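(* Let $n\geq 2$ and $p\geq 1$ be integers and let $c,\tilde c$ be real numbers with $c\neq\tilde c$. Let $M^n_c$ be an $n$-dimensional connected Riemannian manifold of constant sectional curvature $c$, and let $f\colon M^n_c\to\mathbb{Q}^{n+p}_{\tilde c}$ be a substantial isometric immersion into the simply connected space form of dimension $n+p$ and constant sectional curvature $\tilde c$. Assume that the first normal space satisfies $\dim N_1^f(x)=n-1$ at every point $x\in M^n_c$. If $c>\tilde c$, assume also that $f$ is free of weak-umbilic points, that is, no point of $M^n_c$ is a weak-umbilic for $f$. Then $p=n-1$.
   Context: All manifolds and maps are smooth. $\mathbb{Q}^m_{\tilde c}$ denotes the complete simply connected $m$-dimensional space form of constant sectional curvature $\tilde c$: the Euclidean space $\mathbb{R}^m$ if $\tilde c=0$, the Euclidean sphere $\mathbb{S}^m_{\tilde c}$ of sectional curvature $\tilde c$ if $\tilde c>0$, and the hyperbolic space $\mathbb{H}^m_{\tilde c}$ of sectional curvature $\tilde c$ if $\tilde c<0$. For an isometric immersion $f\colon M^n\to\mathbb{Q}^{n+p}_{\tilde c}$, let $N_fM$ denote its normal bundle, with fiber $N_fM(x)$ at $x\in M^n$, and let $\alpha_f\colon TM\times TM\to N_fM$ denote its second fundamental form. For $\zeta\in N_fM(x)$, the shape operator $A_\zeta\colon T_xM\to T_xM$ is defined by $\langle A_\zeta X,Y\rangle=\langle\alpha_f(X,Y),\zeta\rangle$ for all $X,Y\in T_xM$. First normal space: $N_1^f(x)=\mathrm{span}\{\alpha_f(X,Y):X,Y\in T_xM\}\subset N_fM(x)$.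 Weak-umbilic: when $c>\tilde c$, a point $x\in M^n_c$ is called a weak-umbilic for $f\colon M^n_c\to\mathbb{Q}^{n+p}_{\tilde c}$ if there exists a unit normal vector $\zeta\in N_fM(x)$ such that $A_\zeta=\sqrt{c-\tilde c}\,I$, where $I$ is the identity of $T_xM$. Substantial: $f$ is substantial if its codimension cannot be reduced, that is, its image $f(M^n)$ is not contained in any proper totally geodesic submanifold of the ambient space $\mathbb{Q}^{n+p}_{\tilde c}$. *)

theory Defs
  imports "HOL-Analysis.Analysis"
begin

section \<open>Smooth maps between Euclidean spaces\<close>

abbreviation dderiv ::
  "('a::real_normed_vector \<Rightarrow> 'b::real_normed_vector) \<Rightarrow> 'a \<Rightarrow> 'a \<Rightarrow> 'b" where
  "dderiv f x v \<equiv> frechet_derivative f (at x) v"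

text \<open>Both notions below are meant for open sets \<open>S\<close>.\<close>

fun Ck_on :: "nat \<Rightarrow> 'a::real_normed_vector set \<Rightarrow> ('a \<Rightarrow> 'b::real_normed_vector) \<Rightarrow> bool" where
  "Ck_on 0 S f \<longleftrightarrow> continuous_on S f"
| "Ck_on (Suc k) S f \<longleftrightarrow>
     (\<forall>x\<in>S. f differentiable (at x)) \<and> (\<forall>v. Ck_on k S (\<lambda>x. dderiv f x v))"

definition smooth_on :: "'a::real_normed_vector set \<Rightarrow> ('a \<Rightarrow> 'b::real_normed_vector) \<Rightarrow> bool" where
  "smooth_on S f \<longleftrightarrow> (\<forall>k. Ck_on k S f)"


section \<open>Manifolds and Riemannian metrics\<close>

text \<open>
  A manifold is a type \<open>'a::{t2_space,second_countable_topology}\<close> with an atlas modelled on a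
  Euclidean space \<open>'e\<close>, so that its dimension is \<open>DIM('e)\<close>. A chart is a pair \<open>(U, y)\<close> of a domain
  and a coordinate map. In a chart around \<open>x\<close>, the tangent space at \<open>x\<close> is identified with \<open>'e\<close>.
\<close>

type_synonym ('a, 'e) chart = "'a set \<times> ('a \<Rightarrow> 'e)"

definition param :: "('a, 'e) chart \<Rightarrow> 'e \<Rightarrow> 'a" where
  "param \<phi> = inv_into (fst \<phi>) (snd \<phi>)"

definition coord_domain :: "('a, 'e) chart \<Rightarrow> 'e set" where
  "coord_domain \<phi> = snd \<phi> ` fst \<phi>"

definition smooth_atlas ::
  "('a::{t2_space,second_countable_topology}, 'e::euclidean_space) chart set \<Rightarrow> bool" where
  "smooth_atlas \<A> \<longleftrightarrow>
     (\<Union>\<phi>\<in>\<A>. fst \<phi>) = UNIV \<and>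
     (\<forall>\<phi>\<in>\<A>. open (fst \<phi>) \<and> open (coord_domain \<phi>) \<and>
        homeomorphism (fst \<phi>) (coord_domain \<phi>) (snd \<phi>) (param \<phi>)) \<and>
     (\<forall>\<phi>\<in>\<A>. \<forall>\<psi>\<in>\<A>. smooth_on (snd \<phi> ` (fst \<phi> \<inter> fst \<psi>)) (snd \<psi> \<circ> param \<phi>))"

text \<open>
  A metric is given by its coordinate expressions: \<open>g \<phi> \<xi> u v\<close> is the inner product of the tangent
  vectors with coordinates \<open>u\<close>, \<open>v\<close> at the point with coordinates \<open>\<xi>\<close>, all in the chart \<open>\<phi>\<close>.
  The last condition is the transformation rule of covariant 2-tensors.
\<close>

definition riemannian_metric ::
  "('a, 'e::euclidean_space) chart set \<Rightarrow> (('a, 'e) chart \<Rightarrow> 'e \<Rightarrow> 'e \<Rightarrow> 'e \<Rightarrow> real) \<Rightarrow> bool" where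
  "riemannian_metric \<A> g \<longleftrightarrow>
     (\<forall>\<phi>\<in>\<A>. \<forall>\<xi>\<in>coord_domain \<phi>.
        bilinear (g \<phi> \<xi>) \<and> (\<forall>u v. g \<phi> \<xi> u v = g \<phi> \<xi> v u) \<and> (\<forall>u. u \<noteq> 0 \<longrightarrow> g \<phi> \<xi> u u > 0)) \<and>
     (\<forall>\<phi>\<in>\<A>. \<forall>u v. smooth_on (coord_domain \<phi>) (\<lambda>\<xi>. g \<phi> \<xi> u v)) \<and>
     (\<forall>\<phi>\<in>\<A>. \<forall>\<psi>\<in>\<A>. \<forall>x \<in> fst \<phi> \<inter> fst \<psi>. \<forall>u v.
        g \<phi> (snd \<phi> x) u v =
        g \<psi> (snd \<psi> x) (dderiv (snd \<psi> \<circ> param \<phi>) (snd \<phi> x) u)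
                       (dderiv (snd \<psi> \<circ> param \<phi>) (snd \<phi> x) v))"

text \<open>
  In the next three definitions \<open>h\<close> is the coordinate expression of a metric in one chart.
  \<open>christoffel h \<xi> u v\<close> is the Levi-Civita derivative \<open>\<nabla>\<^sub>u v\<close> of constant coordinate fields
  (Koszul formula), and \<open>riemann h \<xi> u v w\<close> is
  \<open>R(u,v)w = \<nabla>\<^sub>u \<nabla>\<^sub>v w - \<nabla>\<^sub>v \<nabla>\<^sub>u w\<close> for such fields.
\<close>

definition christoffel ::
  "('e::euclidean_space \<Rightarrow> 'e \<Rightarrow> 'e \<Rightarrow> real) \<Rightarrow> 'e \<Rightarrow> 'e \<Rightarrow> 'e \<Rightarrow> 'e" where
  "christoffel h \<xi> u v =
     (THE z. \<forall>w. h \<xi> z w =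
        (dderiv (\<lambda>y. h y v w) \<xi> u + dderiv (\<lambda>y. h y u w) \<xi> v - dderiv (\<lambda>y. h y u v) \<xi> w) / 2)"

definition riemann ::
  "('e::euclidean_space \<Rightarrow> 'e \<Rightarrow> 'e \<Rightarrow> real) \<Rightarrow> 'e \<Rightarrow> 'e \<Rightarrow> 'e \<Rightarrow> 'e \<Rightarrow> 'e" where
  "riemann h \<xi> u v w =
     dderiv (\<lambda>y. christoffel h y v w) \<xi> u + christoffel h \<xi> u (christoffel h \<xi> v w)
     - dderiv (\<lambda>y. christoffel h y u w) \<xi> v - christoffel h \<xi> v (christoffel h \<xi> u w)"

definition sectional_curvature ::
  "('e::euclidean_space \<Rightarrow> 'e \<Rightarrow> 'e \<Rightarrow> real) \<Rightarrow> 'e \<Rightarrow> 'e \<Rightarrow> 'e \<Rightarrow> real" where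
  "sectional_curvature h \<xi> u v =
     h \<xi> (riemann h \<xi> u v v) u / (h \<xi> u u * h \<xi> v v - (h \<xi> u v)\<^sup>2)"

definition constant_sectional_curvature ::
  "('a, 'e::euclidean_space) chart set \<Rightarrow> (('a, 'e) chart \<Rightarrow> 'e \<Rightarrow> 'e \<Rightarrow> 'e \<Rightarrow> real) \<Rightarrow> real \<Rightarrow> bool" where
  "constant_sectional_curvature \<A> g c \<longleftrightarrow>
     (\<forall>\<phi>\<in>\<A>. \<forall>\<xi>\<in>coord_domain \<phi>. \<forall>u v. u \<noteq> v \<and> independent {u, v} \<longrightarrow>
        sectional_curvature (g \<phi>) \<xi> u v = c)"


section \<open>Space forms\<close>

text \<open>
  With \<open>m = DIM('q)\<close>, all the space forms of dimension \<open>m\<close> are realised in \<open>'q \<times> real\<close>: the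
  hyperplane \<open>'q \<times> {0}\<close> for \<open>k = 0\<close>, the round sphere of radius \<open>1 / sqrt k\<close> for \<open>k > 0\<close>, and one
  sheet of a hyperboloid in Lorentzian space for \<open>k < 0\<close>. The form below is degenerate for \<open>k = 0\<close>,
  but for every \<open>k\<close> it restricts to an inner product on the tangent spaces of \<open>space_form k\<close>.
\<close>

definition ambient_form :: "real \<Rightarrow> 'q::euclidean_space \<times> real \<Rightarrow> 'q \<times> real \<Rightarrow> real" where
  "ambient_form k z w = fst z \<bullet> fst w + sgn k * (snd z * snd w)"

definition space_form :: "real \<Rightarrow> ('q::euclidean_space \<times> real) set" where
  "space_form k =
     (if k = 0 then {z. snd z = 0}
      else {z. ambient_form k z z = 1 / k \<and> (k < 0 \<longrightarrow> snd z > 0)})"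

definition tangent_space :: "'v::euclidean_space set \<Rightarrow> 'v \<Rightarrow> 'v set" where
  "tangent_space S z =
     {v. \<exists>\<gamma> \<epsilon>. \<epsilon> > 0 \<and> smooth_on {-\<epsilon><..<\<epsilon>::real} \<gamma> \<and> \<gamma> ` {-\<epsilon><..<\<epsilon>} \<subseteq> S \<and>
        \<gamma> 0 = z \<and> (\<gamma> has_vector_derivative v) (at 0)}"

definition orth_proj ::
  "real \<Rightarrow> ('q::euclidean_space \<times> real) set \<Rightarrow> 'q \<times> real \<Rightarrow> 'q \<times> real" where
  "orth_proj k W z = (THE w. w \<in> W \<and> (\<forall>v\<in>W. ambient_form k (z - w) v = 0))"

text \<open>
  The Levi-Civita derivative of \<open>space_form k\<close> is the tangential part of the flat derivative;
  \<open>space_form_cov k z w\<close> takes this part of a flat derivative \<open>w\<close> at the base point \<open>z\<close>.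
\<close>

definition space_form_cov :: "real \<Rightarrow> 'q::euclidean_space \<times> real \<Rightarrow> 'q \<times> real \<Rightarrow> 'q \<times> real" where
  "space_form_cov k z w = orth_proj k (tangent_space (space_form k) z) w"

text \<open>Embedded submanifolds of a Euclidean space, by slice charts.\<close>

definition embedded_submanifold :: "nat \<Rightarrow> 'v::euclidean_space set \<Rightarrow> bool" where
  "embedded_submanifold d S \<longleftrightarrow>
     (\<forall>x\<in>S. \<exists>U V \<Phi> \<Psi> L. open U \<and> x \<in> U \<and> open (V :: 'v set) \<and> homeomorphism U V \<Phi> \<Psi> \<and>
        smooth_on U \<Phi> \<and> smooth_on V \<Psi> \<and> subspace L \<and> dim L = d \<and> \<Phi> ` (S \<inter> U) = L \<inter> V)"

text \<open>
  The second fundamental form of \<open>S\<close> in \<open>space_form k\<close> vanishes iff the Levi-Civita derivative of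
  the space form, taken along \<open>S\<close>, maps fields tangent to \<open>S\<close> to vectors tangent to \<open>S\<close>.
\<close>

definition totally_geodesic_submanifold ::
  "real \<Rightarrow> nat \<Rightarrow> ('q::euclidean_space \<times> real) set \<Rightarrow> bool" where
  "totally_geodesic_submanifold k d S \<longleftrightarrow>
     embedded_submanifold d S \<and> S \<subseteq> space_form k \<and>
     (\<forall>z\<in>S. \<forall>u\<in>tangent_space S z. \<forall>U Y.
        open U \<and> z \<in> U \<and> smooth_on U Y \<and> (\<forall>y \<in> S \<inter> U. Y y \<in> tangent_space S y) \<longrightarrow>
        space_form_cov k z (dderiv Y z u) \<in> tangent_space S z)"


section \<open>Isometric immersions into space forms\<close>

definition isometric_immersion ::
  "('a, 'e::euclidean_space) chart set \<Rightarrow> (('a, 'e) chart \<Rightarrow> 'e \<Rightarrow> 'e \<Rightarrow> 'e \<Rightarrow> real) \<Rightarrow> real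
   \<Rightarrow> ('a \<Rightarrow> 'q::euclidean_space \<times> real) \<Rightarrow> bool" where
  "isometric_immersion \<A> g k f \<longleftrightarrow>
     range f \<subseteq> space_form k \<and>
     (\<forall>\<phi>\<in>\<A>. smooth_on (coord_domain \<phi>) (f \<circ> param \<phi>) \<and>
        (\<forall>\<xi>\<in>coord_domain \<phi>. inj (dderiv (f \<circ> param \<phi>) \<xi>) \<and>
           (\<forall>u v. ambient_form k (dderiv (f \<circ> param \<phi>) \<xi> u) (dderiv (f \<circ> param \<phi>) \<xi> v)
                  = g \<phi> \<xi> u v)))"

text \<open>Here "proper" is read as being of smaller dimension: an open subset is not proper.\<close>

definition substantial :: "real \<Rightarrow> ('a \<Rightarrow> 'q::euclidean_space \<times> real) \<Rightarrow> bool" where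
  "substantial k f \<longleftrightarrow>
     \<not> (\<exists>d S. d < DIM('q) \<and> totally_geodesic_submanifold k d S \<and> range f \<subseteq> S)"

definition normal_space ::
  "('a, 'e::euclidean_space) chart set \<Rightarrow> real \<Rightarrow> ('a \<Rightarrow> 'q::euclidean_space \<times> real) \<Rightarrow> 'a
   \<Rightarrow> ('q \<times> real) set" where
  "normal_space \<A> k f x =
     {\<eta> \<in> tangent_space (space_form k) (f x).
        \<forall>\<phi>\<in>\<A>. x \<in> fst \<phi> \<longrightarrow> (\<forall>u. ambient_form k \<eta> (dderiv (f \<circ> param \<phi>) (snd \<phi> x) u) = 0)}"

text \<open>
  \<open>second_ff \<A> k f \<phi> x u v\<close> is \<open>\<alpha>\<^sub>f(u,v)\<close> for the tangent vectors at \<open>x\<close> with coordinates \<open>u\<close>, \<open>v\<close>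
  in \<open>\<phi>\<close>: the normal component of the ambient covariant derivative in the direction \<open>u\<close> of the
  image under \<open>f\<close> of the constant coordinate field \<open>v\<close>.
\<close>

definition second_ff ::
  "('a, 'e::euclidean_space) chart set \<Rightarrow> real \<Rightarrow> ('a \<Rightarrow> 'q::euclidean_space \<times> real)
   \<Rightarrow> ('a, 'e) chart \<Rightarrow> 'a \<Rightarrow> 'e \<Rightarrow> 'e \<Rightarrow> 'q \<times> real" where
  "second_ff \<A> k f \<phi> x u v =
     orth_proj k (normal_space \<A> k f x)
       (space_form_cov k (f x) (dderiv (\<lambda>\<xi>. dderiv (f \<circ> param \<phi>) \<xi> v) (snd \<phi> x) u))"

text \<open>The values of \<open>\<alpha>\<^sub>f\<close> do not depend on the chart, so any charts around \<open>x\<close> may be used.\<close>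

definition first_normal_space ::
  "('a, 'e::euclidean_space) chart set \<Rightarrow> real \<Rightarrow> ('a \<Rightarrow> 'q::euclidean_space \<times> real) \<Rightarrow> 'a
   \<Rightarrow> ('q \<times> real) set" where
  "first_normal_space \<A> k f x =
     span {second_ff \<A> k f \<phi> x u v | \<phi> u v. \<phi> \<in> \<A> \<and> x \<in> fst \<phi>}"

definition shape_operator ::
  "('a, 'e::euclidean_space) chart set \<Rightarrow> (('a, 'e) chart \<Rightarrow> 'e \<Rightarrow> 'e \<Rightarrow> 'e \<Rightarrow> real) \<Rightarrow> real
   \<Rightarrow> ('a \<Rightarrow> 'q::euclidean_space \<times> real) \<Rightarrow> ('a, 'e) chart \<Rightarrow> 'a \<Rightarrow> 'q \<times> real \<Rightarrow> 'e \<Rightarrow> 'e" where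
  "shape_operator \<A> g k f \<phi> x \<zeta> =
     (THE B. \<forall>u v. g \<phi> (snd \<phi> x) (B u) v = ambient_form k (second_ff \<A> k f \<phi> x u v) \<zeta>)"

definition weak_umbilic ::
  "('a, 'e::euclidean_space) chart set \<Rightarrow> (('a, 'e) chart \<Rightarrow> 'e \<Rightarrow> 'e \<Rightarrow> 'e \<Rightarrow> real) \<Rightarrow> real \<Rightarrow> real
   \<Rightarrow> ('a \<Rightarrow> 'q::euclidean_space \<times> real) \<Rightarrow> 'a \<Rightarrow> bool" where
  "weak_umbilic \<A> g c k f x \<longleftrightarrow>
     (\<exists>\<zeta>\<in>normal_space \<A> k f x. ambient_form k \<zeta> \<zeta> = 1 \<and>
        (\<exists>\<phi>\<in>\<A>. x \<in> fst \<phi> \<and> shape_operator \<A> g k f \<phi> x \<zeta> = (\<lambda>u. sqrt (c - k) *\<^sub>R u)))"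

end

theory Submission
  imports Defs
begin

text \<open>
  Write \<open>h\<close> for the metric and \<open>\<alpha>\<close> for the second fundamental form. By the Gauss equation the
  bilinear form \<open>\<beta> = (\<alpha>, h)\<close> is flat for the form \<open>\<langle>a, b\<rangle> - (c - k) s t\<close> on \<open>N\<^sub>1 \<times> \<real>\<close>, whose
  dimension is \<open>n\<close>. If \<open>\<beta>(X, \<cdot>)\<close> has maximal rank and \<open>\<beta>(X, Y) = 0\<close> with \<open>Y \<noteq> 0\<close>, then \<open>\<beta>(Y, Y)\<close> is a
  null vector orthogonal to the image of \<open>\<beta>\<close>, that is, a weak-umbilic direction; so \<open>\<beta>(X, \<cdot>)\<close> is
  bijective. Differentiating sections of the second osculating space modulo this space gives
  functionals \<open>\<mu>\<^sub>w\<close> on \<open>N\<^sub>1\<close> for which \<open>\<mu>\<^sub>w(\<alpha>(u, v))\<close> is totally symmetric. Represent \<open>\<mu>\<^sub>X\<close> by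
  \<open>\<beta>(X, Z)\<close>. Flatness shows that \<open>\<beta>(Y, Z)\<close> represents \<open>\<mu>\<^sub>Y\<close> for every \<open>Y\<close>, and since \<open>\<mu>\<^sub>Y\<close> vanishes on
  \<open>(0, 1)\<close>, this forces \<open>h(Y, Z) = 0\<close>, hence \<open>Z = 0\<close> and \<open>\<mu> = 0\<close>. So the second osculating space is
  parallel, of dimension \<open>2 n\<close>, hence a constant linear space \<open>L\<close>, and the image of \<open>f\<close> lies in the
  totally geodesic section of the space form by \<open>L\<close>, which has dimension \<open>2 n - 1\<close>.
\<close>

section \<open>Calculus of smooth maps\<close>

text \<open>The ambient space is flat, so the variation of the osculating spaces is computed with
  ordinary derivatives of the immersion in coordinates; a normal connection never appears. The
  obstacle is that these spaces come with generators but without a preferred frame. Constancy of the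
  rank makes up for it, through local frames with bounded coefficients and limits of difference
  quotients. The osculating space includes the position vector (shifted when \<open>k = 0\<close>),
  so its dimension is 1 + n + (n - 1) and it cuts out a section of the space form. The hypothesis on
  the first normal space enters twice: as constant rank, and as the dimension count that turns
  injectivity of \<beta>(X, .) into surjectivity. The two inequalities for \<open>p\<close> have
  different sources: substantiality excludes 2 n - 1 < n + p, while L being a subspace of the
  ambient space of dimension n + p + 1 gives 2 n \<le> n + p + 1.\<close>

lemma dderiv_eqI: "(f has_derivative D) (at x) \<Longrightarrow> dderiv f x = D"
  using frechet_derivative_at by metis

lemma dderiv_works: "f differentiable (at x) \<Longrightarrow> (f has_derivative dderiv f x) (at x)"
  using frechet_derivative_works by blast

lemma has_derivative_cong_open:
  assumes "open S" "x \<in> S" "\<And>y. y \<in> S \<Longrightarrow> f y = g y"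
  shows "(f has_derivative D) (at x) \<longleftrightarrow> (g has_derivative D) (at x)"
  using has_derivative_transform_within_open[of f D x UNIV S g]
    has_derivative_transform_within_open[of g D x UNIV S f] assms by auto

lemma differentiable_cong_open:
  assumes "open S" "x \<in> S" "\<And>y. y \<in> S \<Longrightarrow> f y = g y"
  shows "f differentiable (at x) \<longleftrightarrow> g differentiable (at x)"
  unfolding differentiable_def using has_derivative_cong_open[OF assms] by simp

lemma dderiv_cong_open:
  assumes "open S" "x \<in> S" "\<And>y. y \<in> S \<Longrightarrow> f y = g y"
  shows "dderiv f x = dderiv g x"
  unfolding frechet_derivative_def using has_derivative_cong_open[OF assms] by simp

section \<open>Closure properties of C^k and smooth maps\<close>

lemma Ck_on_cong:
  assumes "open S" "\<And>x. x \<in> S \<Longrightarrow> f x = g x"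
  shows "Ck_on k S f \<longleftrightarrow> Ck_on k S g"
  using assms(2)
proof (induction k arbitrary: f g)
  case 0
  then show ?case by (simp cong: continuous_on_cong)
next
  case (Suc k)
  have "f differentiable (at x) \<longleftrightarrow> g differentiable (at x)" if "x \<in> S" for x
    using differentiable_cong_open[OF assms(1) that] Suc.prems by blast
  moreover have "Ck_on k S (\<lambda>x. dderiv f x v) \<longleftrightarrow> Ck_on k S (\<lambda>x. dderiv g x v)" for v
  proof (rule Suc.IH)
    show "dderiv f x v = dderiv g x v" if "x \<in> S" for x
      using dderiv_cong_open[OF assms(1) that, of f g] Suc.prems by simp
  qed
  ultimately show ?case by simp
qed

lemma Ck_on_Suc_imp: "Ck_on (Suc k) S f \<Longrightarrow> Ck_on k S f"
proof (induction k arbitrary: f)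
  case 0
  then show ?case
    by (auto intro!: continuous_at_imp_continuous_on differentiable_imp_continuous_within)
next
  case (Suc k)
  have *: "(\<forall>x\<in>S. f differentiable (at x)) \<and> (\<forall>v. Ck_on (Suc k) S (\<lambda>x. dderiv f x v))"
    using Suc.prems Ck_on.simps(2) by blast
  have "Ck_on k S (\<lambda>x. dderiv f x v)" for v
    using * by (intro Suc.IH) blast
  with * show ?case using Ck_on.simps(2) by blast
qed

lemma Ck_on_const [simp]: "Ck_on k S (\<lambda>x. c)"
  by (induction k arbitrary: c) auto

lemma Ck_on_add:
  assumes "open S" "Ck_on k S f" "Ck_on k S g"
  shows "Ck_on k S (\<lambda>x. f x + g x)"
  using assms(2,3)
proof (induction k arbitrary: f g)
  case 0
  then show ?case by (simp add: continuous_on_add)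
next
  case (Suc k)
  have d: "((\<lambda>x. f x + g x) has_derivative (\<lambda>v. dderiv f x v + dderiv g x v)) (at x)" if "x \<in> S" for x
    using that Suc.prems by (auto intro!: has_derivative_add dderiv_works)
  have "Ck_on k S (\<lambda>x. dderiv (\<lambda>x. f x + g x) x v)" for v
  proof (subst Ck_on_cong[OF assms(1)])
    show "dderiv (\<lambda>x. f x + g x) x v = dderiv f x v + dderiv g x v" if "x \<in> S" for x
      using dderiv_eqI[OF d[OF that]] by simp
    show "Ck_on k S (\<lambda>x. dderiv f x v + dderiv g x v)"
      using Suc by simp
  qed
  with d show ?case by (auto simp: differentiable_def)
qed

lemma Ck_on_bounded_linear:
  assumes "open S" "bounded_linear h" "Ck_on k S f"
  shows "Ck_on k S (\<lambda>x. h (f x))"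
  using assms(3)
proof (induction k arbitrary: f)
  case 0
  then show ?case using assms(2) by (simp add: bounded_linear.continuous_on)
next
  case (Suc k)
  have d: "((\<lambda>x. h (f x)) has_derivative (\<lambda>v. h (dderiv f x v))) (at x)" if "x \<in> S" for x
    using that Suc.prems by (auto intro!: bounded_linear.has_derivative[OF assms(2)] dderiv_works)
  have "Ck_on k S (\<lambda>x. dderiv (\<lambda>x. h (f x)) x v)" for v
  proof (subst Ck_on_cong[OF assms(1)])
    show "dderiv (\<lambda>x. h (f x)) x v = h (dderiv f x v)" if "x \<in> S" for x
      using dderiv_eqI[OF d[OF that]] by simp
    show "Ck_on k S (\<lambda>x. h (dderiv f x v))"
      using Suc by simp
  qed
  with d show ?case by (auto simp: differentiable_def)
qed

text \<open>The product rule leaves one factor undifferentiated in each term, so the induction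
  hypothesis is applied to one derivative and one factor lowered to C^k by
  \<open>Ck_on_Suc_imp\<close>.\<close>

lemma Ck_on_bounded_bilinear:
  assumes "open S" "bounded_bilinear m" "Ck_on k S f" "Ck_on k S g"
  shows "Ck_on k S (\<lambda>x. m (f x) (g x))"
  using assms(3,4)
proof (induction k arbitrary: f g)
  case 0
  then show ?case using assms(2) by (simp add: bounded_bilinear.continuous_on)
next
  case (Suc k)
  have d: "((\<lambda>x. m (f x) (g x)) has_derivative (\<lambda>v. m (f x) (dderiv g x v) + m (dderiv f x v) (g x))) (at x)"
    if "x \<in> S" for x
    using that Suc.prems by (auto intro!: bounded_bilinear.FDERIV[OF assms(2)] dderiv_works)
  have "Ck_on k S (\<lambda>x. dderiv (\<lambda>x. m (f x) (g x)) x v)" for v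
  proof (subst Ck_on_cong[OF assms(1)])
    show "dderiv (\<lambda>x. m (f x) (g x)) x v = m (f x) (dderiv g x v) + m (dderiv f x v) (g x)" if "x \<in> S" for x
      using dderiv_eqI[OF d[OF that]] by simp
    show "Ck_on k S (\<lambda>x. m (f x) (dderiv g x v) + m (dderiv f x v) (g x))"
      using Suc.prems Ck_on_Suc_imp[OF Suc.prems(1)] Ck_on_Suc_imp[OF Suc.prems(2)]
      by (intro Ck_on_add[OF assms(1)] Suc.IH) auto
  qed
  with d show ?case by (auto simp: differentiable_def)
qed

lemma Ck_on_ident [simp]: "Ck_on k S (\<lambda>x. x)"
  by (cases k) auto

text \<open>The exponent is general because differentiation lowers it by one: square roots alone
  would not survive the induction on \<open>k\<close>.\<close>

lemma Ck_on_powr: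
  fixes q :: "'a::real_normed_vector \<Rightarrow> real"
  assumes "open S" "Ck_on k S q" "\<And>x. x \<in> S \<Longrightarrow> q x > 0"
  shows "Ck_on k S (\<lambda>x. q x powr a)"
  using assms(2)
proof (induction k arbitrary: a)
  case 0
  have "q x \<noteq> 0" if "x \<in> S" for x using assms(3)[OF that] by simp
  with 0 show ?case by (auto intro!: continuous_on_powr continuous_intros)
next
  case (Suc k)
  have d: "((\<lambda>x. q x powr a) has_derivative (\<lambda>v. a * q x powr (a - 1) * dderiv q x v)) (at x)"
    if "x \<in> S" for x
  proof -
    have "((\<lambda>y. y powr a) has_derivative (\<lambda>v. (a * q x powr (a - 1)) * v)) (at (q x))"
      using has_real_derivative_powr[OF assms(3)[OF that], of a]
      by (simp add: has_field_derivative_def)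
    moreover have "(q has_derivative dderiv q x) (at x)"
      using that Suc.prems by (auto intro!: dderiv_works)
    ultimately show ?thesis
      using has_derivative_compose[of q "dderiv q x" x UNIV "\<lambda>y. y powr a"] by simp
  qed
  have "Ck_on k S (\<lambda>x. dderiv (\<lambda>x. q x powr a) x v)" for v
  proof (subst Ck_on_cong[OF assms(1)])
    show "dderiv (\<lambda>x. q x powr a) x v = (a * q x powr (a - 1)) * dderiv q x v" if "x \<in> S" for x
      using dderiv_eqI[OF d[OF that]] by simp
    show "Ck_on k S (\<lambda>x. (a * q x powr (a - 1)) * dderiv q x v)"
      using Suc.prems Ck_on_Suc_imp[OF Suc.prems]
      by (intro Ck_on_bounded_bilinear[OF assms(1) bounded_bilinear_mult]) (auto intro: Suc.IH)
  qed
  with d show ?case by (auto simp: differentiable_def)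
qed

lemma smooth_on_Ck: "smooth_on S f \<Longrightarrow> Ck_on k S f"
  by (simp add: smooth_on_def)

lemma smooth_on_differentiable: "smooth_on S f \<Longrightarrow> x \<in> S \<Longrightarrow> f differentiable (at x)"
  using smooth_on_Ck[of S f 1] by simp

lemma smooth_on_has_derivative: "smooth_on S f \<Longrightarrow> x \<in> S \<Longrightarrow> (f has_derivative dderiv f x) (at x)"
  by (simp add: dderiv_works smooth_on_differentiable)

lemma smooth_on_linear: "smooth_on S f \<Longrightarrow> x \<in> S \<Longrightarrow> linear (dderiv f x)"
  by (simp add: linear_frechet_derivative smooth_on_differentiable)

lemma smooth_on_dderiv: "smooth_on S f \<Longrightarrow> smooth_on S (\<lambda>x. dderiv f x v)"
  unfolding smooth_on_def by (metis Ck_on.simps(2))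

lemma smooth_on_continuous: "smooth_on S f \<Longrightarrow> continuous_on S f"
  using smooth_on_Ck[of S f 0] by simp

lemma smooth_on_add:
  "open S \<Longrightarrow> smooth_on S f \<Longrightarrow> smooth_on S g \<Longrightarrow> smooth_on S (\<lambda>x. f x + g x)"
  by (simp add: smooth_on_def Ck_on_add)

lemma smooth_on_const [simp]: "smooth_on S (\<lambda>x. c)"
  by (simp add: smooth_on_def)

lemma smooth_on_ident [simp]: "smooth_on S (\<lambda>x. x)"
  by (simp add: smooth_on_def)

lemma smooth_on_bounded_linear:
  "open S \<Longrightarrow> bounded_linear h \<Longrightarrow> smooth_on S f \<Longrightarrow> smooth_on S (\<lambda>x. h (f x))"
  by (simp add: smooth_on_def Ck_on_bounded_linear)

lemma smooth_on_bounded_bilinear: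
  "open S \<Longrightarrow> bounded_bilinear m \<Longrightarrow> smooth_on S f \<Longrightarrow> smooth_on S g \<Longrightarrow> smooth_on S (\<lambda>x. m (f x) (g x))"
  by (simp add: smooth_on_def Ck_on_bounded_bilinear)

lemma smooth_on_diff:
  fixes f g :: "'a::real_normed_vector \<Rightarrow> 'b::real_normed_vector"
  assumes "open S" "smooth_on S f" "smooth_on S g"
  shows "smooth_on S (\<lambda>x. f x - g x)"
  using smooth_on_add[OF assms(1,2) smooth_on_bounded_linear[OF assms(1) _ assms(3), of uminus]]
  by (simp add: bounded_linear_minus[OF bounded_linear_ident])

lemma smooth_on_scaleR: "open S \<Longrightarrow> smooth_on S f \<Longrightarrow> smooth_on S (\<lambda>x. f x *\<^sub>R v)"
  by (rule smooth_on_bounded_linear[OF _ bounded_linear_scaleR_left])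

lemma smooth_on_mult:
  fixes f g :: "'a::real_normed_vector \<Rightarrow> real"
  shows "open S \<Longrightarrow> smooth_on S f \<Longrightarrow> smooth_on S g \<Longrightarrow> smooth_on S (\<lambda>x. f x * g x)"
  by (rule smooth_on_bounded_bilinear[OF _ bounded_bilinear_mult])

lemma smooth_on_sqrt:
  fixes q :: "'a::real_normed_vector \<Rightarrow> real"
  assumes "open S" "smooth_on S q" "\<And>x. x \<in> S \<Longrightarrow> q x > 0"
  shows "smooth_on S (\<lambda>x. sqrt (q x))"
proof -
  have "Ck_on k S (\<lambda>x. sqrt (q x))" for k
    using Ck_on_powr[OF assms(1) smooth_on_Ck[OF assms(2)] assms(3), of k "1/2"]
    by (subst Ck_on_cong[OF assms(1), of _ "\<lambda>x. q x powr (1/2)"])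
      (auto simp: powr_half_sqrt less_imp_le assms(3))
  then show ?thesis by (simp add: smooth_on_def)
qed

section \<open>Derivatives along lines and symmetry of second derivatives\<close>

lemma dderiv_bounded_linear:
  assumes "bounded_linear h" "f differentiable (at x)"
  shows "dderiv (\<lambda>y. h (f y)) x v = h (dderiv f x v)"
  using dderiv_eqI[OF bounded_linear.has_derivative[OF assms(1) dderiv_works[OF assms(2)]]] by simp

lemma has_vector_derivative_line:
  assumes "(f has_derivative D) (at (x + t *\<^sub>R v))"
  shows "((\<lambda>s. f (x + s *\<^sub>R v)) has_vector_derivative D v) (at t)"
proof -
  have "((\<lambda>s. x + s *\<^sub>R v) has_derivative (\<lambda>s. s *\<^sub>R v)) (at t)"
    by (auto intro!: derivative_eq_intros)
  from has_derivative_compose[OF this, of f D] assms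
  have "((\<lambda>s. f (x + s *\<^sub>R v)) has_derivative (\<lambda>s. D (s *\<^sub>R v))) (at t)" by simp
  then show ?thesis
    using linear_scale[OF has_derivative_linear[OF assms]] by (simp add: has_vector_derivative_def)
qed

text \<open>The mean value theorem is applied twice: along \<open>u\<close> to the increment of
  \<open>g\<close> in direction \<open>v\<close>, then along \<open>v\<close> to the derivative in
  direction \<open>u\<close>. Since the second difference is symmetric in \<open>u\<close> and
  \<open>v\<close>, this leads to Schwarz's theorem.\<close>

lemma second_difference_mean_value:
  fixes g :: "'a::real_normed_vector \<Rightarrow> real"
  assumes t: "t > 0"
    and g: "\<And>a b. \<lbrakk>0 \<le> a; a \<le> t; 0 \<le> b; b \<le> t\<rbrakk> \<Longrightarrow>
        g differentiable (at (x + a *\<^sub>R u + b *\<^sub>R v)) \<and>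
        (\<lambda>y. dderiv g y u) differentiable (at (x + a *\<^sub>R u + b *\<^sub>R v))"
  shows "\<exists>a b. 0 \<le> a \<and> a \<le> t \<and> 0 \<le> b \<and> b \<le> t \<and>
     g (x + t *\<^sub>R u + t *\<^sub>R v) - g (x + t *\<^sub>R u) - g (x + t *\<^sub>R v) + g x
     = t * t * dderiv (\<lambda>y. dderiv g y u) (x + a *\<^sub>R u + b *\<^sub>R v) v"
proof -
  define \<phi> where "\<phi> s = g ((x + t *\<^sub>R v) + s *\<^sub>R u) - g (x + s *\<^sub>R u)" for s
  define \<phi>' where "\<phi>' s = dderiv g ((x + t *\<^sub>R v) + s *\<^sub>R u) u - dderiv g (x + s *\<^sub>R u) u" for s
  have "DERIV \<phi> s :> \<phi>' s" if "0 \<le> s" "s \<le> t" for s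
  proof -
    have "g differentiable (at ((x + t *\<^sub>R v) + s *\<^sub>R u))" "g differentiable (at (x + s *\<^sub>R u))"
      using g[of s t] g[of s 0] that t by (auto simp: algebra_simps)
    then show ?thesis unfolding \<phi>_def \<phi>'_def has_real_derivative_iff_has_vector_derivative
      by (intro has_vector_derivative_diff has_vector_derivative_line dderiv_works)
  qed
  from MVT2[OF t this] obtain a where a: "0 < a" "a < t" "\<phi> t - \<phi> 0 = (t - 0) * \<phi>' a" by blast
  define h where "h b = dderiv g ((x + a *\<^sub>R u) + b *\<^sub>R v) u" for b
  have "DERIV h b :> dderiv (\<lambda>y. dderiv g y u) ((x + a *\<^sub>R u) + b *\<^sub>R v) v" if "0 \<le> b" "b \<le> t" for b
    unfolding h_def has_real_derivative_iff_has_vector_derivative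
    using g[of a b] that a by (intro has_vector_derivative_line dderiv_works) auto
  from MVT2[OF t this] obtain b where b: "0 < b" "b < t"
    "h t - h 0 = (t - 0) * dderiv (\<lambda>y. dderiv g y u) ((x + a *\<^sub>R u) + b *\<^sub>R v) v" by blast
  have "\<phi>' a = h t - h 0" by (simp add: \<phi>'_def h_def algebra_simps)
  with a b show ?thesis
    by (intro exI[of _ a] exI[of _ b]) (auto simp: \<phi>_def algebra_simps)
qed

lemma symmetric_second_derivative_real:
  fixes g :: "'a::real_normed_vector \<Rightarrow> real"
  assumes S: "open S" "x \<in> S" and g: "Ck_on 2 S g"
  shows "dderiv (\<lambda>y. dderiv g y u) x v = dderiv (\<lambda>y. dderiv g y v) x u"
proof (rule ccontr)
  define A where "A y = dderiv (\<lambda>y. dderiv g y u) y v" for y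
  define B where "B y = dderiv (\<lambda>y. dderiv g y v) y u" for y
  assume ne: "\<not> ?thesis"
  have g2: "Ck_on (Suc (Suc 0)) S g" using g by (simp add: numeral_2_eq_2)
  have c: "continuous_on S A" "continuous_on S B" using g2 by (auto simp: A_def B_def)
  \<comment> \<open>A value of \<open>A\<close> will equal a value of \<open>B\<close>, each within
    \<open>e\<close> of the value at \<open>x\<close>, so the gap would be less than
    \<open>2 * e\<close>.\<close>
  define e where "e = \<bar>A x - B x\<bar> / 2"
  have e: "e > 0" using ne by (auto simp: e_def A_def B_def)
  obtain d where d: "d > 0" "ball x d \<subseteq> S" using S openE by blast
  obtain d1 where d1: "d1 > 0" "\<And>y. y \<in> S \<Longrightarrow> dist y x < d1 \<Longrightarrow> dist (A y) (A x) < e"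
    using c(1) S(2) e unfolding continuous_on_iff by blast
  obtain d2 where d2: "d2 > 0" "\<And>y. y \<in> S \<Longrightarrow> dist y x < d2 \<Longrightarrow> dist (B y) (B x) < e"
    using c(2) S(2) e unfolding continuous_on_iff by blast
  define r where "r = Min {d, d1, d2}"
  have r: "r > 0" "r \<le> d" "r \<le> d1" "r \<le> d2" using d d1 d2 by (auto simp: r_def)
  \<comment> \<open>Keeps the parallelogram with sides \<open>t *\<^sub>R u\<close> and
    \<open>t *\<^sub>R v\<close> within \<open>r / 2\<close> of \<open>x\<close>; the summand 1
    avoids division by zero.\<close>
  define t where "t = r / (2 * (norm u + norm v + 1))"
  have N: "norm u + norm v + 1 > 0" by (meson add_nonneg_pos add_nonneg_nonneg norm_ge_zero zero_less_one)
  have t: "t > 0" using r N by (auto simp: t_def)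
  have near: "dist (x + a *\<^sub>R u + b *\<^sub>R v) x < r" if "0 \<le> a" "a \<le> t" "0 \<le> b" "b \<le> t" for a b
  proof -
    have "dist (x + a *\<^sub>R u + b *\<^sub>R v) x = norm (a *\<^sub>R u + b *\<^sub>R v)" by (simp add: dist_norm)
    also have "\<dots> \<le> a * norm u + b * norm v"
      using that norm_triangle_ineq[of "a *\<^sub>R u" "b *\<^sub>R v"] by simp
    also have "\<dots> \<le> t * norm u + t * norm v" using that by (intro add_mono mult_right_mono) auto
    also have "\<dots> \<le> t * (norm u + norm v + 1)" using t by (simp add: algebra_simps)
    also have "\<dots> = r / 2"
    proof -
      define q where "q = norm u + norm v + 1"
      show ?thesis unfolding t_def q_def[symmetric] using N[folded q_def] by simp
    qed
    finally show ?thesis using r by simp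
  qed
  have inS: "x + a *\<^sub>R u + b *\<^sub>R v \<in> S" if "0 \<le> a" "a \<le> t" "0 \<le> b" "b \<le> t" for a b
    using near[OF that] d r by (auto simp: subset_iff dist_commute)
  have "\<exists>a b. 0 \<le> a \<and> a \<le> t \<and> 0 \<le> b \<and> b \<le> t \<and>
     g (x + t *\<^sub>R u + t *\<^sub>R v) - g (x + t *\<^sub>R u) - g (x + t *\<^sub>R v) + g x
     = t * t * dderiv (\<lambda>y. dderiv g y u) (x + a *\<^sub>R u + b *\<^sub>R v) v"
    using g2 inS t by (intro second_difference_mean_value) auto
  then obtain a b where ab: "0 \<le> a" "a \<le> t" "0 \<le> b" "b \<le> t"
     "g (x + t *\<^sub>R u + t *\<^sub>R v) - g (x + t *\<^sub>R u) - g (x + t *\<^sub>R v) + g x = t * t * A (x + a *\<^sub>R u + b *\<^sub>R v)"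
    unfolding A_def by blast
  have sw: "x + a *\<^sub>R v + b *\<^sub>R u = x + b *\<^sub>R u + a *\<^sub>R v" for a b by simp
  have "\<exists>a b. 0 \<le> a \<and> a \<le> t \<and> 0 \<le> b \<and> b \<le> t \<and>
     g (x + t *\<^sub>R v + t *\<^sub>R u) - g (x + t *\<^sub>R v) - g (x + t *\<^sub>R u) + g x
     = t * t * dderiv (\<lambda>y. dderiv g y v) (x + a *\<^sub>R v + b *\<^sub>R u) u"
    using g2 inS t by (intro second_difference_mean_value) (auto simp: sw)
  then obtain a' b' where ab': "0 \<le> a'" "a' \<le> t" "0 \<le> b'" "b' \<le> t"
     "g (x + t *\<^sub>R v + t *\<^sub>R u) - g (x + t *\<^sub>R v) - g (x + t *\<^sub>R u) + g x = t * t * B (x + b' *\<^sub>R u + a' *\<^sub>R v)"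
    unfolding B_def sw by blast
  have "t * t * A (x + a *\<^sub>R u + b *\<^sub>R v) = t * t * B (x + b' *\<^sub>R u + a' *\<^sub>R v)"
    using ab(5) ab'(5) by (simp add: algebra_simps)
  then have eq: "A (x + a *\<^sub>R u + b *\<^sub>R v) = B (x + b' *\<^sub>R u + a' *\<^sub>R v)" using t by simp
  have "dist (A (x + a *\<^sub>R u + b *\<^sub>R v)) (A x) < e"
    using d1(2) inS near r ab by (meson less_le_trans)
  moreover have "dist (B (x + b' *\<^sub>R u + a' *\<^sub>R v)) (B x) < e"
    using d2(2) inS near r ab' by (meson less_le_trans)
  ultimately have "\<bar>A x - B x\<bar> < 2 * e" unfolding eq dist_real_def by linarith
  then show False by (simp add: e_def)
qed

lemma symmetric_second_derivative:
  fixes F :: "'a::real_normed_vector \<Rightarrow> 'b::euclidean_space"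
  assumes S: "open S" "x \<in> S" and F: "smooth_on S F"
  shows "dderiv (\<lambda>y. dderiv F y u) x v = dderiv (\<lambda>y. dderiv F y v) x u"
proof (rule euclidean_eqI)
  fix b :: 'b assume "b \<in> Basis"
  have lin: "bounded_linear (\<lambda>z::'b. z \<bullet> b)" by (rule bounded_linear_inner_left)
  have "dderiv (\<lambda>y. dderiv F y u) x v \<bullet> b = dderiv (\<lambda>y. dderiv (\<lambda>y. F y \<bullet> b) y u) x v" for u v
  proof -
    have "dderiv (\<lambda>y. dderiv F y u) x v \<bullet> b = dderiv (\<lambda>y. dderiv F y u \<bullet> b) x v"
      using dderiv_bounded_linear[OF lin smooth_on_differentiable[OF smooth_on_dderiv[OF F] S(2)]] by simp
    also have "\<dots> = dderiv (\<lambda>y. dderiv (\<lambda>y. F y \<bullet> b) y u) x v"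
      using dderiv_bounded_linear[OF lin smooth_on_differentiable[OF F]]
      by (subst dderiv_cong_open[OF S]) auto
    finally show ?thesis .
  qed
  moreover have "Ck_on 2 S (\<lambda>y. F y \<bullet> b)"
    by (rule Ck_on_bounded_linear[OF S(1) lin smooth_on_Ck[OF F]])
  ultimately show "dderiv (\<lambda>y. dderiv F y u) x v \<bullet> b = dderiv (\<lambda>y. dderiv F y v) x u \<bullet> b"
    using symmetric_second_derivative_real[OF S] by metis
qed

text \<open>Linearity of the inner derivative holds at every point of \<open>S\<close>, so it
  survives another differentiation. In the outer direction linearity is part of Frechet
  differentiability.\<close>

lemma linear_second_derivative:
  fixes F :: "'a::real_normed_vector \<Rightarrow> 'b::real_normed_vector"
  assumes S: "open S" "x \<in> S" and F: "smooth_on S F"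
  shows "linear (\<lambda>v. dderiv (\<lambda>y. dderiv F y v) x u)"
proof (rule linearI)
  note L = smooth_on_linear[OF F]
  note D = smooth_on_has_derivative[OF smooth_on_dderiv[OF F] S(2)]
  fix v w and r :: real
  have "((\<lambda>y. dderiv F y (v + w)) has_derivative
      (\<lambda>u. dderiv (\<lambda>y. dderiv F y v) x u + dderiv (\<lambda>y. dderiv F y w) x u)) (at x)"
    by (rule has_derivative_transform_within_open[OF has_derivative_add[OF D D] S])
      (simp add: linear_add[OF L])
  then show "dderiv (\<lambda>y. dderiv F y (v + w)) x u = dderiv (\<lambda>y. dderiv F y v) x u + dderiv (\<lambda>y. dderiv F y w) x u"
    by (simp add: dderiv_eqI)
  have "((\<lambda>y. dderiv F y (r *\<^sub>R v)) has_derivative (\<lambda>u. r *\<^sub>R dderiv (\<lambda>y. dderiv F y v) x u)) (at x)"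
    by (rule has_derivative_transform_within_open[OF has_derivative_scaleR_right[OF D] S])
      (simp add: linear_scale[OF L])
  then show "dderiv (\<lambda>y. dderiv F y (r *\<^sub>R v)) x u = r *\<^sub>R dderiv (\<lambda>y. dderiv F y v) x u"
    by (simp add: dderiv_eqI)
qed

section \<open>Linear algebra of flat bilinear forms\<close>

lemma independent_coeff_bound:
  fixes B :: "'w::euclidean_space set"
  assumes "independent B"
  obtains C where "C > 0" "\<And>a. (\<Sum>b\<in>B. \<bar>a b\<bar>) \<le> C * norm (\<Sum>b\<in>B. a b *\<^sub>R b)"
proof -
  have fin: "finite B" using assms by (rule independent_imp_finite)
  have "\<exists>K. \<forall>a. \<bar>a b\<bar> \<le> K * norm (\<Sum>b\<in>B. a b *\<^sub>R b)" if b: "b \<in> B" for b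
  proof -
    obtain f :: "'w \<Rightarrow> real" where f: "linear f" "\<And>x. x \<in> B \<Longrightarrow> f x = (if x = b then 1 else 0)"
      using linear_independent_extend[OF assms, of "\<lambda>x. if x = b then 1 else 0"] by auto
    obtain K where K: "\<And>x. norm (f x) \<le> K * norm x" using linear_bounded[OF f(1)] by blast
    have "f (\<Sum>b\<in>B. a b *\<^sub>R b) = a b" for a
    proof -
      have "f (\<Sum>b\<in>B. a b *\<^sub>R b) = (\<Sum>x\<in>B. a x * f x)"
        by (simp add: linear_sum[OF f(1)] linear_scale[OF f(1)])
      also have "\<dots> = (\<Sum>x\<in>B. if x = b then a x else 0)" by (rule sum.cong) (auto simp: f(2))
      finally show ?thesis using fin b by simp
    qed
    then show ?thesis using K by (metis real_norm_def)
  qed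
  then obtain K where K: "\<And>b a. b \<in> B \<Longrightarrow> \<bar>a b\<bar> \<le> K b * norm (\<Sum>b\<in>B. a b *\<^sub>R b)" by metis
  show ?thesis
  proof (rule that)
    \<comment> \<open>The 1 keeps the constant positive when \<open>B\<close> is empty.\<close>
    show "1 + (\<Sum>b\<in>B. \<bar>K b\<bar>) > 0" by (simp add: add_pos_nonneg sum_nonneg)
    fix a :: "'w \<Rightarrow> real"
    have "(\<Sum>b\<in>B. \<bar>a b\<bar>) \<le> (\<Sum>b\<in>B. \<bar>K b\<bar> * norm (\<Sum>b\<in>B. a b *\<^sub>R b))"
      using K by (intro sum_mono) (meson abs_ge_self mult_right_mono norm_ge_zero order_trans)
    also have "\<dots> \<le> (1 + (\<Sum>b\<in>B. \<bar>K b\<bar>)) * norm (\<Sum>b\<in>B. a b *\<^sub>R b)"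
      by (simp add: sum_distrib_right[symmetric] algebra_simps)
    finally show "(\<Sum>b\<in>B. \<bar>a b\<bar>) \<le> (1 + (\<Sum>b\<in>B. \<bar>K b\<bar>)) * norm (\<Sum>b\<in>B. a b *\<^sub>R b)" .
  qed
qed

text \<open>With errors below \<open>1 / (2 * C)\<close>, replacing each \<open>b\<close> by
  \<open>G b\<close> changes a combination by at most s / (2 C), where s is the sum of the absolute
  coefficients. The coefficient bound turns this into s / 2, which is absorbed on the left.\<close>

lemma independent_perturbation:
  fixes B :: "'w::euclidean_space set"
  assumes "independent B"
  obtains C d where "C > 0" "d > 0"
    "\<And>G a. (\<And>b. b \<in> B \<Longrightarrow> norm (G b - b) < d) \<Longrightarrow> (\<Sum>b\<in>B. \<bar>a b\<bar>) \<le> C * norm (\<Sum>b\<in>B. a b *\<^sub>R G b)"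
proof -
  obtain C where C: "C > 0" "\<And>a. (\<Sum>b\<in>B. \<bar>a b\<bar>) \<le> C * norm (\<Sum>b\<in>B. a b *\<^sub>R b)"
    using independent_coeff_bound[OF assms] by blast
  show ?thesis
  proof (rule that)
    show "2 * C > 0" "1 / (2 * C) > 0" using C by auto
    fix G and a :: "'w \<Rightarrow> real" assume G: "\<And>b. b \<in> B \<Longrightarrow> norm (G b - b) < 1 / (2 * C)"
    define s where "s = (\<Sum>b\<in>B. \<bar>a b\<bar>)"
    have "norm (\<Sum>b\<in>B. a b *\<^sub>R (b - G b)) \<le> (\<Sum>b\<in>B. \<bar>a b\<bar> * (1 / (2 * C)))"
    proof (rule sum_norm_le)
      fix b assume "b \<in> B"
      then show "norm (a b *\<^sub>R (b - G b)) \<le> \<bar>a b\<bar> * (1 / (2 * C))"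
        using G[of b] norm_minus_commute[of b "G b"] by (simp only: norm_scaleR) (intro mult_left_mono, auto)
    qed
    also have "\<dots> = s / (2 * C)" by (simp add: s_def sum_divide_distrib)
    finally have 1: "norm (\<Sum>b\<in>B. a b *\<^sub>R (b - G b)) \<le> s / (2 * C)" .
    have "(\<Sum>b\<in>B. a b *\<^sub>R b) = (\<Sum>b\<in>B. a b *\<^sub>R G b) + (\<Sum>b\<in>B. a b *\<^sub>R (b - G b))"
      by (simp add: sum.distrib[symmetric] algebra_simps)
    then have "norm (\<Sum>b\<in>B. a b *\<^sub>R b) \<le> norm (\<Sum>b\<in>B. a b *\<^sub>R G b) + s / (2 * C)"
      using norm_triangle_ineq[of "\<Sum>b\<in>B. a b *\<^sub>R G b" "\<Sum>b\<in>B. a b *\<^sub>R (b - G b)"] 1 by simp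
    then have "s \<le> C * (norm (\<Sum>b\<in>B. a b *\<^sub>R G b) + s / (2 * C))"
      using C(2)[of a] C(1) unfolding s_def by (meson less_eq_real_def mult_left_mono order_trans)
    then have "s \<le> 2 * C * norm (\<Sum>b\<in>B. a b *\<^sub>R G b)" using C(1) by (simp add: field_simps)
    then show "(\<Sum>b\<in>B. \<bar>a b\<bar>) \<le> 2 * C * norm (\<Sum>b\<in>B. a b *\<^sub>R G b)" by (simp add: s_def)
  qed
qed

text \<open>The bound forces every coefficient of a vanishing combination to vanish. Injectivity is
  recorded because later arguments compare the cardinality of \<open>B\<close> with a
  dimension.\<close>

lemma perturbed_independent:
  fixes G :: "'i \<Rightarrow> 'w::euclidean_space"
  assumes fin: "finite B"
    and bound: "\<And>a. (\<Sum>b\<in>B. \<bar>a b\<bar>) \<le> C * norm (\<Sum>b\<in>B. a b *\<^sub>R G b)"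
  shows "inj_on G B" "independent (G ` B)"
proof -
  have zero: "a b = 0" if "(\<Sum>b\<in>B. a b *\<^sub>R G b) = 0" "b \<in> B" for a :: "'i \<Rightarrow> real" and b
  proof -
    have "(\<Sum>b\<in>B. \<bar>a b\<bar>) \<le> 0" using bound[of a] that by simp
    then have "(\<Sum>b\<in>B. \<bar>a b\<bar>) = 0" by (meson abs_ge_zero order_antisym sum_nonneg)
    then show ?thesis using fin that by (simp add: sum_nonneg_eq_0_iff)
  qed
  show inj: "inj_on G B"
  proof (rule inj_onI, rule ccontr)
    fix x y assume xy: "x \<in> B" "y \<in> B" "G x = G y" "x \<noteq> y"
    \<comment> \<open>Coefficients 1 at \<open>x\<close> and -1 at \<open>y\<close>; the combination
      vanishes because \<open>G x = G y\<close>.\<close>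
    have "(\<Sum>b\<in>B. ((if b = x then 1 else 0) - (if b = y then 1 else 0)) *\<^sub>R G b) = 0"
      using fin xy by (simp add: scaleR_diff_left sum_subtractf if_distrib[of "\<lambda>r. r *\<^sub>R _"] cong: if_cong)
    from zero[OF this xy(1)] xy show False by auto
  qed
  show "independent (G ` B)"
  proof (subst independent_explicit, intro conjI allI impI ballI)
    show "finite (G ` B)" using fin by simp
    fix u v assume "(\<Sum>v\<in>G ` B. u v *\<^sub>R v) = 0" "v \<in> G ` B"
    then show "u v = 0" using zero[of "\<lambda>b. u (G b)"] by (auto simp: sum.reindex[OF inj])
  qed
qed

section \<open>Regular elements and flatness of bilinear maps\<close>

text \<open>
  Moore's regularity argument: otherwise the rank of \<open>\<beta> (X + t *\<^sub>R Z)\<close> would exceed that of \<open>\<beta> X\<close>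
  for all small \<open>t \<noteq> 0\<close>, because \<open>\<beta> (X + t *\<^sub>R Z) (Y /\<^sub>R t) = \<beta> Z Y\<close>.
\<close>

lemma regular_element_kernel:
  fixes \<beta> :: "'v::euclidean_space \<Rightarrow> 'u::euclidean_space \<Rightarrow> 'w::euclidean_space"
  assumes \<beta>: "bilinear \<beta>"
    and X: "\<And>X'. dim (range (\<beta> X')) \<le> dim (range (\<beta> X))"
    and Y: "\<beta> X Y = 0"
  shows "\<beta> Z Y \<in> range (\<beta> X)"
proof (rule ccontr)
  assume no: "\<beta> Z Y \<notin> range (\<beta> X)"
  have lin: "linear (\<beta> x)" for x using \<beta> by (simp add: bilinear_def)
  have lin2: "linear (\<lambda>x. \<beta> x y)" for y using \<beta> by (simp add: bilinear_def)
  have sub: "subspace (range (\<beta> x))" for x by (simp add: linear_subspace_image[OF lin])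
  obtain C where C: "C \<subseteq> range (\<beta> X)" "independent C" "range (\<beta> X) \<subseteq> span C" "card C = dim (range (\<beta> X))"
    using basis_exists by blast
  have spanC: "span C \<subseteq> range (\<beta> X)" using C(1) sub span_minimal by blast
  define B where "B = insert (\<beta> Z Y) C"
  have finC: "finite C" using C(2) independent_imp_finite by blast
  have notC: "\<beta> Z Y \<notin> C" using no C(1) by blast
  have indB: "independent B"
  proof -
    have "\<beta> Z Y \<notin> span C" using no spanC by blast
    then show ?thesis unfolding B_def using C(2) by (rule independent_insertI)
  qed
  obtain K d where "K > 0" and K: "d > 0"
    "\<And>G a. (\<And>b. b \<in> B \<Longrightarrow> norm (G b - b) < d) \<Longrightarrow> (\<Sum>b\<in>B. \<bar>a b\<bar>) \<le> K * norm (\<Sum>b\<in>B. a b *\<^sub>R G b)"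
    by (rule independent_perturbation[OF indB]) blast
  define p where "p b = (SOME u. \<beta> X u = b)" for b
  have p: "\<beta> X (p b) = b" if "b \<in> C" for b
    using C(1) that unfolding p_def by (metis (mono_tags) someI_ex imageE subsetD)
  define M where "M = 1 + (\<Sum>b\<in>C. norm (\<beta> Z (p b)))"
  have M: "M > 0" unfolding M_def by (meson add_pos_nonneg norm_ge_zero sum_nonneg zero_less_one)
  define t where "t = d / (2 * M)"
  have t: "t > 0" using K(1) M by (simp add: t_def)
  \<comment> \<open>Each \<open>b = \<beta> X (p b)\<close> is moved to
    \<open>\<beta> (X + t *\<^sub>R Z) (p b)\<close>, that is, by
    \<open>t *\<^sub>R \<beta> Z (p b)\<close>, while \<open>\<beta> Z Y\<close> stays. The choice
    of \<open>t\<close> keeps all displacements below \<open>d\<close>.\<close>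
  define G where "G b = (if b = \<beta> Z Y then b else \<beta> (X + t *\<^sub>R Z) (p b))" for b
  have "norm (G b - b) < d" if "b \<in> B" for b
  proof (cases "b = \<beta> Z Y")
    case True
    then show ?thesis using K(1) by (simp add: G_def)
  next
    case False
    then have b: "b \<in> C" using that by (simp add: B_def)
    have "G b - b = t *\<^sub>R \<beta> Z (p b)"
      using False p[OF b] by (simp add: G_def linear_add[OF lin2] linear_scale[OF lin2])
    then have "norm (G b - b) = t * norm (\<beta> Z (p b))" using t by simp
    also have "\<dots> \<le> t * M" unfolding M_def using t member_le_sum[OF b, of "\<lambda>b. norm (\<beta> Z (p b))"] finC
      by (intro mult_left_mono) auto
    also have "\<dots> < d" using M K(1) by (simp add: t_def)
    finally show ?thesis .
  qed
  from K(2)[OF this] have bd: "(\<Sum>b\<in>B. \<bar>a b\<bar>) \<le> K * norm (\<Sum>b\<in>B. a b *\<^sub>R G b)" for a .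
  have finB: "finite B" using finC by (simp add: B_def)
  note ind = perturbed_independent[OF finB bd]
  have "G b \<in> range (\<beta> (X + t *\<^sub>R Z))" for b
  proof (cases "b = \<beta> Z Y")
    case True
    have "\<beta> (X + t *\<^sub>R Z) (Y /\<^sub>R t) = \<beta> Z Y"
      using Y t by (simp add: linear_add[OF lin2] linear_scale[OF lin2] linear_scale[OF lin])
    then show ?thesis using True by (metis G_def rangeI)
  qed (auto simp: G_def)
  then have "card (G ` B) \<le> dim (range (\<beta> (X + t *\<^sub>R Z)))"
    using ind(2) by (intro independent_card_le_dim) auto
  then have "card B \<le> dim (range (\<beta> X))" using X[of "X + t *\<^sub>R Z"] card_image[OF ind(1)] by simp
  moreover have "card B = Suc (dim (range (\<beta> X)))" using C(4) finC notC by (simp add: B_def)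
  ultimately show False by simp
qed

lemma regular_element_exists:
  fixes \<beta> :: "'v::euclidean_space \<Rightarrow> 'u::euclidean_space \<Rightarrow> 'w::euclidean_space"
  obtains X where "\<And>X'. dim (range (\<beta> X')) \<le> dim (range (\<beta> X))"
proof -
  have "\<exists>X. (\<forall>X'. True \<longrightarrow> dim (range (\<beta> X')) \<le> dim (range (\<beta> X))) \<and> True"
    using ex_has_greatest_nat[of "\<lambda>_. True" undefined "\<lambda>X. dim (range (\<beta> X))" "Suc (DIM('w))"]
    by (metis dim_subset_UNIV le_imp_less_Suc)
  then show ?thesis using that by blast
qed

text \<open>The Gauss equation only provides the case \<open>Q u u v v = Q u v u v\<close>.
  Polarising in \<open>u\<close> and then in \<open>v\<close> recovers the rest, just as an
  algebraic curvature tensor is determined by its sectional curvatures.\<close>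

lemma totally_symmetric_polarization:
  fixes Q :: "'v::real_vector \<Rightarrow> 'v \<Rightarrow> 'v \<Rightarrow> 'v \<Rightarrow> real"
  assumes add: "\<And>u u' v w z. Q (u + u') v w z = Q u v w z + Q u' v w z"
    and sym1: "\<And>u v w z. Q u v w z = Q v u w z" and sym2: "\<And>u v w z. Q u v w z = Q w z u v"
    and Q: "\<And>u v. Q u u v v = Q u v u v"
  shows "Q u v w z = Q u w v z"
proof -
  have sym3: "Q u v w z = Q u v z w" for u v w z using sym1 sym2 by metis
  have add2: "Q u (v + v') w z = Q u v w z + Q u v' w z" for u v v' w z using add sym1 by metis
  have add3: "Q u v (w + w') z = Q u v w z + Q u v w' z" for u v w w' z using add sym2 by metis
  have add4: "Q u v w (z + z') = Q u v w z + Q u v w z'" for u v w z z' using add3 sym3 by metis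
  have 1: "Q u z v v = Q u v z v" for u z v
    using Q[of "u + z" v] Q[of u v] Q[of z v] sym1[of z u v v] sym2[of z v u v]
    by (simp add: add add2 add3)
  have 2: "2 * Q u z v w = Q u v z w + Q u w z v" for u z v w
    using 1[of u z "v + w"] 1[of u z v] 1[of u z w] sym3[of u z w v]
    by (simp add: add2 add3 add4)
  show ?thesis
    \<comment> \<open>With a = \<open>Q u v w z\<close> and b = \<open>Q u w v z\<close>, the two
      instances read 2 a = b + r and 2 b = a + r with the same r, so a = b.\<close>
    using 2[of u v w z] 2[of u w v z] sym3[of u z v w] sym3[of u z w v] sym3 by (smt (verit))
qed

text \<open>Riesz representation in the standard inner product. It turns the bilinear forms below
  into linear endomorphisms, for which injective implies surjective.\<close>

lemma linear_functional_inner: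
  fixes f :: "'v::euclidean_space \<Rightarrow> real"
  assumes "linear f"
  shows "(\<Sum>b\<in>Basis. f b *\<^sub>R b) \<bullet> U = f U"
proof -
  have "f U = f (\<Sum>b\<in>Basis. (U \<bullet> b) *\<^sub>R b)" by (simp add: euclidean_representation)
  also have "\<dots> = (\<Sum>b\<in>Basis. (U \<bullet> b) * f b)"
    by (simp add: linear_sum[OF assms] linear_scale[OF assms])
  finally show ?thesis by (simp add: inner_sum_left inner_commute[of U] mult.commute)
qed

text \<open>The data at one point of the immersion: second fundamental form, metric, ambient form,
  curvature difference c - k and first normal space. Positivity of \<open>B\<close> is asked on
  \<open>N\<close> only, because the ambient form is Lorentzian for k < 0 and degenerate for k =
  0.\<close>

locale flat_pair =
  fixes \<alpha> :: "'v::euclidean_space \<Rightarrow> 'v \<Rightarrow> 'w::euclidean_space"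
    and h :: "'v \<Rightarrow> 'v \<Rightarrow> real" and B :: "'w \<Rightarrow> 'w \<Rightarrow> real" and \<kappa> :: real and N :: "'w set"
  assumes alpha: "bilinear \<alpha>" and alpha_sym: "\<alpha> u v = \<alpha> v u"
    and h: "bilinear h" and h_sym: "h u v = h v u" and h_pos: "u \<noteq> 0 \<Longrightarrow> h u u > 0"
    and B: "bilinear B" and B_sym: "B a b = B b a"
    and N: "N = span {\<alpha> u v | u v. True}" and B_pos: "a \<in> N \<Longrightarrow> a \<noteq> 0 \<Longrightarrow> B a a > 0"
    and dim_N: "Suc (dim N) = DIM('v)"
    and kappa: "\<kappa> \<noteq> 0"
    and gauss: "B (\<alpha> u u) (\<alpha> v v) - B (\<alpha> u v) (\<alpha> u v) = \<kappa> * (h u u * h v v - h u v * h u v)"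
    and no_umbilic: "\<lbrakk>\<kappa> > 0; \<zeta> \<in> N; B \<zeta> \<zeta> = 1\<rbrakk> \<Longrightarrow> \<exists>u v. B (\<alpha> u v) \<zeta> \<noteq> sqrt \<kappa> * h u v"
begin

text \<open>By the Gauss equation, \<open>\<beta>\<close> is flat for the nondegenerate form \<open>W\<close> on \<open>N \<times> \<real>\<close>.\<close>

definition \<beta> :: "'v \<Rightarrow> 'v \<Rightarrow> 'w \<times> real" where "\<beta> u v = (\<alpha> u v, h u v)"

definition W :: "'w \<times> real \<Rightarrow> 'w \<times> real \<Rightarrow> real" where "W x y = B (fst x) (fst y) - \<kappa> * (snd x * snd y)"

lemma linB: "linear (B a)" "linear (\<lambda>a. B a b)" using B by (auto simp: bilinear_def)
lemma linalpha: "linear (\<alpha> a)" "linear (\<lambda>a. \<alpha> a b)" using alpha by (auto simp: bilinear_def)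
lemma linh: "linear (h a)" "linear (\<lambda>a. h a b)" using h by (auto simp: bilinear_def)

lemmas lin_simps = linear_add[OF linB(1)] linear_add[OF linB(2)] linear_scale[OF linB(1)] linear_scale[OF linB(2)]
  linear_add[OF linalpha(1)] linear_add[OF linalpha(2)] linear_scale[OF linalpha(1)] linear_scale[OF linalpha(2)]
  linear_add[OF linh(1)] linear_add[OF linh(2)] linear_scale[OF linh(1)] linear_scale[OF linh(2)]
  linear_0[OF linB(1)] linear_0[OF linB(2)] linear_0[OF linalpha(1)] linear_0[OF linalpha(2)]
  linear_0[OF linh(1)] linear_0[OF linh(2)]

lemma bilinear_beta: "bilinear \<beta>"
  unfolding bilinear_def \<beta>_def
  by (intro conjI allI linearI) (simp_all add: lin_simps)

lemma beta_sym: "\<beta> u v = \<beta> v u"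
  using alpha_sym h_sym by (simp add: \<beta>_def)

lemma linbeta: "linear (\<beta> u)"
  using bilinear_beta by (simp add: bilinear_def)

lemma W_sym: "W x y = W y x"
  by (simp add: W_def B_sym mult.commute)

lemma bilinear_W: "bilinear W"
  unfolding bilinear_def W_def
  by (intro conjI allI linearI) (simp_all add: lin_simps algebra_simps)

text \<open>In terms of \<open>W\<close>, the Gauss equation is the case of the arguments
  \<open>u, u, v, v\<close>; polarisation does the rest.\<close>

lemma flat: "W (\<beta> u v) (\<beta> w z) = W (\<beta> u w) (\<beta> v z)"
proof (rule totally_symmetric_polarization[of "\<lambda>u v w z. W (\<beta> u v) (\<beta> w z)"])
  show "W (\<beta> (u + u') v) (\<beta> w z) = W (\<beta> u v) (\<beta> w z) + W (\<beta> u' v) (\<beta> w z)" for u u' v w z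
    by (simp add: W_def \<beta>_def lin_simps algebra_simps)
  show "W (\<beta> u u) (\<beta> v v) = W (\<beta> u v) (\<beta> u v)" for u v
    using gauss[of u v] by (simp add: W_def \<beta>_def algebra_simps)
qed (use beta_sym W_sym in metis)+

lemma subspace_N: "subspace N" by (simp add: N)

lemma alpha_N: "\<alpha> u v \<in> N" unfolding N by (rule span_base) blast

lemma range_beta: "range (\<beta> X) \<subseteq> N \<times> UNIV"
  by (auto simp: \<beta>_def alpha_N)

lemma kernel_trivial:
  assumes X: "\<And>X'. dim (range (\<beta> X')) \<le> dim (range (\<beta> X))" and Y: "\<beta> X Y = 0"
  shows "Y = 0"
proof (rule ccontr)
  assume "Y \<noteq> 0"
  \<comment> \<open>\<open>regular_element_kernel\<close> writes \<open>\<beta> U Y\<close> as some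
    \<open>\<beta> X U'\<close>; flatness then pairs \<open>X\<close> with \<open>Y\<close>, and
    \<open>\<beta> X Y = 0\<close>.\<close>
  have perp: "W (\<beta> Y Z) (\<beta> Y U) = 0" for Z U
  proof -
    obtain U' where "\<beta> U Y = \<beta> X U'" using regular_element_kernel[OF bilinear_beta X Y, of U] by auto
    then have "W (\<beta> Y Z) (\<beta> Y U) = W (\<beta> Z Y) (\<beta> X U')" by (metis beta_sym)
    also have "\<dots> = W (\<beta> X Y) (\<beta> Z U')" using flat[of Z Y X U'] flat beta_sym W_sym by metis
    also have "\<dots> = 0" by (simp add: Y W_def lin_simps)
    finally show ?thesis .
  qed
  define s where "s = h Y Y"
  have s: "s > 0" using h_pos \<open>Y \<noteq> 0\<close> by (simp add: s_def)
  \<comment> \<open>By flatness, \<open>perp\<close> says that \<open>\<beta> Y Y\<close> is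
    \<open>W\<close>-orthogonal to every \<open>\<beta> Z U\<close>.\<close>
  have orth: "B (\<alpha> Y Y) (\<alpha> Z U) = \<kappa> * s * h Z U" for Z U
    using perp[of Z U] flat[of Y Z Y U] by (simp add: W_def \<beta>_def s_def)
  have norm: "B (\<alpha> Y Y) (\<alpha> Y Y) = \<kappa> * s * s" using orth[of Y Y] by (simp add: s_def)
  show False
  proof (cases "\<kappa> > 0")
    case False
    \<comment> \<open>Here \<open>\<alpha> Y Y\<close> would have negative square, although
      \<open>B\<close> is definite on \<open>N\<close>.\<close>
    then have "\<kappa> * s * s < 0" using kappa s by (simp add: mult_neg_pos)
    then show False using norm B_pos[OF alpha_N, of Y Y] by (cases "\<alpha> Y Y = 0") (auto simp: lin_simps)
  next
    case True
    define r where "r = sqrt \<kappa>"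
    have r: "r > 0" "\<kappa> = r * r" using True by (auto simp: r_def)
    \<comment> \<open>The square of \<open>\<alpha> Y Y\<close> is that of \<open>r * s\<close>, so
      \<zeta> is the unit vector in its direction; by \<open>orth\<close> its shape operator is
      \<open>r\<close> times the identity.\<close>
    define \<zeta> where "\<zeta> = (1 / (r * s)) *\<^sub>R \<alpha> Y Y"
    have "B \<zeta> \<zeta> = (1 / (r * s)) * ((1 / (r * s)) * (r * r * s * s))"
      using norm by (simp add: \<zeta>_def lin_simps r(2))
    also have "\<dots> = 1" using s r(1) by (simp add: field_simps)
    finally have 1: "B \<zeta> \<zeta> = 1" .
    have 2: "B (\<alpha> u v) \<zeta> = sqrt \<kappa> * h u v" for u v
    proof -
      have "B (\<alpha> u v) \<zeta> = (1 / (r * s)) * B (\<alpha> Y Y) (\<alpha> u v)"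
        by (simp add: \<zeta>_def lin_simps B_sym[of "\<alpha> u v"])
      also have "\<dots> = r * h u v"
        unfolding orth r(2) using s r(1) by (simp add: field_simps)
      finally show ?thesis by (simp add: r_def)
    qed
    have "\<zeta> \<in> N" unfolding \<zeta>_def using subspace_N alpha_N by (simp add: subspace_scale)
    from no_umbilic[OF True this 1] 2 show False by blast
  qed
qed

text \<open>An injective \<open>\<beta> X\<close> is onto by counting dimensions:
  \<open>dim_N\<close> says that \<open>N \<times> UNIV\<close> is as large as the tangent
  space.\<close>

lemma bijective_element:
  obtains X where "inj (\<beta> X)" "range (\<beta> X) = N \<times> UNIV"
proof -
  obtain X where X: "\<And>X'. dim (range (\<beta> X')) \<le> dim (range (\<beta> X))"
    using regular_element_exists[of \<beta>] by blast
  have inj: "inj (\<beta> X)"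
    using kernel_trivial[OF X] linear_injective_0[OF linbeta] by blast
  have "dim (range (\<beta> X)) = DIM('v)"
    using dim_image_eq[where f="\<beta> X" and S=UNIV, OF linbeta] inj by simp
  also have "\<dots> = dim (N \<times> (UNIV :: real set))"
    using dim_N dim_Times[OF subspace_N subspace_UNIV, where ?'b = real] by simp
  finally have "range (\<beta> X) = N \<times> UNIV"
    using subspace_N by (intro subspace_dim_equal[OF _ _ range_beta])
      (auto intro: linear_subspace_image linbeta subspace_Times)
  then show ?thesis using inj that by blast
qed

text \<open>Testing with \<open>(0, 1)\<close> isolates the real component; definiteness of
  \<open>B\<close> on \<open>N\<close> disposes of the other one, whatever the signature of
  \<open>W\<close>.\<close>

lemma W_nondegenerate:
  assumes "x \<in> N \<times> UNIV" "\<And>y. y \<in> N \<times> UNIV \<Longrightarrow> W x y = 0"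
  shows "x = 0"
proof -
  have "\<kappa> * snd x = 0" using assms(2)[of "(0, 1)"] subspace_0[OF subspace_N] by (simp add: W_def lin_simps)
  then have "snd x = 0" using kappa by simp
  moreover have "B (fst x) (fst x) = 0"
    using assms(1) assms(2)[of "(fst x, 0)"] by (auto simp: W_def)
  then have "fst x = 0" using B_pos[of "fst x"] assms(1) by (cases x) fastforce
  ultimately show ?thesis by (simp add: prod_eq_iff)
qed

theorem symmetric_functional_zero:
  fixes \<mu> :: "'v \<Rightarrow> 'w \<Rightarrow> real"
  assumes lin: "\<And>w. linear (\<mu> w)" and sym: "\<And>u v w. \<mu> w (\<alpha> u v) = \<mu> u (\<alpha> w v)"
  shows "\<mu> w (\<alpha> u v) = 0"
proof -
  obtain X where X: "inj (\<beta> X)" "range (\<beta> X) = N \<times> UNIV" by (rule bijective_element)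
  have linW: "linear (W x)" "linear (\<lambda>x. W x y)" for x y
    using bilinear_W unfolding bilinear_def by blast+
  \<comment> \<open>The Gram operator of \<open>W (\<beta> X Z) (\<beta> X U)\<close>. It is
    injective by nondegeneracy, hence onto, so every functional of \<open>U\<close> arises from some
    \<open>Z\<close>.\<close>
  define L where "L Z = (\<Sum>b\<in>Basis. W (\<beta> X Z) (\<beta> X b) *\<^sub>R b)" for Z
  have Lin: "linear L" unfolding L_def
    by (intro linearI)
      (simp_all add: linear_add[OF linbeta] linear_scale[OF linbeta] linear_add[OF linW(2)] linear_scale[OF linW(2)]
        scaleR_add_left sum.distrib scaleR_sum_right)
  have L: "L Z \<bullet> U = W (\<beta> X Z) (\<beta> X U)" for Z U
    unfolding L_def
    by (rule linear_functional_inner) (use linear_compose[OF linbeta linW(1)] in \<open>simp add: o_def\<close>)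
  have "inj L" unfolding linear_injective_0[OF Lin]
  proof (intro allI impI)
    fix Z assume "L Z = 0"
    then have 0: "W (\<beta> X Z) (\<beta> X U) = 0" for U using L[of Z U] by simp
    have "\<beta> X Z = 0"
    proof (rule W_nondegenerate)
      show "\<beta> X Z \<in> N \<times> UNIV" using range_beta by blast
      show "W (\<beta> X Z) y = 0" if y: "y \<in> N \<times> UNIV" for y
      proof -
        obtain U where "y = \<beta> X U" using y X(2) by (metis imageE)
        then show ?thesis using 0 by simp
      qed
    qed
    then show "Z = 0" using X(1) linear_injective_0[OF linbeta] by blast
  qed
  then have "surj L" using Lin linear_injective_imp_surjective by blast
  define q where "q = (\<Sum>b\<in>Basis. \<mu> X (\<alpha> X b) *\<^sub>R b)"
  obtain Z where Z: "L Z = q" using \<open>surj L\<close> by (metis surjD)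
  have q: "q \<bullet> U = \<mu> X (\<alpha> X U)" for U
    unfolding q_def
    by (rule linear_functional_inner) (use linear_compose[OF linalpha(1) lin] in \<open>simp add: o_def\<close>)
  \<comment> \<open>With \<open>\<beta> Y U = \<beta> X U'\<close>, symmetry of \<mu> gives
    \<mu>_Y(\<alpha>(X, U)) = \<mu>_X(\<alpha>(Y, U)) = \<mu>_X(\<alpha>(X, U')), where the
    representation by \<open>Z\<close> applies; flatness finally exchanges \<open>X\<close> and
    \<open>Y\<close>.\<close>
  have key: "\<mu> Y (\<alpha> X U) = W (\<beta> Y Z) (\<beta> X U)" for Y U
  proof -
    have "\<beta> Y U \<in> range (\<beta> X)" unfolding X(2) using range_beta by blast
    then obtain U' where U': "\<beta> Y U = \<beta> X U'" by blast
    then have "\<alpha> Y U = \<alpha> X U'" by (simp add: \<beta>_def)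
    then have "\<mu> Y (\<alpha> X U) = q \<bullet> U'" using sym[of Y X U] q by simp
    also have "\<dots> = W (\<beta> X Z) (\<beta> Y U)" using Z L[of Z U'] U' by simp
    also have "\<dots> = W (\<beta> Y Z) (\<beta> X U)" using flat beta_sym by metis
    finally show ?thesis .
  qed
  have "(0, 1) \<in> range (\<beta> X)" unfolding X(2) using subspace_0[OF subspace_N] by simp
  then obtain U0 where U0: "\<beta> X U0 = (0, 1)" by (metis imageE)
  \<comment> \<open>At \<open>U0\<close> the left side of \<open>key\<close> is
    \<open>\<mu> Y 0 = 0\<close> and the right side is \<open>- \<kappa> * h Y Z\<close>.\<close>
  have "h Y Z = 0" for Y
    using key[of Y U0] U0 kappa linear_0[OF lin] by (simp add: W_def \<beta>_def lin_simps)
  then have "Z = 0" using h_pos[of Z] by force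
  then have "\<mu> Y (\<alpha> X U) = 0" for Y U using key[of Y U] by (simp add: W_def \<beta>_def lin_simps)
  moreover have "\<beta> u v \<in> range (\<beta> X)" unfolding X(2) using range_beta by blast
  then obtain U' where "\<beta> u v = \<beta> X U'" by blast
  then have "\<alpha> u v = \<alpha> X U'" by (simp add: \<beta>_def)
  ultimately show ?thesis by simp
qed

end

section \<open>Families of subspaces of constant rank\<close>

text \<open>The test is applied to the component of \<open>v\<close> orthogonal to the span, whose
  product with \<open>v\<close> is its own square. Thus Euclidean normals \<open>z\<close> can stand
  for functionals modulo a subspace.\<close>

lemma in_span_orthogonalI:
  fixes S :: "'w::euclidean_space set"
  assumes "\<And>z. (\<And>x. x \<in> span S \<Longrightarrow> z \<bullet> x = 0) \<Longrightarrow> z \<bullet> v = 0"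
  shows "v \<in> span S"
proof -
  obtain s o' where so: "s \<in> span S" "\<And>w. w \<in> span S \<Longrightarrow> orthogonal o' w" "v = s + o'"
    using orthogonal_subspace_decomp_exists[of S v] by blast
  have "o' \<bullet> v = 0" using so(2) by (intro assms) (simp add: orthogonal_def)
  moreover have "o' \<bullet> s = 0" using so(2)[OF so(1)] by (simp add: orthogonal_def)
  ultimately have "o' \<bullet> o' = 0" using so(3) by (simp add: inner_right_distrib)
  then show ?thesis using so by simp
qed

text \<open>Without vertical vectors \<open>R\<close> is a graph over its projection: some normal
  \<open>z\<close> of \<open>R\<close> is not orthogonal to \<open>(0, 1)\<close>, and its equation
  can be solved for \<open>s\<close>.\<close>

lemma subspace_graph_inner:
  fixes R :: "('w::euclidean_space \<times> real) set"
  assumes R: "subspace R" and zero: "\<And>s. (0, s) \<in> R \<Longrightarrow> s = 0"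
  obtains m where "\<And>x s. (x, s) \<in> R \<Longrightarrow> s = m \<bullet> x"
proof -
  have "(0, 1) \<notin> R" using zero[of 1] by auto
  then have "(0::'w, 1::real) \<notin> span R" using R by (simp add: span_eq_iff[THEN iffD2])
  then have "\<not> (\<forall>z. (\<forall>x\<in>span R. z \<bullet> x = 0) \<longrightarrow> z \<bullet> (0::'w, 1::real) = 0)"
    using in_span_orthogonalI[of R "(0::'w, 1::real)"] by blast
  then obtain z where z: "\<And>x. x \<in> R \<Longrightarrow> z \<bullet> x = 0" "z \<bullet> (0::'w, 1::real) \<noteq> 0"
    using span_base by blast
  obtain a b where ab: "z = (a, b)" by (cases z)
  have "b \<noteq> 0" using z(2) ab by (simp add: inner_Pair)
  have "s = (- (a /\<^sub>R b)) \<bullet> x" if "(x, s) \<in> R" for x s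
  proof -
    have "a \<bullet> x + b * s = 0" using z(1)[OF that] ab by (simp add: inner_Pair)
    then show ?thesis using \<open>b \<noteq> 0\<close> by (simp add: field_simps)
  qed
  then show ?thesis using that by blast
qed

text \<open>The fibre of a family of subspaces presented by generating maps, which may be redundant,
  so that no frame has to be chosen in advance.\<close>

definition span_at :: "('e \<Rightarrow> 'w::real_vector) set \<Rightarrow> 'e \<Rightarrow> 'w set" where
  "span_at \<G> y = span ((\<lambda>G. G y) ` \<G>)"

lemma subspace_span_at [simp]: "subspace (span_at \<G> y)"
  by (simp add: span_at_def)

lemma span_at_base: "G \<in> \<G> \<Longrightarrow> G y \<in> span_at \<G> y"
  by (auto simp: span_at_def intro: span_base)

text \<open>Members of \<open>\<G>\<close> whose values at \<open>\<xi>\<close> form a basis stay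
  independent nearby with a uniform coefficient bound, and constancy of the rank makes them span the
  nearby fibres. Each frame section is indexed by its value \<open>b\<close> at
  \<open>\<xi>\<close>.\<close>

lemma constant_rank_frame:
  fixes \<G> :: "('e::real_normed_vector \<Rightarrow> 'w::euclidean_space) set"
  assumes \<Omega>: "open \<Omega>" "\<xi> \<in> \<Omega>" and cont: "\<And>G. G \<in> \<G> \<Longrightarrow> isCont G \<xi>"
    and dim: "\<And>y. y \<in> \<Omega> \<Longrightarrow> dim (span_at \<G> y) = m"
  obtains C \<delta> and Bs :: "'w set" and \<gamma> where "C > 0" "\<delta> > 0" "ball \<xi> \<delta> \<subseteq> \<Omega>" "finite Bs" "\<gamma> ` Bs \<subseteq> \<G>"
    "\<And>y v. y \<in> ball \<xi> \<delta> \<Longrightarrow> v \<in> span_at \<G> y \<Longrightarrow>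
       \<exists>a. v = (\<Sum>b\<in>Bs. a b *\<^sub>R \<gamma> b y) \<and> (\<Sum>b\<in>Bs. \<bar>a b\<bar>) \<le> C * norm v"
proof -
  obtain Bs where Bs: "Bs \<subseteq> (\<lambda>G. G \<xi>) ` \<G>" "independent Bs" "span_at \<G> \<xi> \<subseteq> span Bs" "card Bs = m"
    using basis_exists[of "(\<lambda>G. G \<xi>) ` \<G>"] dim[OF \<Omega>(2)] span_minimal[OF _ subspace_span]
    unfolding span_at_def by (metis dim_span)
  have fin: "finite Bs" using Bs(2) by (rule independent_imp_finite)
  have "\<forall>b\<in>Bs. \<exists>G. G \<in> \<G> \<and> G \<xi> = b" using Bs(1) by blast
  then obtain \<gamma> where \<gamma>: "\<And>b. b \<in> Bs \<Longrightarrow> \<gamma> b \<in> \<G>" "\<And>b. b \<in> Bs \<Longrightarrow> \<gamma> b \<xi> = b" by metis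
  obtain C d where Cd: "C > 0" "d > 0"
    "\<And>G a. (\<And>b. b \<in> Bs \<Longrightarrow> norm (G b - b) < d) \<Longrightarrow> (\<Sum>b\<in>Bs. \<bar>a b\<bar>) \<le> C * norm (\<Sum>b\<in>Bs. a b *\<^sub>R G b)"
    by (rule independent_perturbation[OF Bs(2)]) blast
  have "\<forall>\<^sub>F y in nhds \<xi>. norm (\<gamma> b y - b) < d" if "b \<in> Bs" for b
  proof -
    have "(\<gamma> b \<longlongrightarrow> \<gamma> b \<xi>) (nhds \<xi>)" using cont[OF \<gamma>(1)[OF that]]
      by (simp add: isCont_def tendsto_at_iff_tendsto_nhds)
    then show ?thesis using Cd(2) \<gamma>(2)[OF that] by (simp add: tendsto_iff dist_norm)
  qed
  then have "\<forall>\<^sub>F y in nhds \<xi>. y \<in> \<Omega> \<and> (\<forall>b\<in>Bs. norm (\<gamma> b y - b) < d)"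
    using \<Omega> fin by (intro eventually_conj eventually_nhds_in_open eventually_ball_finite) auto
  then obtain \<delta> where \<delta>: "\<delta> > 0" "\<And>y. dist y \<xi> < \<delta> \<Longrightarrow> y \<in> \<Omega> \<and> (\<forall>b\<in>Bs. norm (\<gamma> b y - b) < d)"
    unfolding eventually_nhds_metric by blast
  show ?thesis
  proof (rule that)
    show "C > 0" "\<delta> > 0" "finite Bs" "\<gamma> ` Bs \<subseteq> \<G>" using Cd \<delta> fin \<gamma> by auto
    show "ball \<xi> \<delta> \<subseteq> \<Omega>" using \<delta> by (auto simp: dist_commute)
    fix y v assume y: "y \<in> ball \<xi> \<delta>" and v: "v \<in> span_at \<G> y"
    have bd: "(\<Sum>b\<in>Bs. \<bar>a b\<bar>) \<le> C * norm (\<Sum>b\<in>Bs. a b *\<^sub>R \<gamma> b y)" for a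

    proof (rule Cd(3)[of "\<lambda>b. \<gamma> b y"])
      show "norm (\<gamma> b y - b) < d" if "b \<in> Bs" for b
        using \<delta>(2)[of y] y that by (simp add: dist_commute)
    qed
    note ind = perturbed_independent[where G = "\<lambda>b. \<gamma> b y", OF fin bd]
    have sub: "(\<lambda>b. \<gamma> b y) ` Bs \<subseteq> span_at \<G> y" by (rule image_subsetI, rule span_at_base[OF \<gamma>(1)])
    have "card ((\<lambda>b. \<gamma> b y) ` Bs) = dim (span_at \<G> y)"
      using card_image[OF ind(1)] Bs(4) dim[of y] \<delta>(2)[of y] y by (simp add: dist_commute)
    then have "v \<in> span ((\<lambda>b. \<gamma> b y) ` Bs)"
      using card_ge_dim_independent[OF sub ind(2)] v by auto
    then obtain u where "v = (\<Sum>x\<in>(\<lambda>b. \<gamma> b y) ` Bs. u x *\<^sub>R x)"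
      using fin by (auto simp: span_finite)
    then have "v = (\<Sum>b\<in>Bs. u (\<gamma> b y) *\<^sub>R \<gamma> b y)" by (simp add: sum.reindex[OF ind(1)])
    then show "\<exists>a. v = (\<Sum>b\<in>Bs. a b *\<^sub>R \<gamma> b y) \<and> (\<Sum>b\<in>Bs. \<bar>a b\<bar>) \<le> C * norm v"
      using bd[of "\<lambda>b. u (\<gamma> b y)"] by auto
  qed
qed

text \<open>Write \<open>v i\<close> in the frame at \<open>y i\<close> and use the same
  coefficients in the frame at \<open>\<xi>\<close>. The new vectors lie in one closed fibre and
  differ from \<open>v i\<close> by bounded coefficients times frame differences tending to 0.
  Without constant rank the fibre at the limit could be too small.\<close>

lemma constant_rank_limit:
  fixes \<G> :: "('e::real_normed_vector \<Rightarrow> 'w::euclidean_space) set"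
  assumes \<Omega>: "open \<Omega>" "\<xi> \<in> \<Omega>" and cont: "\<And>G. G \<in> \<G> \<Longrightarrow> isCont G \<xi>"
    and dim: "\<And>y. y \<in> \<Omega> \<Longrightarrow> dim (span_at \<G> y) = m"
    and y: "y \<longlonglongrightarrow> \<xi>" and v: "v \<longlonglongrightarrow> v0" and mem: "\<And>i. v i \<in> span_at \<G> (y i)"
  shows "v0 \<in> span_at \<G> \<xi>"
proof -
  obtain C \<delta> and Bs :: "'w set" and \<gamma> where F: "C > 0" "\<delta> > 0" "ball \<xi> \<delta> \<subseteq> \<Omega>" "finite Bs" "\<gamma> ` Bs \<subseteq> \<G>"
    "\<And>y v. y \<in> ball \<xi> \<delta> \<Longrightarrow> v \<in> span_at \<G> y \<Longrightarrow>
       \<exists>a. v = (\<Sum>b\<in>Bs. a b *\<^sub>R \<gamma> b y) \<and> (\<Sum>b\<in>Bs. \<bar>a b\<bar>) \<le> C * norm v"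
    by (rule constant_rank_frame[OF \<Omega> cont dim]) blast+
  have "\<forall>i. \<exists>a. y i \<in> ball \<xi> \<delta> \<longrightarrow>
      v i = (\<Sum>b\<in>Bs. a b *\<^sub>R \<gamma> b (y i)) \<and> (\<Sum>b\<in>Bs. \<bar>a b\<bar>) \<le> C * norm (v i)"
    using F(6) mem by blast
  from choice[OF this] obtain a
    where a: "\<And>i. y i \<in> ball \<xi> \<delta> \<Longrightarrow>
      v i = (\<Sum>b\<in>Bs. a i b *\<^sub>R \<gamma> b (y i)) \<and> (\<Sum>b\<in>Bs. \<bar>a i b\<bar>) \<le> C * norm (v i)"
    by blast
  define w where "w i = (\<Sum>b\<in>Bs. a i b *\<^sub>R \<gamma> b \<xi>)" for i
  have w: "w i \<in> span_at \<G> \<xi>" for i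

    unfolding w_def
  proof (intro subspace_sum subspace_scale subspace_span_at)
    fix b assume "b \<in> Bs"
    then show "\<gamma> b \<xi> \<in> span_at \<G> \<xi>" using F(5) span_at_base[of "\<gamma> b" \<G> \<xi>] by auto
  qed
  define e where "e i = C * norm (v i) * (\<Sum>b\<in>Bs. norm (\<gamma> b (y i) - \<gamma> b \<xi>))" for i
  have "e \<longlonglongrightarrow> C * norm v0 * (\<Sum>b\<in>Bs. norm (\<gamma> b \<xi> - \<gamma> b \<xi>))"
    unfolding e_def using F(5) cont
    by (intro tendsto_intros v isCont_tendsto_compose[OF _ y]) auto
  then have e: "e \<longlonglongrightarrow> 0" by simp
  have "\<forall>\<^sub>F i in sequentially. y i \<in> ball \<xi> \<delta>"
    using y F(2) by (simp add: tendsto_iff dist_commute)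
  then have "\<forall>\<^sub>F i in sequentially. norm (v i - w i) \<le> e i"
  proof eventually_elim
    case (elim i)
    have "v i - w i = (\<Sum>b\<in>Bs. a i b *\<^sub>R (\<gamma> b (y i) - \<gamma> b \<xi>))"
      using conjunct1[OF a[OF elim]] by (simp add: w_def sum_subtractf scaleR_diff_right)
    also have "norm \<dots> \<le> (\<Sum>b\<in>Bs. (\<Sum>b\<in>Bs. \<bar>a i b\<bar>) * norm (\<gamma> b (y i) - \<gamma> b \<xi>))"
    proof (rule sum_norm_le)
      fix b assume b: "b \<in> Bs"
      have "\<bar>a i b\<bar> \<le> (\<Sum>b\<in>Bs. \<bar>a i b\<bar>)" using member_le_sum[OF b, of "\<lambda>b. \<bar>a i b\<bar>"] F(4) by simp
      then show "norm (a i b *\<^sub>R (\<gamma> b (y i) - \<gamma> b \<xi>)) \<le> (\<Sum>b\<in>Bs. \<bar>a i b\<bar>) * norm (\<gamma> b (y i) - \<gamma> b \<xi>)"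
        by (simp add: mult_right_mono)
    qed
    also have "\<dots> \<le> e i"
      unfolding e_def sum_distrib_left[symmetric] using a[OF elim]
      by (intro mult_right_mono sum_nonneg) auto
    finally show ?case .
  qed
  then have "(\<lambda>i. v i - w i) \<longlonglongrightarrow> 0" by (rule Lim_null_comparison[OF _ e])
  from tendsto_diff[OF v this] have "w \<longlonglongrightarrow> v0" by simp
  then show ?thesis
    by (rule closed_sequentially[OF closed_subspace[OF subspace_span_at] w])
qed

text \<open>Modulo the fibre, the derivative of a section depends only on its value at
  \<open>\<xi>\<close>: if the section vanishes there, its difference quotients lie in nearby
  fibres, so their limit lies in the fibre at \<open>\<xi>\<close>, which \<open>z\<close>
  annihilates. Hence the pairs of value and derivative form the graph of a functional.\<close>

lemma section_derivative_functional:
  fixes \<G> :: "('e::real_normed_vector \<Rightarrow> 'w::euclidean_space) set"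
  assumes \<Omega>: "open \<Omega>" "\<xi> \<in> \<Omega>" and cont: "\<And>G. G \<in> \<G> \<Longrightarrow> isCont G \<xi>"
    and dim: "\<And>y. y \<in> \<Omega> \<Longrightarrow> dim (span_at \<G> y) = m"
    and z: "\<And>x. x \<in> span_at \<G> \<xi> \<Longrightarrow> z \<bullet> x = 0"
  obtains \<mu> where "\<And>v. (\<And>y. y \<in> \<Omega> \<Longrightarrow> v y \<in> span_at \<G> y) \<Longrightarrow> v differentiable (at \<xi>) \<Longrightarrow>
     z \<bullet> dderiv v \<xi> w = \<mu> \<bullet> v \<xi>"
proof -
  define P where "P v \<longleftrightarrow> (\<forall>y\<in>\<Omega>. v y \<in> span_at \<G> y) \<and> v differentiable (at \<xi>)" for v
  define R where "R = {(v \<xi>, z \<bullet> dderiv v \<xi> w) | v. P v}"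
  have R: "subspace R"
  proof (rule subspaceI)
    have "P (\<lambda>_. 0)" by (simp add: P_def subspace_0)
    then show "0 \<in> R" unfolding R_def zero_prod_def by force
    show "p + q \<in> R" if "p \<in> R" "q \<in> R" for p q
    proof -
      obtain v v' where v: "P v" "P v'" "p = (v \<xi>, z \<bullet> dderiv v \<xi> w)" "q = (v' \<xi>, z \<bullet> dderiv v' \<xi> w)"
        using \<open>p \<in> R\<close> \<open>q \<in> R\<close> unfolding R_def by blast
      have d: "((\<lambda>y. v y + v' y) has_derivative (\<lambda>w. dderiv v \<xi> w + dderiv v' \<xi> w)) (at \<xi>)"
        using v(1,2) by (auto simp: P_def intro!: has_derivative_add dderiv_works)
      have "P (\<lambda>y. v y + v' y)" using v(1,2) by (auto simp: P_def intro!: subspace_add)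
      moreover have "p + q = (v \<xi> + v' \<xi>, z \<bullet> dderiv (\<lambda>y. v y + v' y) \<xi> w)"
        unfolding dderiv_eqI[OF d] using v(3,4) by (simp add: inner_right_distrib)
      ultimately show ?thesis unfolding R_def by (auto intro!: exI[of _ "\<lambda>y. v y + v' y"])
    qed
    show "r *\<^sub>R p \<in> R" if "p \<in> R" for r p
    proof -
      obtain v where v: "P v" "p = (v \<xi>, z \<bullet> dderiv v \<xi> w)"
        using \<open>p \<in> R\<close> unfolding R_def by blast
      have d: "((\<lambda>y. r *\<^sub>R v y) has_derivative (\<lambda>w. r *\<^sub>R dderiv v \<xi> w)) (at \<xi>)"
        using v(1) by (auto simp: P_def intro!: has_derivative_scaleR_right dderiv_works)
      have "P (\<lambda>y. r *\<^sub>R v y)" using v(1) by (auto simp: P_def intro!: subspace_scale)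
      moreover have "r *\<^sub>R p = (r *\<^sub>R v \<xi>, z \<bullet> dderiv (\<lambda>y. r *\<^sub>R v y) \<xi> w)"
        unfolding dderiv_eqI[OF d] using v(2) by simp
      ultimately show ?thesis unfolding R_def by (auto intro!: exI[of _ "\<lambda>y. r *\<^sub>R v y"])
    qed
  qed
  have "s = 0" if "(0, s) \<in> R" for s
  proof -
    obtain v where "P v" "(0, s) = (v \<xi>, z \<bullet> dderiv v \<xi> w)" using \<open>(0, s) \<in> R\<close> unfolding R_def by blast
    then have v: "P v" "v \<xi> = 0" "s = z \<bullet> dderiv v \<xi> w" by simp_all
    have vd: "(v has_derivative dderiv v \<xi>) (at (\<xi> + 0 *\<^sub>R w))" using v(1) by (simp add: P_def dderiv_works)
    have "((\<lambda>t. v (\<xi> + t *\<^sub>R w)) has_vector_derivative dderiv v \<xi> w) (at 0)"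
      by (rule has_vector_derivative_line[OF vd])
    then have "((\<lambda>t. norm (v (\<xi> + t *\<^sub>R w) - t *\<^sub>R dderiv v \<xi> w) / norm t) \<longlongrightarrow> 0) (at 0)"
      using v(2) by (simp add: has_vector_derivative_def has_derivative_at)
    moreover have "\<forall>\<^sub>F t in at 0. norm (v (\<xi> + t *\<^sub>R w) - t *\<^sub>R dderiv v \<xi> w) / norm t
        = norm (v (\<xi> + t *\<^sub>R w) /\<^sub>R t - dderiv v \<xi> w)"
    proof (rule eventually_mono[OF eventually_at_ball'[of 1]])
      fix t :: real assume "t \<in> ball 0 1 \<and> t \<noteq> 0 \<and> t \<in> UNIV"
      then have "t \<noteq> 0" by simp
      then have eq: "v (\<xi> + t *\<^sub>R w) /\<^sub>R t - dderiv v \<xi> w = (v (\<xi> + t *\<^sub>R w) - t *\<^sub>R dderiv v \<xi> w) /\<^sub>R t"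
        by (simp add: scaleR_diff_right)
      show "norm (v (\<xi> + t *\<^sub>R w) - t *\<^sub>R dderiv v \<xi> w) / norm t
        = norm (v (\<xi> + t *\<^sub>R w) /\<^sub>R t - dderiv v \<xi> w)"
        by (simp only: eq norm_scaleR real_norm_def abs_inverse divide_inverse mult.commute)
    qed simp
    ultimately have "((\<lambda>t. norm (v (\<xi> + t *\<^sub>R w) /\<^sub>R t - dderiv v \<xi> w)) \<longlongrightarrow> 0) (at 0)"
      by (rule Lim_transform_eventually)
    then have lim: "((\<lambda>t. v (\<xi> + t *\<^sub>R w) /\<^sub>R t) \<longlongrightarrow> dderiv v \<xi> w) (at 0)"
      by (rule LIM_zero_cancel[OF tendsto_norm_zero_cancel])
    have "((\<lambda>t. \<xi> + t *\<^sub>R w) \<longlongrightarrow> \<xi> + 0 *\<^sub>R w) (at 0)" by (intro tendsto_intros)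
    then have "\<forall>\<^sub>F t in at 0. \<xi> + t *\<^sub>R w \<in> \<Omega>" using \<Omega> by (intro topological_tendstoD) auto
    then obtain d where d: "d > 0" "\<And>t. t \<noteq> 0 \<Longrightarrow> \<bar>t\<bar> < d \<Longrightarrow> \<xi> + t *\<^sub>R w \<in> \<Omega>"
      unfolding eventually_at by auto
    \<comment> \<open>The 2 keeps \<open>t i\<close> strictly below \<open>d\<close> already for
      \<open>i = 0\<close>.\<close>
    define t where "t i = d / (2 + real i)" for i
    have t: "t i \<noteq> 0" "\<bar>t i\<bar> < d" for i using d(1) by (auto simp: t_def field_simps add_pos_nonneg)
    have "t \<longlonglongrightarrow> 0" unfolding t_def by (rule real_tendsto_divide_at_top[OF tendsto_const]) (rule filterlim_tendsto_add_at_top[OF tendsto_const filterlim_real_sequentially])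
    then have ft: "filterlim t (at 0) sequentially" using t by (auto simp: filterlim_at)
    have "dderiv v \<xi> w \<in> span_at \<G> \<xi>"
    proof (rule constant_rank_limit[OF \<Omega> cont dim])
      show "(\<lambda>i. v (\<xi> + t i *\<^sub>R w) /\<^sub>R t i) \<longlonglongrightarrow> dderiv v \<xi> w"
        by (rule filterlim_compose[OF lim ft])
      have "(\<lambda>i. \<xi> + t i *\<^sub>R w) \<longlonglongrightarrow> \<xi> + 0 *\<^sub>R w" by (intro tendsto_intros \<open>t \<longlonglongrightarrow> 0\<close>)
      then show "(\<lambda>i. \<xi> + t i *\<^sub>R w) \<longlonglongrightarrow> \<xi>" by simp
      show "v (\<xi> + t i *\<^sub>R w) /\<^sub>R t i \<in> span_at \<G> (\<xi> + t i *\<^sub>R w)" for i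
        using v(1) d(2)[OF t] by (auto simp: P_def intro: subspace_scale)
    qed
    then show "s = 0" using z v(3) by simp
  qed
  from subspace_graph_inner[OF R this] obtain m where "\<And>x s. (x, s) \<in> R \<Longrightarrow> s = m \<bullet> x" by blast
  then show ?thesis using that[of m] unfolding R_def P_def by blast
qed

text \<open>The energy \<open>U\<close> has derivative at most \<open>K * U\<close>, so
  \<open>V\<close> does not increase, and it starts at 0. The value of \<open>K\<close> comes from
  Cauchy-Schwarz: the square of the sum of the absolute values is at most
  \<open>card I * U\<close>.\<close>

lemma gronwall_zero:
  fixes u u' :: "'i \<Rightarrow> real \<Rightarrow> real"
  assumes fin: "finite I"
    and d: "\<And>i t. i \<in> I \<Longrightarrow> 0 \<le> t \<Longrightarrow> t \<le> 1 \<Longrightarrow> DERIV (u i) t :> u' i t"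
    and bd: "\<And>i t. i \<in> I \<Longrightarrow> 0 \<le> t \<Longrightarrow> t \<le> 1 \<Longrightarrow> \<bar>u' i t\<bar> \<le> C * (\<Sum>j\<in>I. \<bar>u j t\<bar>)"
    and init: "\<And>i. i \<in> I \<Longrightarrow> u i 0 = 0" and i: "i \<in> I"
  shows "u i 1 = 0"
proof -
  define K where "K = 2 * \<bar>C\<bar> * card I"
  define U where "U t = (\<Sum>i\<in>I. (u i t)\<^sup>2)" for t
  define V where "V t = exp (- (K * t)) * U t" for t
  have dV: "\<exists>y. DERIV V t :> y \<and> y \<le> 0" if t: "0 \<le> t" "t \<le> 1" for t
  proof -
    define U' where "U' = (\<Sum>i\<in>I. 2 * u i t * u' i t)"
    have dU: "DERIV U t :> U'" unfolding U_def U'_def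
      using t by (intro DERIV_sum) (auto intro!: derivative_eq_intros d)
    have dV: "DERIV V t :> exp (- (K * t)) * (U' - K * U t)" unfolding V_def
      by (rule derivative_eq_intros dU refl)+ (simp add: algebra_simps)
    define S where "S = (\<Sum>j\<in>I. \<bar>u j t\<bar>)"
    have "U' \<le> (\<Sum>i\<in>I. 2 * \<bar>u i t\<bar> * (\<bar>C\<bar> * S))" unfolding U'_def
    proof (rule sum_mono)
      fix i assume i: "i \<in> I"
      have S0: "S \<ge> 0" by (simp add: S_def sum_nonneg)
      have "\<bar>u' i t\<bar> \<le> \<bar>C\<bar> * S" using bd[OF i t] S0 unfolding S_def[symmetric]
        by (meson abs_ge_self mult_right_mono order_trans)
      then have "\<bar>2 * u i t\<bar> * \<bar>u' i t\<bar> \<le> \<bar>2 * u i t\<bar> * (\<bar>C\<bar> * S)" by (intro mult_left_mono) auto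
      then show "2 * u i t * u' i t \<le> 2 * \<bar>u i t\<bar> * (\<bar>C\<bar> * S)"
        using abs_ge_self[of "2 * u i t * u' i t"] by (simp add: abs_mult)
    qed
    also have "\<dots> = 2 * \<bar>C\<bar> * S\<^sup>2"
      by (simp add: S_def sum_distrib_left sum_distrib_right power2_eq_square algebra_simps)
    also have "\<dots> \<le> 2 * \<bar>C\<bar> * (card I * U t)"
    proof -
      have "S\<^sup>2 \<le> (\<Sum>i\<in>I. \<bar>u i t\<bar>\<^sup>2) * (\<Sum>i\<in>I. 1\<^sup>2)"
        unfolding S_def using Cauchy_Schwarz_ineq_sum[of "\<lambda>i. \<bar>u i t\<bar>" "\<lambda>_. 1" I] by simp
      then have "S\<^sup>2 \<le> card I * U t" by (simp add: U_def mult.commute)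
      then show ?thesis by (intro mult_left_mono) auto
    qed
    finally have "U' - K * U t \<le> 0" by (simp add: K_def)
    then show ?thesis using dV by (meson exp_ge_zero mult_nonneg_nonpos)
  qed
  have "V 1 \<le> V 0" by (rule DERIV_nonpos_imp_nonincreasing[of 0 1 V]) (use dV in auto)
  also have "V 0 = 0" using init by (simp add: V_def U_def)
  finally have "U 1 \<le> 0" by (simp add: V_def mult_le_0_iff)
  then have "(\<Sum>i\<in>I. (u i 1)\<^sup>2) = 0" unfolding U_def by (meson order_antisym sum_nonneg zero_le_power2)
  then show ?thesis using fin i by (simp add: sum_nonneg_eq_0_iff)
qed

text \<open>For \<open>z\<close> normal to the fibre at \<open>\<xi>\<close>, the functions z . G
  along the segment from \<open>\<xi>\<close> to \<open>y\<close> satisfy a homogeneous linear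
  differential inequality with zero initial values, so they vanish. This gives one inclusion of
  fibres, and constancy of the rank gives equality.\<close>

theorem parallel_family_locally_constant:
  fixes \<G> :: "('e::real_normed_vector \<Rightarrow> 'w::euclidean_space) set"
  assumes \<Omega>: "open \<Omega>" "\<xi> \<in> \<Omega>" and fin: "finite \<G>"
    and smooth: "\<And>G. G \<in> \<G> \<Longrightarrow> smooth_on \<Omega> G"
    and dim: "\<And>y. y \<in> \<Omega> \<Longrightarrow> dim (span_at \<G> y) = m"
    and par: "\<And>G y w. G \<in> \<G> \<Longrightarrow> y \<in> \<Omega> \<Longrightarrow> dderiv G y w \<in> span_at \<G> y"
  shows "\<forall>\<^sub>F y in nhds \<xi>. span_at \<G> y = span_at \<G> \<xi>"
proof -
  have cont: "isCont G \<xi>" if "G \<in> \<G>" for G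
    using smooth_on_differentiable[OF smooth[OF that] \<Omega>(2)] differentiable_imp_continuous_within by blast
  obtain C \<delta> and Bs :: "'w set" and \<gamma> where F: "C > 0" "\<delta> > 0" "ball \<xi> \<delta> \<subseteq> \<Omega>" "finite Bs" "\<gamma> ` Bs \<subseteq> \<G>"
    "\<And>y v. y \<in> ball \<xi> \<delta> \<Longrightarrow> v \<in> span_at \<G> y \<Longrightarrow>
       \<exists>a. v = (\<Sum>b\<in>Bs. a b *\<^sub>R \<gamma> b y) \<and> (\<Sum>b\<in>Bs. \<bar>a b\<bar>) \<le> C * norm v"
    by (rule constant_rank_frame[OF \<Omega> cont dim]) blast+
  have "span_at \<G> y = span_at \<G> \<xi>" if y: "dist y \<xi> < \<delta>" for y
  proof -
    define w where "w = y - \<xi>"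
    have seg: "\<xi> + t *\<^sub>R w \<in> ball \<xi> \<delta>" if "0 \<le> t" "t \<le> 1" for t
    proof -
      have "dist \<xi> (\<xi> + t *\<^sub>R w) = t * norm w" using that by (simp add: dist_norm)
      also have "\<dots> \<le> norm w" using that by (simp add: mult_left_le_one_le)
      finally show ?thesis using y by (simp add: w_def dist_norm)
    qed
    have "\<exists>M. \<forall>t\<in>{0..1}. norm (dderiv G (\<xi> + t *\<^sub>R w) w) \<le> M" if "G \<in> \<G>" for G
    proof -
      have "continuous_on ((\<lambda>t. \<xi> + t *\<^sub>R w) ` {0..1}) (\<lambda>y. dderiv G y w)"
        using smooth_on_continuous[OF smooth_on_dderiv[OF smooth[OF that]]]
        by (rule continuous_on_subset) (use seg F(3) in auto)
      then have "continuous_on {0..1} (\<lambda>t. dderiv G (\<xi> + t *\<^sub>R w) w)"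
        by (rule continuous_on_compose2) (auto intro!: continuous_intros)
      then have "compact ((\<lambda>t. dderiv G (\<xi> + t *\<^sub>R w) w) ` {0..1})"
        by (rule compact_continuous_image) simp
      then show ?thesis using compact_imp_bounded bounded_iff by (metis (no_types, lifting) image_eqI)
    qed
    then obtain M where M: "\<And>G t. G \<in> \<G> \<Longrightarrow> 0 \<le> t \<Longrightarrow> t \<le> 1 \<Longrightarrow> norm (dderiv G (\<xi> + t *\<^sub>R w) w) \<le> M G"
      by (metis atLeastAtMost_iff)
    \<comment> \<open>Bounds the derivatives of all generators along the segment; together with the
      frame constant it yields the rate \<open>C * M'\<close> for
      \<open>gronwall_zero\<close>.\<close>
    define M' where "M' = (\<Sum>G\<in>\<G>. \<bar>M G\<bar>)"
    have M': "norm (dderiv G (\<xi> + t *\<^sub>R w) w) \<le> M'" if "G \<in> \<G>" "0 \<le> t" "t \<le> 1" for G t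
      using M[OF that] member_le_sum[OF that(1), of "\<lambda>G. \<bar>M G\<bar>"] fin by (simp add: M'_def)
    have "(\<lambda>G. G y) ` \<G> \<subseteq> span_at \<G> \<xi>"
    proof (rule image_subsetI)
      fix G assume G: "G \<in> \<G>"
      show "G y \<in> span_at \<G> \<xi>" unfolding span_at_def
      proof (rule in_span_orthogonalI)
        fix z assume "\<And>x. x \<in> span ((\<lambda>G. G \<xi>) ` \<G>) \<Longrightarrow> z \<bullet> x = 0"
        then have z: "z \<bullet> G \<xi> = 0" if "G \<in> \<G>" for G using that by (simp add: span_base)
        define u where "u G t = z \<bullet> G (\<xi> + t *\<^sub>R w)" for G t
        define u' where "u' G t = z \<bullet> dderiv G (\<xi> + t *\<^sub>R w) w" for G t
        have "u G 1 = 0"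
        proof (rule gronwall_zero[OF fin _ _ _ G, where u' = u' and C = "C * M'"])
          fix G t assume G: "G \<in> \<G>" and t: "0 \<le> t" "t \<le> (1::real)"
          have in\<Omega>: "\<xi> + t *\<^sub>R w \<in> \<Omega>" using seg[OF t] F(3) by blast
          show "DERIV (u G) t :> u' G t"
            unfolding u_def u'_def has_real_derivative_iff_has_vector_derivative
            by (intro bounded_linear.has_vector_derivative[OF bounded_linear_inner_right]
                has_vector_derivative_line smooth_on_has_derivative[OF smooth[OF G] in\<Omega>])
          obtain a where a: "dderiv G (\<xi> + t *\<^sub>R w) w = (\<Sum>b\<in>Bs. a b *\<^sub>R \<gamma> b (\<xi> + t *\<^sub>R w))"
            "(\<Sum>b\<in>Bs. \<bar>a b\<bar>) \<le> C * norm (dderiv G (\<xi> + t *\<^sub>R w) w)"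
            using F(6)[OF seg[OF t] par[OF G in\<Omega>]] by blast
          have "\<bar>u' G t\<bar> = \<bar>\<Sum>b\<in>Bs. a b * u (\<gamma> b) t\<bar>" by (simp add: u'_def u_def a(1) inner_sum_right)
          also have "\<dots> \<le> (\<Sum>b\<in>Bs. \<bar>a b\<bar> * (\<Sum>H\<in>\<G>. \<bar>u H t\<bar>))"
          proof (rule order_trans[OF sum_abs sum_mono])
            fix b assume "b \<in> Bs"
            then have "\<bar>u (\<gamma> b) t\<bar> \<le> (\<Sum>H\<in>\<G>. \<bar>u H t\<bar>)"
              using F(5) fin by (intro member_le_sum[of _ _ "\<lambda>H. \<bar>u H t\<bar>"]) auto
            then show "\<bar>a b * u (\<gamma> b) t\<bar> \<le> \<bar>a b\<bar> * (\<Sum>H\<in>\<G>. \<bar>u H t\<bar>)"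
              by (simp add: abs_mult mult_left_mono)
          qed
          also have "\<dots> \<le> (C * M') * (\<Sum>H\<in>\<G>. \<bar>u H t\<bar>)"
            unfolding sum_distrib_right[symmetric]
          proof (rule mult_right_mono)
            show "(\<Sum>b\<in>Bs. \<bar>a b\<bar>) \<le> C * M'"
              using a(2) M'[OF G t] F(1) by (meson less_imp_le mult_left_mono order_trans)
          qed (simp add: sum_nonneg)
          finally show "\<bar>u' G t\<bar> \<le> (C * M') * (\<Sum>H\<in>\<G>. \<bar>u H t\<bar>)" .
        next
          fix G assume "G \<in> \<G>"
          then show "u G 0 = 0" using z by (simp add: u_def)
        qed
        then show "z \<bullet> G y = 0" by (simp add: u_def w_def)
      qed
    qed
    then have "span_at \<G> y \<subseteq> span_at \<G> \<xi>" unfolding span_at_def[of _ y] by (simp add: span_minimal)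
    moreover have "dim (span_at \<G> y) = dim (span_at \<G> \<xi>)"
      using dim[OF \<Omega>(2)] dim[of y] y F(3) by (auto simp: dist_commute)
    ultimately show ?thesis by (intro subspace_dim_equal) auto
  qed
  then have "\<forall>y. dist y \<xi> < \<delta> \<longrightarrow> span_at \<G> y = span_at \<G> \<xi>" by simp
  with F(2) show ?thesis unfolding eventually_nhds_metric by (intro exI[of _ \<delta>] conjI)
qed

section \<open>Linear sections of space forms\<close>

lemma bounded_bilinear_ambient_form:
  "bounded_bilinear (ambient_form k :: 'q::euclidean_space \<times> real \<Rightarrow> 'q \<times> real \<Rightarrow> real)"
proof -
  have "bounded_linear (\<lambda>z :: 'q \<times> real. (fst z, sgn k * snd z))"
    by (intro bounded_linear_Pair bounded_linear_fst
        bounded_linear_compose[OF bounded_linear_mult_right bounded_linear_snd])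
  from bounded_bilinear.comp[OF bounded_bilinear_inner this bounded_linear_ident]
  show ?thesis by (simp add: ambient_form_def[abs_def] inner_prod_def mult.assoc)
qed

interpretation ambient_form: bounded_bilinear "ambient_form k" for k
  by (rule bounded_bilinear_ambient_form)

lemma ambient_form_commute: "ambient_form k z w = ambient_form k w z"
  by (simp add: ambient_form_def inner_commute mult.commute)

lemma bilinear_ambient_form: "bilinear (ambient_form k)"
  using bounded_bilinear_ambient_form[of k] bilinear_conv_bounded_bilinear by blast

lemmas ambient_form_simps = ambient_form.add_left ambient_form.add_right ambient_form.diff_left
  ambient_form.diff_right ambient_form.scaleR_left ambient_form.scaleR_right
  ambient_form.zero_left ambient_form.zero_right ambient_form.minus_left ambient_form.minus_right

lemma space_form_norm: "z \<in> space_form k \<Longrightarrow> k \<noteq> 0 \<Longrightarrow> k * ambient_form k z z = 1"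
  by (simp add: space_form_def)

text \<open>
  The tangent space of \<open>space_form k\<close> at \<open>z\<close> is the kernel of \<open>height k z\<close>. The shift by \<open>(0, 1)\<close>
  for \<open>k = 0\<close> makes affine subspaces of \<open>space_form 0\<close> linear sections, as in the other cases.
\<close>

definition height :: "real \<Rightarrow> 'q::euclidean_space \<times> real \<Rightarrow> 'q \<times> real \<Rightarrow> real" where
  "height k z v = (if k = 0 then snd v else k * ambient_form k v z)"

definition lift :: "real \<Rightarrow> 'q::euclidean_space \<times> real \<Rightarrow> 'q \<times> real" where
  "lift k z = z + (if k = 0 then (0, 1) else 0)"

definition linear_section :: "real \<Rightarrow> ('q::euclidean_space \<times> real) set \<Rightarrow> ('q \<times> real) set" where
  "linear_section k L = {z \<in> space_form k. lift k z \<in> L}"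

lemma linear_section_UNIV: "linear_section k UNIV = space_form k"
  by (simp add: linear_section_def)

lemma linear_height: "linear (height k z)"
  by (rule linearI) (simp_all add: height_def ambient_form_simps algebra_simps)

text \<open>Thus \<open>lift k z\<close> is transverse to the tangent space at \<open>z\<close> in
  every case; for \<open>k = 0\<close> the point \<open>z\<close> itself has height 0.\<close>

lemma height_lift: "z \<in> space_form k \<Longrightarrow> height k z (lift k z) = 1"
  by (cases "k = 0") (auto simp: height_def lift_def space_form_norm space_form_def)

lemma scaleR_lift: "k *\<^sub>R lift k z = k *\<^sub>R z"
  by (simp add: lift_def)

lemma height_simps: "height k z (v + w) = height k z v + height k z w"
  "height k z (v - w) = height k z v - height k z w" "height k z (r *\<^sub>R v) = r * height k z v"
  "height k z 0 = 0"
  by (simp_all add: linear_add[OF linear_height] linear_diff[OF linear_height] linear_scale[OF linear_height]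
    linear_0[OF linear_height])

text \<open>Only \<open>k < 0\<close> has content: a vector orthogonal to a timelike one is
  spacelike. Orthogonality gives \<open>b \<bullet> a = t * s\<close>, and Cauchy-Schwarz with
  \<open>a \<bullet> a < s * s\<close> gives \<open>t * t < b \<bullet> b\<close>.\<close>

lemma ambient_form_pos:
  assumes z: "z \<in> space_form k" and v: "height k z v = 0" "v \<noteq> 0"
  shows "ambient_form k v v > 0"
proof -
  consider "k = 0" | "k > 0" | "k < 0" by linarith
  then show ?thesis
  proof cases
    case 1
    then show ?thesis using v by (cases v) (auto simp: height_def ambient_form_def zero_prod_def)
  next
    case 2
    then have "ambient_form k v v = v \<bullet> v" by (cases v) (simp add: ambient_form_def inner_Pair)
    then show ?thesis using v by simp
  next
    case 3
    obtain a s where zz: "z = (a, s)" by (cases z)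
    obtain b t where vv: "v = (b, t)" by (cases v)
    have s: "s > 0" "a \<bullet> a - s * s = 1 / k" using z 3 zz by (auto simp: space_form_def ambient_form_def)
    have ba: "b \<bullet> a = t * s" using v(1) 3 zz vv by (auto simp: height_def ambient_form_def)
    have b: "b \<noteq> 0"
    proof
      assume "b = 0"
      then have "t = 0" using ba s by simp
      then show False using \<open>b = 0\<close> v(2) vv by (simp add: zero_prod_def)
    qed
    have "(t * s)\<^sup>2 \<le> (b \<bullet> b) * (a \<bullet> a)" using Cauchy_Schwarz_ineq[of b a] ba by simp
    also have "\<dots> < (b \<bullet> b) * (s * s)"
      using s(2) 3 b by (intro mult_strict_left_mono) (auto simp: divide_less_0_iff algebra_simps)
    finally have "(t * t) * (s * s) < (b \<bullet> b) * (s * s)" by (simp add: power2_eq_square algebra_simps)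
    then have "t * t < b \<bullet> b" using s(1) by (simp add: mult_less_cancel_right)
    then show ?thesis using 3 vv by (simp add: ambient_form_def)
  qed
qed

text \<open>\<open>orth_proj\<close> is a definite description, so uniqueness matters: two
  candidates differ by a vector of \<open>W\<close> that is orthogonal to itself.\<close>

lemma orth_proj_eqI:
  assumes "subspace W" "\<And>v. v \<in> W \<Longrightarrow> v \<noteq> 0 \<Longrightarrow> ambient_form k v v > 0"
    and "w \<in> W" "\<And>v. v \<in> W \<Longrightarrow> ambient_form k (z - w) v = 0"
  shows "orth_proj k W z = w"
  unfolding orth_proj_def
proof (rule the_equality)
  fix w' assume w': "w' \<in> W \<and> (\<forall>v\<in>W. ambient_form k (z - w') v = 0)"
  have d: "w' - w \<in> W" using w' assms by (simp add: subspace_diff)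
  have "ambient_form k (z - w) (w' - w) = 0" "ambient_form k (z - w') (w' - w) = 0"
    using w' assms(4) d by auto
  then have "ambient_form k (w' - w) (w' - w) = 0" by (simp add: ambient_form_simps)
  then show "w' = w" using assms(2)[OF d] by force
qed (use assms in auto)

lemma derivative_in_subspace:
  fixes c :: "real \<Rightarrow> 'w::euclidean_space"
  assumes "subspace L" "\<epsilon> > 0" "\<And>t. t \<in> {-\<epsilon><..<\<epsilon>} \<Longrightarrow> c t \<in> L"
    and "(c has_vector_derivative v) (at 0)"
  shows "v \<in> L"
proof -
  have "v \<in> span L"
  proof (rule in_span_orthogonalI)
    fix z assume z: "\<And>x. x \<in> span L \<Longrightarrow> z \<bullet> x = 0"
    have "((\<lambda>t. z \<bullet> c t) has_vector_derivative z \<bullet> v) (at 0)"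
      by (rule bounded_linear.has_vector_derivative[OF bounded_linear_inner_right assms(4)])
    moreover have "((\<lambda>t. z \<bullet> c t) has_vector_derivative 0) (at 0)"
      by (rule has_vector_derivative_transform_within_open[of "\<lambda>_. 0" _ _ "{-\<epsilon><..<\<epsilon>}"])
        (use assms z in \<open>auto simp: span_base\<close>)
    ultimately show "z \<bullet> v = 0" by (rule vector_derivative_unique_at)
  qed
  then show ?thesis using assms(1) by (simp add: span_eq_iff[THEN iffD2])
qed

text \<open>For \<open>k \<noteq> 0\<close>, the inverse of the slice chart of \<open>space_form k\<close> around \<open>z\<close>.\<close>

definition slice_inv :: "real \<Rightarrow> 'q::euclidean_space \<times> real \<Rightarrow> 'q \<times> real \<Rightarrow> 'q \<times> real" where
  "slice_inv k z w = w - height k z w *\<^sub>R z +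
     sqrt (1 + height k z w - k * ambient_form k (w - height k z w *\<^sub>R z) (w - height k z w *\<^sub>R z)) *\<^sub>R z"

text \<open>For \<open>k < 0\<close>, positive height relative to \<open>z0\<close> selects its
  sheet of the hyperboloid. Both points have a space part shorter than their time part, so a
  nonpositive \<open>s\<close> would give \<open>a \<bullet> b \<ge> s * t\<close> by
  Cauchy-Schwarz.\<close>

lemma height_sheet:
  assumes z0: "z0 \<in> space_form k" and k: "k \<noteq> 0" and z: "k * ambient_form k z z = 1" and h: "height k z0 z > 0"
  shows "z \<in> space_form k"
proof (cases "k < 0")
  case False
  then show ?thesis using k z by (simp add: space_form_def field_simps)
next
  case True
  obtain a s where zz: "z = (a, s)" by (cases z)
  obtain b t where vv: "z0 = (b, t)" by (cases z0)
  have t: "t > 0" "b \<bullet> b - t * t = 1 / k" using z0 True vv by (auto simp: space_form_def ambient_form_def)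
  have s: "a \<bullet> a - s * s = 1 / k" using z True zz by (auto simp: ambient_form_def field_simps)
  have k0: "1 / k < 0" using True by simp
  have "(norm b)\<^sup>2 = t\<^sup>2 + 1 / k" using t(2) by (simp add: dot_square_norm power2_eq_square)
  then have "(norm b)\<^sup>2 < t\<^sup>2" using k0 by linarith
  then have 1: "norm b < t" using t(1) by (intro power2_less_imp_less[of _ t]) auto
  have "(norm a)\<^sup>2 = s\<^sup>2 + 1 / k" using s by (simp add: dot_square_norm power2_eq_square)
  then have "(norm a)\<^sup>2 < \<bar>s\<bar>\<^sup>2" using k0 by (simp only: power2_abs)
  then have 2: "norm a < \<bar>s\<bar>" by (intro power2_less_imp_less[of _ "\<bar>s\<bar>"]) auto
  have 3: "a \<bullet> b < s * t" using h True zz vv by (simp add: height_def ambient_form_def zero_less_mult_iff)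
  have "s > 0"
  proof (rule ccontr)
    assume "\<not> s > 0"
    then have "norm a < - s" using 2 by simp
    moreover have "0 \<le> - s" using \<open>norm a < - s\<close> norm_ge_zero[of a] by linarith
    ultimately have "norm a * norm b \<le> (- s) * t" using 1 by (intro mult_mono) auto
    then show False using 3 Cauchy_Schwarz_ineq2[of a b] by simp
  qed
  then show ?thesis using k z zz True by (simp add: space_form_def field_simps)
qed

text \<open>The part y of \<open>w\<close> of height 0 is orthogonal to \<open>z0\<close>, so
  \<open>k\<close> times the square of y + r z0 is k <y, y> + r^2. The radicand makes this
  \<open>1 + height k z0 w\<close>: the coordinate of \<open>w\<close> along \<open>z0\<close>
  measures the defect from the quadric.\<close>

lemma
  fixes z0 w :: "'q::euclidean_space \<times> real"
  assumes z0: "z0 \<in> space_form k" and k: "k \<noteq> 0"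
    and pos: "1 + height k z0 w - k * ambient_form k (w - height k z0 w *\<^sub>R z0) (w - height k z0 w *\<^sub>R z0) > 0"
  shows height_slice_inv: "height k z0 (slice_inv k z0 w) =
      sqrt (1 + height k z0 w - k * ambient_form k (w - height k z0 w *\<^sub>R z0) (w - height k z0 w *\<^sub>R z0))"
    and norm_slice_inv: "k * ambient_form k (slice_inv k z0 w) (slice_inv k z0 w) = 1 + height k z0 w"
proof -
  define y where "y = w - height k z0 w *\<^sub>R z0"
  define r where "r = sqrt (1 + height k z0 w - k * ambient_form k y y)"
  have r2: "r * r = 1 + height k z0 w - k * ambient_form k y y" using pos by (simp add: r_def y_def)
  have hz: "height k z0 z0 = 1" using height_lift[OF z0] k by (simp add: lift_def)
  have hy: "height k z0 y = 0" using hz by (simp add: y_def height_simps)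
  have eq: "slice_inv k z0 w = y + r *\<^sub>R z0" by (simp add: slice_inv_def y_def r_def)
  show "height k z0 (slice_inv k z0 w) =
      sqrt (1 + height k z0 w - k * ambient_form k (w - height k z0 w *\<^sub>R z0) (w - height k z0 w *\<^sub>R z0))"
    unfolding eq by (simp add: height_simps hy hz) (simp add: r_def y_def)
  have "ambient_form k y z0 = 0" using hy k by (simp add: height_def)
  then have "k * ambient_form k (slice_inv k z0 w) (slice_inv k z0 w) = k * ambient_form k y y + r * r * (k * ambient_form k z0 z0)"
    unfolding eq by (simp add: ambient_form_simps ambient_form_commute[of k z0 y] algebra_simps)
  then show "k * ambient_form k (slice_inv k z0 w) (slice_inv k z0 w) = 1 + height k z0 w"
    using r2 space_form_norm[OF z0 k] by simp
qed

text \<open>For \<open>k = 0\<close> a straight line serves. Otherwise the line through 0 with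
  velocity \<open>v\<close>, all of height 0, is carried to the quadric by \<open>slice_inv\<close>;
  it stays in \<open>L\<close> because only \<open>v\<close> and \<open>z0\<close> are
  combined.\<close>

lemma linear_section_curve:
  assumes z0: "z0 \<in> linear_section k L" and L: "subspace L" and v: "v \<in> L" "height k z0 v = 0"
  shows "v \<in> tangent_space (linear_section k L) z0"
proof (cases "k = 0")
  case True
  have z0': "z0 \<in> space_form k" "lift k z0 \<in> L" using z0 by (auto simp: linear_section_def)
  have "smooth_on {-1<..<1::real} (\<lambda>t. z0 + t *\<^sub>R v)"
    by (intro smooth_on_add smooth_on_scaleR) auto
  moreover have "z0 + t *\<^sub>R v \<in> linear_section k L" for t
  proof -
    have "lift k (z0 + t *\<^sub>R v) = lift k z0 + t *\<^sub>R v" by (simp add: lift_def)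
    then have "lift k (z0 + t *\<^sub>R v) \<in> L" using z0' v L by (simp add: subspace_add subspace_scale)
    then show ?thesis using True z0' v(2) by (simp add: linear_section_def space_form_def height_def)
  qed
  moreover have "((\<lambda>t. z0 + t *\<^sub>R v) has_vector_derivative v) (at 0)"
    by (auto intro!: derivative_eq_intros)
  ultimately show ?thesis unfolding tangent_space_def
    by (intro CollectI exI[of _ "\<lambda>t. z0 + t *\<^sub>R v"] exI[of _ "1::real"]) auto
next
  case False
  have z0': "z0 \<in> space_form k" "z0 \<in> L" using z0 False by (auto simp: linear_section_def lift_def)
  define b where "b = k * ambient_form k v v"
  define q where "q t = 1 - b * (t * t)" for t :: real
  define c where "c t = t *\<^sub>R v + sqrt (q t) *\<^sub>R z0" for t
  have cq: "c t = slice_inv k z0 (t *\<^sub>R v)" for t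
    by (simp add: c_def q_def b_def slice_inv_def height_simps v(2) ambient_form_simps algebra_simps)
  have "continuous_on UNIV q" unfolding q_def by (intro continuous_intros)
  then have "open {t. q t > 0}" by (intro open_Collect_less continuous_intros)
  moreover have "q 0 > 0" by (simp add: q_def)
  ultimately obtain \<epsilon> where \<epsilon>: "\<epsilon> > 0" "ball 0 \<epsilon> \<subseteq> {t. q t > 0}" using openE by (metis (mono_tags) mem_Collect_eq)
  have qpos: "q t > 0" if "t \<in> {-\<epsilon><..<\<epsilon>}" for t
    using \<epsilon>(2) that by (auto simp: subset_iff dist_real_def)
  have smq: "smooth_on {-\<epsilon><..<\<epsilon>} q" unfolding q_def
    by (intro smooth_on_diff smooth_on_mult) auto
  have "smooth_on {-\<epsilon><..<\<epsilon>} c" unfolding c_def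
    by (intro smooth_on_add smooth_on_scaleR smooth_on_sqrt smq)
      (auto intro: qpos)
  moreover have "c t \<in> linear_section k L" if t: "t \<in> {-\<epsilon><..<\<epsilon>}" for t
  proof -
    have "c t \<in> L" unfolding c_def using z0' v L by (intro subspace_add subspace_scale) auto
    moreover have pos: "1 + height k z0 (t *\<^sub>R v) - k * ambient_form k (t *\<^sub>R v - height k z0 (t *\<^sub>R v) *\<^sub>R z0)
        (t *\<^sub>R v - height k z0 (t *\<^sub>R v) *\<^sub>R z0) = q t"
      by (simp add: height_simps v(2) ambient_form_simps q_def b_def algebra_simps)
    have "c t \<in> space_form k"
    proof (rule height_sheet[OF z0'(1) False])
      show "k * ambient_form k (c t) (c t) = 1"
        unfolding cq using qpos[OF t] pos by (subst norm_slice_inv[OF z0'(1) False]) (simp_all add: height_simps v(2))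
      show "height k z0 (c t) > 0"
        unfolding cq using qpos[OF t] pos by (subst height_slice_inv[OF z0'(1) False]) simp_all
    qed
    ultimately show ?thesis using False by (simp add: linear_section_def lift_def)
  qed
  moreover have "(c has_vector_derivative v) (at 0)" unfolding c_def q_def
    by (auto intro!: derivative_eq_intros simp: has_vector_derivative_def)
  moreover have "c 0 = z0" by (simp add: c_def q_def)
  ultimately show ?thesis unfolding tangent_space_def
    using \<epsilon>(1) by (intro CollectI exI[of _ c] exI[of _ \<epsilon>]) auto
qed

section \<open>Tangent spaces, dimensions and slice charts of linear sections\<close>

lemma tangent_space_linear_section:
  assumes z0: "z0 \<in> linear_section k L" and L: "subspace L"
  shows "tangent_space (linear_section k L) z0 = {v \<in> L. height k z0 v = 0}"
proof (intro equalityI subsetI)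
  fix v assume "v \<in> tangent_space (linear_section k L) z0"
  then obtain c \<epsilon> where c: "\<epsilon> > 0" "c ` {-\<epsilon><..<\<epsilon>} \<subseteq> linear_section k L" "c 0 = z0"
    "(c has_vector_derivative v) (at 0)" unfolding tangent_space_def by blast
  have d: "((\<lambda>t. lift k (c t)) has_vector_derivative v) (at 0)"
    unfolding lift_def by (auto intro!: derivative_eq_intros c)
  have "c t \<in> linear_section k L" if "t \<in> {-\<epsilon><..<\<epsilon>}" for t
    using c(2) that by blast
  then have cs: "c t \<in> space_form k" "lift k (c t) \<in> L" if "t \<in> {-\<epsilon><..<\<epsilon>}" for t
    using that by (simp_all add: linear_section_def)
  have "v \<in> L" by (rule derivative_in_subspace[OF L c(1) _ d]) (use cs in auto)
  moreover have "height k z0 v = 0"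
  proof (cases "k = 0")
    case True
    have "v \<in> {v. snd v = 0}"
      by (rule derivative_in_subspace[OF _ c(1) _ c(4)])
        (use cs True in \<open>auto simp: space_form_def subspace_def\<close>)
    then show ?thesis using True by (simp add: height_def)
  next
    case False
    have "((\<lambda>t. ambient_form k (c t) (c t)) has_vector_derivative
        ambient_form k (c 0) v + ambient_form k v (c 0)) (at 0)"
      by (rule bounded_bilinear.has_vector_derivative[OF bounded_bilinear_ambient_form c(4) c(4)])
    moreover have "((\<lambda>t. ambient_form k (c t) (c t)) has_vector_derivative 0) (at 0)"
      by (rule has_vector_derivative_transform_within_open[of "\<lambda>_. 1 / k" _ _ "{-\<epsilon><..<\<epsilon>}"])
        (use cs False c(1) in \<open>auto simp: space_form_def\<close>)
    ultimately have "ambient_form k (c 0) v + ambient_form k v (c 0) = 0" by (rule vector_derivative_unique_at)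
    then show ?thesis using False c(3) by (simp add: height_def ambient_form_commute[of k z0])
  qed
  ultimately show "v \<in> {v \<in> L. height k z0 v = 0}" by simp
qed (use linear_section_curve[OF z0 L] in auto)

lemma tangent_space_form: "z \<in> space_form k \<Longrightarrow> tangent_space (space_form k) z = {v. height k z v = 0}"
  using tangent_space_linear_section[of z k UNIV] by (simp add: linear_section_UNIV)

text \<open>The direction removed is orthogonal to the tangent space: the position vector for
  \<open>k \<noteq> 0\<close>, and for \<open>k = 0\<close> the vector \<open>(0, 1)\<close>, which
  spans the radical of the form.\<close>

lemma space_form_cov_eq:
  assumes z: "z \<in> space_form k"
  shows "space_form_cov k z w = w - height k z w *\<^sub>R (if k = 0 then (0, 1) else z)"
  unfolding space_form_cov_def tangent_space_form[OF z]
proof (rule orth_proj_eqI)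
  show "subspace {v. height k z v = 0}" by (simp add: subspace_def height_simps)
  show "ambient_form k v v > 0" if "v \<in> {v. height k z v = 0}" "v \<noteq> 0" for v
    using ambient_form_pos[OF z] that by simp
  show "w - height k z w *\<^sub>R (if k = 0 then (0, 1) else z) \<in> {v. height k z v = 0}"
    using height_lift[OF z] by (auto simp: height_simps lift_def) (simp add: height_def)
  show "ambient_form k (w - (w - height k z w *\<^sub>R (if k = 0 then (0, 1) else z))) v = 0"
    if "v \<in> {v. height k z v = 0}" for v
    using that by (auto simp: ambient_form_simps ambient_form_def[of 0] height_def ambient_form_commute[of k z])
qed

lemma dim_height_kernel:
  fixes L :: "('q::euclidean_space \<times> real) set"
  assumes z0: "z0 \<in> linear_section k L" and L: "subspace L"
  shows "dim L = Suc (dim {v \<in> L. height k z0 v = 0})"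
proof -
  define K where "K = {v \<in> L. height k z0 v = 0}"
  have K: "subspace K" using L unfolding K_def by (auto simp: subspace_def height_simps)
  have z: "lift k z0 \<in> L" "height k z0 (lift k z0) = 1" using z0 height_lift[of z0 k] by (simp_all add: linear_section_def)
  have "L \<subseteq> span (insert (lift k z0) K)"
  proof
    fix l assume l: "l \<in> L"
    have "l - height k z0 l *\<^sub>R lift k z0 \<in> K"
      using l z L by (auto simp: K_def height_simps subspace_diff subspace_scale)
    then have "(l - height k z0 l *\<^sub>R lift k z0) + height k z0 l *\<^sub>R lift k z0 \<in> span (insert (lift k z0) K)"
      by (intro span_add span_scale span_base) auto
    then show "l \<in> span (insert (lift k z0) K)" by simp
  qed
  moreover have "span (insert (lift k z0) K) \<subseteq> L" using z L by (intro span_minimal) (auto simp: K_def)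
  ultimately have "L = span (insert (lift k z0) K)" by (rule equalityI)
  then have "dim L = dim (insert (lift k z0) K)" by (metis dim_span)
  moreover have "lift k z0 \<notin> span K" using z K by (auto simp: span_eq_iff[THEN iffD2] K_def)
  ultimately show ?thesis by (simp add: dim_insert K_def)
qed

text \<open>For \<open>k = 0\<close> a translation straightens the section. Otherwise the chart
  keeps the component of height 0 and uses the defining function of the quadric as coordinate along
  \<open>z0\<close>. The chart and its inverse preserve \<open>L\<close> because
  \<open>z0 \<in> L\<close>.\<close>

lemma embedded_linear_section:
  fixes L :: "('q::euclidean_space \<times> real) set"
  assumes L: "subspace L"
  shows "embedded_submanifold (dim L - 1) (linear_section k L)"
  unfolding embedded_submanifold_def
proof
  fix z0 :: "'q \<times> real" assume z0: "z0 \<in> linear_section k L"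
  define K where "K = {v \<in> L. height k z0 v = 0}"
  have K: "subspace K" using L unfolding K_def by (auto simp: subspace_def height_simps)
  have dimK: "dim K = dim L - 1" using dim_height_kernel[OF z0 L] by (simp add: K_def)
  have z0': "z0 \<in> space_form k" "lift k z0 \<in> L" using z0 by (auto simp: linear_section_def)
  have hz: "height k z0 (lift k z0) = 1" using height_lift[OF z0'(1)] .
  show "\<exists>U V \<Phi> \<Psi> K. open U \<and> z0 \<in> U \<and> open (V :: ('q \<times> real) set) \<and> homeomorphism U V \<Phi> \<Psi> \<and>
        smooth_on U \<Phi> \<and> smooth_on V \<Psi> \<and> subspace K \<and> dim K = dim L - 1 \<and> \<Phi> ` (linear_section k L \<inter> U) = K \<inter> V"
  proof (cases "k = 0")
    case True
    have "(\<lambda>z. z - z0) ` linear_section k L = K"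
    proof (intro equalityI subsetI)
      fix w assume "w \<in> (\<lambda>z. z - z0) ` linear_section k L"
      then obtain z where z: "z \<in> space_form k" "lift k z \<in> L" "w = z - z0" by (auto simp: linear_section_def)
      have "w = lift k z - lift k z0" by (simp add: z(3) lift_def)
      then have "w \<in> L" using z z0' L by (simp add: subspace_diff)
      moreover have "snd w = 0" using z z0' True by (simp add: space_form_def)
      ultimately show "w \<in> K" using True by (simp add: K_def height_def)
    next
      fix w assume w: "w \<in> K"
      have "lift k (w + z0) = w + lift k z0" by (simp add: lift_def)
      then have "lift k (w + z0) \<in> L" using w z0' L by (simp add: subspace_add K_def)
      moreover have "w + z0 \<in> space_form k" using w z0' True by (simp add: K_def height_def space_form_def)
      ultimately have "w + z0 \<in> linear_section k L" by (simp add: linear_section_def)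
      then have "(w + z0) - z0 \<in> (\<lambda>z. z - z0) ` linear_section k L" by (rule imageI)
      then show "w \<in> (\<lambda>z. z - z0) ` linear_section k L" by simp
    qed
    moreover have "homeomorphism UNIV UNIV (\<lambda>z. z - z0) (\<lambda>w. w + z0)"
      by (rule homeomorphismI) (auto intro!: continuous_intros)
    moreover have "smooth_on UNIV (\<lambda>z. z - z0)" "smooth_on UNIV (\<lambda>w. w + z0)"
      by (auto intro!: smooth_on_diff smooth_on_add)
    ultimately show ?thesis using K dimK
      by (intro exI[of _ UNIV] exI[of _ "\<lambda>z. z - z0"] exI[of _ "\<lambda>w. w + z0"] exI[of _ K]) simp
  next
    case False
    define q where "q w = 1 + height k z0 w - k * ambient_form k (w - height k z0 w *\<^sub>R z0) (w - height k z0 w *\<^sub>R z0)" for w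
    define U where "U = {z. height k z0 z > 0}"
    define V where "V = {w. q w > 0}"
    define \<Phi> where "\<Phi> z = z - height k z0 z *\<^sub>R z0 + (k * ambient_form k z z - 1) *\<^sub>R z0" for z
    define \<Psi> where "\<Psi> = slice_inv k z0"
    have hz: "height k z0 z0 = 1" using hz False by (simp add: lift_def)
    have bl: "bounded_linear (height k z0)" using linear_height linear_conv_bounded_linear by blast
    have h_smooth: "smooth_on X (height k z0)" if "open X" for X
      using smooth_on_bounded_linear[OF that bl smooth_on_ident] .
    have "smooth_on X (\<lambda>w. w - height k z0 w *\<^sub>R z0)" if "open X" for X
      using that by (intro smooth_on_diff smooth_on_scaleR h_smooth) auto
    note y_smooth = this
    have q_smooth: "smooth_on X q" if "open X" for X
      unfolding q_def using that
      by (intro smooth_on_diff smooth_on_add h_smooth smooth_on_mult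
          smooth_on_bounded_bilinear[OF _ bounded_bilinear_ambient_form] y_smooth) auto
    have U: "open U" unfolding U_def
      using smooth_on_continuous[OF h_smooth[OF open_UNIV]] by (intro open_Collect_less continuous_intros)
    have V: "open V" unfolding V_def
      using smooth_on_continuous[OF q_smooth[OF open_UNIV]] by (intro open_Collect_less continuous_intros)
    have \<Phi>_smooth: "smooth_on U \<Phi>" unfolding \<Phi>_def using U
      by (intro smooth_on_diff smooth_on_add smooth_on_scaleR
          h_smooth smooth_on_mult
          smooth_on_bounded_bilinear[OF _ bounded_bilinear_ambient_form]) auto
    have \<Psi>_smooth: "smooth_on V \<Psi>" unfolding \<Psi>_def slice_inv_def[abs_def] q_def[symmetric] using V
      by (intro smooth_on_add smooth_on_scaleR y_smooth
          smooth_on_sqrt q_smooth) (auto simp: V_def)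
    have hPhi: "height k z0 (\<Phi> z) = k * ambient_form k z z - 1" for z
      by (simp add: \<Phi>_def height_simps hz)
    have Phi_y: "\<Phi> z - height k z0 (\<Phi> z) *\<^sub>R z0 = z - height k z0 z *\<^sub>R z0" for z
      by (simp add: hPhi) (simp add: \<Phi>_def)
    \<comment> \<open>So the square root in \<open>\<Psi>\<close> returns the height of
      \<open>z\<close>, which is positive on \<open>U\<close>.\<close>
    have qPhi: "q (\<Phi> z) = (height k z0 z)\<^sup>2" for z
    proof -
      have kz: "k * ambient_form k z0 z0 = 1" using space_form_norm[OF z0'(1) False] .
      define h where "h = height k z0 z"
      have 1: "k * ambient_form k z z0 = h" using False by (simp add: height_def h_def)
      have "k * ambient_form k (z - h *\<^sub>R z0) (z - h *\<^sub>R z0)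
          = k * ambient_form k z z - 2 * h * (k * ambient_form k z z0) + h * h * (k * ambient_form k z0 z0)"
        by (simp add: ambient_form_simps ambient_form_commute[of k z0 z] algebra_simps)
      also have "\<dots> = k * ambient_form k z z - h\<^sup>2" by (simp only: 1 kz) (simp add: power2_eq_square)
      finally show ?thesis unfolding q_def Phi_y unfolding hPhi h_def[symmetric] by simp
    qed
    have Psi: "\<Psi> w = w - height k z0 w *\<^sub>R z0 + sqrt (q w) *\<^sub>R z0" for w
      by (simp add: \<Psi>_def slice_inv_def q_def)
    have \<Phi>V: "\<Phi> z \<in> V" and \<Psi>\<Phi>: "\<Psi> (\<Phi> z) = z" if "z \<in> U" for z
    proof -
      show "\<Phi> z \<in> V" using that qPhi[of z] by (simp add: V_def U_def)
      have "\<Psi> (\<Phi> z) = z - height k z0 z *\<^sub>R z0 + sqrt (q (\<Phi> z)) *\<^sub>R z0"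
        unfolding Psi[of "\<Phi> z"] Phi_y ..
      then show "\<Psi> (\<Phi> z) = z" using that by (simp add: qPhi U_def)
    qed
    have hPsi: "height k z0 (\<Psi> w) = sqrt (q w)" "k * ambient_form k (\<Psi> w) (\<Psi> w) = 1 + height k z0 w" if "w \<in> V" for w
      using that height_slice_inv[OF z0'(1) False, of w] norm_slice_inv[OF z0'(1) False, of w]
      by (auto simp: V_def q_def \<Psi>_def)
    have \<Psi>U: "\<Psi> w \<in> U" and \<Phi>\<Psi>: "\<Phi> (\<Psi> w) = w" if "w \<in> V" for w
    proof -
      show "\<Psi> w \<in> U" using that hPsi(1)[OF that] by (simp add: U_def V_def)
      show "\<Phi> (\<Psi> w) = w" unfolding \<Phi>_def hPsi[OF that]
        by (simp add: \<Psi>_def slice_inv_def q_def)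
    qed
    have homeo: "homeomorphism U V \<Phi> \<Psi>"
      using \<Phi>V \<Psi>U \<Phi>\<Psi> \<Psi>\<Phi> smooth_on_continuous[OF \<Phi>_smooth] smooth_on_continuous[OF \<Psi>_smooth]
      by (intro homeomorphismI) auto
    have "\<Phi> ` (linear_section k L \<inter> U) = K \<inter> V"
    proof (intro equalityI subsetI)
      fix w assume "w \<in> \<Phi> ` (linear_section k L \<inter> U)"
      then obtain z where z: "z \<in> U" "z \<in> space_form k" "z \<in> L" "w = \<Phi> z"
        using False by (auto simp: linear_section_def lift_def)
      have "z0 \<in> L" using z0' False by (simp add: lift_def)
      then have "w \<in> L" unfolding z(4) \<Phi>_def using L z(3) by (intro subspace_add subspace_diff subspace_scale) auto
      moreover have "height k z0 w = 0" using hPhi[of z] z space_form_norm[OF z(2) False] by simp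
      ultimately show "w \<in> K \<inter> V" using \<Phi>V[OF z(1)] z(4) by (simp add: K_def)
    next
      fix w assume w: "w \<in> K \<inter> V"
      then have h0: "height k z0 w = 0" by (simp add: K_def)
      have "z0 \<in> L" using z0' False by (simp add: lift_def)
      then have "\<Psi> w \<in> L" unfolding \<Psi>_def slice_inv_def using w L
        by (intro subspace_add subspace_diff subspace_scale) (auto simp: K_def)
      moreover have "\<Psi> w \<in> space_form k"
        using w hPsi(2)[of w] h0 \<Psi>U[of w] by (intro height_sheet[OF z0'(1) False]) (auto simp: U_def)
      ultimately have "\<Psi> w \<in> linear_section k L \<inter> U" using \<Psi>U[of w] w False
        by (simp add: linear_section_def lift_def)
      then show "w \<in> \<Phi> ` (linear_section k L \<inter> U)" using \<Phi>\<Psi>[of w] w by (metis IntD2 imageI)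
    qed
    moreover have "z0 \<in> U" using hz by (simp add: U_def)
    ultimately show ?thesis using U V homeo \<Phi>_smooth \<Psi>_smooth K dimK
      by (intro exI[of _ U] exI[of _ V] exI[of _ \<Phi>] exI[of _ \<Psi>] exI[of _ K]) simp
  qed
qed

text \<open>Along a curve in the section a tangent field takes values in \<open>L\<close>, hence so
  does its derivative. Its tangential part differs from it by a multiple of \<open>z \<in> L\<close>
  for \<open>k \<noteq> 0\<close>, and not at all for \<open>k = 0\<close>.\<close>

theorem totally_geodesic_linear_section:
  fixes L :: "('q::euclidean_space \<times> real) set"
  assumes L: "subspace L"
  shows "totally_geodesic_submanifold k (dim L - 1) (linear_section k L)"
  unfolding totally_geodesic_submanifold_def
proof (intro conjI ballI allI impI)
  show "embedded_submanifold (dim L - 1) (linear_section k L)" by (rule embedded_linear_section[OF L])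
  show "linear_section k L \<subseteq> space_form k" by (auto simp: linear_section_def)
  fix z u U and Y :: "'q \<times> real \<Rightarrow> 'q \<times> real"
  assume z: "z \<in> linear_section k L" and u: "u \<in> tangent_space (linear_section k L) z"
    and Y: "open U \<and> z \<in> U \<and> smooth_on U Y \<and>
      (\<forall>y\<in>linear_section k L \<inter> U. Y y \<in> tangent_space (linear_section k L) y)"
  have z': "z \<in> space_form k" "lift k z \<in> L" using z by (auto simp: linear_section_def)
  obtain c \<epsilon> where c: "\<epsilon> > 0" "c ` {-\<epsilon><..<\<epsilon>} \<subseteq> linear_section k L" "c 0 = z"
    "(c has_vector_derivative u) (at 0)" using u unfolding tangent_space_def by blast
  have "isCont c 0" using c(4) has_vector_derivative_continuous by blast
  then have "(c \<longlongrightarrow> c 0) (nhds 0)" by (simp add: isCont_def tendsto_at_iff_tendsto_nhds)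
  then have "\<forall>\<^sub>F t in nhds 0. c t \<in> U" using Y c(3) by (intro topological_tendstoD) auto
  then obtain d where d: "d > 0" "\<And>t. dist t 0 < d \<Longrightarrow> c t \<in> U" unfolding eventually_nhds_metric by blast
  define e where "e = min d \<epsilon>"
  have e: "e > 0" using d c by (simp add: e_def)
  have Yc: "Y (c t) \<in> L" "k = 0 \<Longrightarrow> snd (Y (c t)) = 0" if "t \<in> {-e<..<e}" for t
  proof -
    have "c t \<in> U" "c t \<in> linear_section k L" using that d c(2) by (auto simp: e_def dist_real_def)
    then have "Y (c t) \<in> {v \<in> L. height k (c t) v = 0}" using Y tangent_space_linear_section[OF _ L] by blast
    then show "Y (c t) \<in> L" "k = 0 \<Longrightarrow> snd (Y (c t)) = 0" by (auto simp: height_def)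
  qed
  have "(Y has_derivative dderiv Y z) (at (c 0))" using Y c(3) smooth_on_has_derivative[of U Y z] by simp
  from vector_derivative_diff_chain_within[of c u 0 UNIV Y "dderiv Y z"] this c(4)
  have dYc: "((\<lambda>t. Y (c t)) has_vector_derivative dderiv Y z u) (at 0)"
    using has_derivative_at_withinI by (fastforce simp: o_def)
  have 1: "dderiv Y z u \<in> L" by (rule derivative_in_subspace[OF L e Yc(1) dYc])
  have 2: "space_form_cov k z (dderiv Y z u) \<in> {v \<in> L. height k z v = 0}"
  proof (cases "k = 0")
    case True
    have "dderiv Y z u \<in> {v. snd v = 0}"
      by (rule derivative_in_subspace[OF _ e _ dYc]) (use Yc(2) True in \<open>auto simp: subspace_def\<close>)
    then show ?thesis using 1 True z'(1) by (simp add: space_form_cov_eq height_def zero_prod_def[symmetric])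
  next
    case False
    then have zL: "z \<in> L" "height k z z = 1" using z' height_lift[OF z'(1)] by (auto simp: lift_def)
    then show ?thesis using 1 False L
      by (simp add: space_form_cov_eq[OF z'(1)] height_simps subspace_diff subspace_scale)
  qed
  then show "space_form_cov k z (dderiv Y z u) \<in> tangent_space (linear_section k L) z"
    by (simp add: tangent_space_linear_section[OF z L])
qed

section \<open>The Gauss equation in a chart\<close>

text \<open>Expansion in the standard basis turns \<open>m y (g y)\<close> into finitely many
  products, so differentiability of \<open>m\<close> for each fixed argument is enough.\<close>

lemma has_derivative_linear_apply:
  fixes m :: "'a::real_normed_vector \<Rightarrow> 'b::euclidean_space \<Rightarrow> 'c::real_normed_vector"
  assumes \<Omega>: "open \<Omega>" "\<xi> \<in> \<Omega>" and lin: "\<And>y. y \<in> \<Omega> \<Longrightarrow> linear (m y)"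
    and m: "\<And>a. (\<lambda>y. m y a) differentiable (at \<xi>)" and g: "(g has_derivative g') (at \<xi>)"
  shows "((\<lambda>y. m y (g y)) has_derivative (\<lambda>u. dderiv (\<lambda>y. m y (g \<xi>)) \<xi> u + m \<xi> (g' u))) (at \<xi>)"
proof -
  have rep: "m y a = (\<Sum>b\<in>Basis. (a \<bullet> b) *\<^sub>R m y b)" if "y \<in> \<Omega>" for y a
  proof -
    have "m y a = m y (\<Sum>b\<in>Basis. (a \<bullet> b) *\<^sub>R b)" by (simp add: euclidean_representation)
    then show ?thesis by (simp add: linear_sum[OF lin[OF that]] linear_scale[OF lin[OF that]])
  qed
  have dsum: "((\<lambda>y. \<Sum>b\<in>Basis. (f y \<bullet> b) *\<^sub>R m y b) has_derivative
      (\<lambda>u. \<Sum>b\<in>Basis. (f \<xi> \<bullet> b) *\<^sub>R dderiv (\<lambda>y. m y b) \<xi> u + (f' u \<bullet> b) *\<^sub>R m \<xi> b)) (at \<xi>)"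
    if "(f has_derivative f') (at \<xi>)" for f f'
    by (intro has_derivative_sum has_derivative_scaleR has_derivative_inner_left that dderiv_works m)
  have d: "((\<lambda>y. m y (f y)) has_derivative
      (\<lambda>u. \<Sum>b\<in>Basis. (f \<xi> \<bullet> b) *\<^sub>R dderiv (\<lambda>y. m y b) \<xi> u + (f' u \<bullet> b) *\<^sub>R m \<xi> b)) (at \<xi>)"
    if "(f has_derivative f') (at \<xi>)" for f f'
    by (rule has_derivative_transform_within_open[OF dsum[OF that] \<Omega>]) (simp add: rep[symmetric])
  have dg: "dderiv (\<lambda>y. m y (g \<xi>)) \<xi> u = (\<Sum>b\<in>Basis. (g \<xi> \<bullet> b) *\<^sub>R dderiv (\<lambda>y. m y b) \<xi> u)" for u
    unfolding dderiv_eqI[OF d[OF has_derivative_const[of "g \<xi>"]]] by simp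
  have "(\<lambda>u. dderiv (\<lambda>y. m y (g \<xi>)) \<xi> u + m \<xi> (g' u)) =
      (\<lambda>u. \<Sum>b\<in>Basis. (g \<xi> \<bullet> b) *\<^sub>R dderiv (\<lambda>y. m y b) \<xi> u + (g' u \<bullet> b) *\<^sub>R m \<xi> b)"
    unfolding dg sum.distrib by (rule ext, subst rep[OF \<Omega>(2)], rule refl)
  then show ?thesis using d[OF g] by simp
qed

text \<open>Where \<open>d\<close> vanishes, a derivative of \<open>\<phi>\<close> would only enter
  with factor 0, so continuity of \<open>\<phi>\<close> suffices. This upgrades continuity of
  solutions of linear systems to differentiability.\<close>

lemma has_derivative_continuous_scaleR_zero:
  fixes \<phi> :: "'a::real_normed_vector \<Rightarrow> real" and d :: "'a \<Rightarrow> 'b::real_normed_vector"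
  assumes \<phi>: "isCont \<phi> \<xi>" and d: "(d has_derivative D) (at \<xi>)" "d \<xi> = 0"
  shows "((\<lambda>y. \<phi> y *\<^sub>R d y) has_derivative (\<lambda>u. \<phi> \<xi> *\<^sub>R D u)) (at \<xi>)"
proof -
  have bD: "bounded_linear D" using d(1) by (rule has_derivative_bounded_linear)
  then obtain K where K: "\<And>u. norm (D u) \<le> norm u * K" "K > 0" using bounded_linear.pos_bounded by metis
  define E where "E y = norm (d y - D (y - \<xi>)) / norm (y - \<xi>)" for y
  have E: "(E \<longlongrightarrow> 0) (at \<xi>)" using d unfolding E_def by (simp add: has_derivative_at2 has_derivative_iff_norm)
  have p: "(\<phi> \<longlongrightarrow> \<phi> \<xi>) (at \<xi>)" using \<phi> by (simp add: isCont_def)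
  have lim: "((\<lambda>y. \<bar>\<phi> y\<bar> * E y + \<bar>\<phi> y - \<phi> \<xi>\<bar> * K) \<longlongrightarrow> \<bar>\<phi> \<xi>\<bar> * 0 + \<bar>\<phi> \<xi> - \<phi> \<xi>\<bar> * K) (at \<xi>)"
    by (intro tendsto_intros p E)
  show ?thesis unfolding has_derivative_iff_norm
  proof (intro conjI)
    show "bounded_linear (\<lambda>u. \<phi> \<xi> *\<^sub>R D u)" using bD by (rule bounded_linear_const_scaleR)
    show "((\<lambda>y. norm (\<phi> y *\<^sub>R d y - \<phi> \<xi> *\<^sub>R d \<xi> - \<phi> \<xi> *\<^sub>R D (y - \<xi>)) / norm (y - \<xi>)) \<longlongrightarrow> 0) (at \<xi>)"
    proof (rule Lim_null_comparison)
      show "((\<lambda>y. \<bar>\<phi> y\<bar> * E y + \<bar>\<phi> y - \<phi> \<xi>\<bar> * K) \<longlongrightarrow> 0) (at \<xi>)" using lim by simp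
      show "\<forall>\<^sub>F y in at \<xi>. norm (norm (\<phi> y *\<^sub>R d y - \<phi> \<xi> *\<^sub>R d \<xi> - \<phi> \<xi> *\<^sub>R D (y - \<xi>)) / norm (y - \<xi>))
          \<le> \<bar>\<phi> y\<bar> * E y + \<bar>\<phi> y - \<phi> \<xi>\<bar> * K"
      proof (rule eventually_mono[OF eventually_at_ball'[of 1]])
        fix y assume "y \<in> ball \<xi> 1 \<and> y \<noteq> \<xi> \<and> y \<in> UNIV"
        then have n: "norm (y - \<xi>) > 0" by simp
        have "\<phi> y *\<^sub>R d y - \<phi> \<xi> *\<^sub>R d \<xi> - \<phi> \<xi> *\<^sub>R D (y - \<xi>)
            = \<phi> y *\<^sub>R (d y - D (y - \<xi>)) + (\<phi> y - \<phi> \<xi>) *\<^sub>R D (y - \<xi>)"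
          using d(2) by (simp add: algebra_simps)
        then have "norm (\<phi> y *\<^sub>R d y - \<phi> \<xi> *\<^sub>R d \<xi> - \<phi> \<xi> *\<^sub>R D (y - \<xi>))
            \<le> \<bar>\<phi> y\<bar> * norm (d y - D (y - \<xi>)) + \<bar>\<phi> y - \<phi> \<xi>\<bar> * norm (D (y - \<xi>))"
          using norm_triangle_ineq[of "\<phi> y *\<^sub>R (d y - D (y - \<xi>))" "(\<phi> y - \<phi> \<xi>) *\<^sub>R D (y - \<xi>)"] by simp
        also have "\<dots> \<le> \<bar>\<phi> y\<bar> * norm (d y - D (y - \<xi>)) + \<bar>\<phi> y - \<phi> \<xi>\<bar> * (norm (y - \<xi>) * K)"
          using K(1) by (intro add_left_mono mult_left_mono) auto
        also have "\<dots> = (\<bar>\<phi> y\<bar> * E y + \<bar>\<phi> y - \<phi> \<xi>\<bar> * K) * norm (y - \<xi>)"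
          using n by (simp add: E_def field_simps)
        finally show "norm (norm (\<phi> y *\<^sub>R d y - \<phi> \<xi> *\<^sub>R d \<xi> - \<phi> \<xi> *\<^sub>R D (y - \<xi>)) / norm (y - \<xi>))
          \<le> \<bar>\<phi> y\<bar> * E y + \<bar>\<phi> y - \<phi> \<xi>\<bar> * K" using n by (simp add: divide_le_eq)
      qed simp
    qed
  qed
qed

text \<open>Christoffel symbols are definite descriptions, so their differentiability is read off
  the system they solve. With \<open>f\<close> inverting \<open>G \<xi>\<close>, the solution is
  \<open>f\<close> of \<open>r\<close> minus a perturbation whose factors \<open>\<delta> b\<close>
  vanish at \<open>\<xi>\<close>. This gives first continuity, by absorption, and then
  differentiability.\<close>

lemma linear_system_differentiable:
  fixes G :: "'a::real_normed_vector \<Rightarrow> 'e::euclidean_space \<Rightarrow> 'e"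
  assumes \<Omega>: "open \<Omega>" "\<xi> \<in> \<Omega>" and lin: "\<And>y. y \<in> \<Omega> \<Longrightarrow> linear (G y)" and inj: "inj (G \<xi>)"
    and G: "\<And>a. (\<lambda>y. G y a) differentiable (at \<xi>)" and r: "r differentiable (at \<xi>)"
    and eq: "\<And>y. y \<in> \<Omega> \<Longrightarrow> G y (z y) = r y"
  shows "z differentiable (at \<xi>)"
proof -
  obtain f where f: "linear f" "\<And>x. f (G \<xi> x) = x"
    using linear_injective_isomorphism[OF lin[OF \<Omega>(2)] inj] by blast
  have bf: "bounded_linear f" using f(1) by (simp add: linear_conv_bounded_linear)
  then obtain K where K: "\<And>u. norm (f u) \<le> norm u * K" "K > 0" using bounded_linear.pos_bounded by metis
  define \<delta> where "\<delta> b y = G y b - G \<xi> b" for b y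
  have \<delta>: "(\<delta> b has_derivative dderiv (\<lambda>y. G y b) \<xi>) (at \<xi>)" for b
    unfolding \<delta>_def using has_derivative_diff[OF dderiv_works[OF G] has_derivative_const] by fastforce
  define \<epsilon> where "\<epsilon> y = (\<Sum>b\<in>Basis. norm (\<delta> b y))" for y
  have "isCont (\<delta> b) \<xi>" for b using has_derivative_continuous[OF \<delta>] .
  then have "isCont \<epsilon> \<xi>" unfolding \<epsilon>_def by (intro continuous_intros) auto
  then have \<epsilon>: "(\<epsilon> \<longlongrightarrow> 0) (nhds \<xi>)"
    by (simp add: isCont_def tendsto_at_iff_tendsto_nhds) (simp add: \<epsilon>_def \<delta>_def)
  have rc: "(r \<longlongrightarrow> r \<xi>) (nhds \<xi>)" using differentiable_imp_continuous_within[OF r]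
    by (simp add: isCont_def tendsto_at_iff_tendsto_nhds)
  have diff: "G y a - G \<xi> a = (\<Sum>b\<in>Basis. (a \<bullet> b) *\<^sub>R \<delta> b y)" if "y \<in> \<Omega>" for y a
  proof -
    have "linear (\<lambda>a. G y a - G \<xi> a)" using lin[OF that] lin[OF \<Omega>(2)] by (rule linear_compose_sub)
    then have "G y (\<Sum>b\<in>Basis. (a \<bullet> b) *\<^sub>R b) - G \<xi> (\<Sum>b\<in>Basis. (a \<bullet> b) *\<^sub>R b) = (\<Sum>b\<in>Basis. (a \<bullet> b) *\<^sub>R \<delta> b y)"
      unfolding \<delta>_def by (simp add: linear_sum[OF lin[OF that]] linear_sum[OF lin[OF \<Omega>(2)]]
        linear_scale[OF lin[OF that]] linear_scale[OF lin[OF \<Omega>(2)]] scaleR_diff_right sum_subtractf)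
    then show ?thesis by (simp add: euclidean_representation)
  qed
  have z: "z y = f (r y - (\<Sum>b\<in>Basis. (z y \<bullet> b) *\<^sub>R \<delta> b y))" if "y \<in> \<Omega>" for y
    using diff[OF that, of "z y"] eq[OF that] f(2)[of "z y"] by (simp add: algebra_simps)
  have z\<xi>: "z \<xi> = f (r \<xi>)" using eq[OF \<Omega>(2)] f(2)[of "z \<xi>"] by simp
  have bnd: "norm (z y - z \<xi>) \<le> K * norm (r y - r \<xi>) + K * \<epsilon> y * (norm (z y - z \<xi>) + norm (z \<xi>))"
    if "y \<in> \<Omega>" for y
  proof -
    have "z y - z \<xi> = f ((r y - r \<xi>) - (\<Sum>b\<in>Basis. (z y \<bullet> b) *\<^sub>R \<delta> b y))"
      using z[OF that] z\<xi> by (simp add: linear_diff[OF f(1)])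
    then have "norm (z y - z \<xi>) \<le> norm ((r y - r \<xi>) - (\<Sum>b\<in>Basis. (z y \<bullet> b) *\<^sub>R \<delta> b y)) * K" using K(1) by metis
    also have "norm ((r y - r \<xi>) - (\<Sum>b\<in>Basis. (z y \<bullet> b) *\<^sub>R \<delta> b y)) \<le> norm (r y - r \<xi>) + norm (z y) * \<epsilon> y"
    proof (rule order_trans[OF norm_triangle_ineq4 add_left_mono])
      have "norm (\<Sum>b\<in>Basis. (z y \<bullet> b) *\<^sub>R \<delta> b y) \<le> (\<Sum>b\<in>Basis. norm (z y) * norm (\<delta> b y))"
        by (rule sum_norm_le) (simp add: Basis_le_norm mult_right_mono)
      then show "norm (\<Sum>b\<in>Basis. (z y \<bullet> b) *\<^sub>R \<delta> b y) \<le> norm (z y) * \<epsilon> y"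
        by (simp add: \<epsilon>_def sum_distrib_left)
    qed
    also have "norm (z y) * \<epsilon> y \<le> (norm (z y - z \<xi>) + norm (z \<xi>)) * \<epsilon> y"
      using norm_triangle_ineq[of "z y - z \<xi>" "z \<xi>"] by (intro mult_right_mono) (auto simp: \<epsilon>_def sum_nonneg)
    finally show ?thesis using K(2) by (simp add: algebra_simps)
  qed
  have "((\<lambda>y. z y - z \<xi>) \<longlongrightarrow> 0) (nhds \<xi>)"
  proof (rule Lim_null_comparison)
    have "((\<lambda>y. 2 * (K * norm (r y - r \<xi>) + K * \<epsilon> y * norm (z \<xi>))) \<longlongrightarrow>
        2 * (K * norm (r \<xi> - r \<xi>) + K * 0 * norm (z \<xi>))) (nhds \<xi>)"
      by (intro tendsto_intros rc \<epsilon>)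
    then show "((\<lambda>y. 2 * (K * norm (r y - r \<xi>) + K * \<epsilon> y * norm (z \<xi>))) \<longlongrightarrow> 0) (nhds \<xi>)" by simp
    have "((\<lambda>y. K * \<epsilon> y) \<longlongrightarrow> K * 0) (nhds \<xi>)" by (intro tendsto_intros \<epsilon>)
    \<comment> \<open>Half of the unknown increment in \<open>bnd\<close> is absorbed on the left,
      whence the factor 2.\<close>
    then have "\<forall>\<^sub>F y in nhds \<xi>. K * \<epsilon> y < 1 / 2" by (rule order_tendstoD) simp
    moreover have "\<forall>\<^sub>F y in nhds \<xi>. y \<in> \<Omega>" using \<Omega> by (rule eventually_nhds_in_open)
    ultimately show "\<forall>\<^sub>F y in nhds \<xi>. norm (z y - z \<xi>) \<le> 2 * (K * norm (r y - r \<xi>) + K * \<epsilon> y * norm (z \<xi>))"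
    proof eventually_elim
      case (elim y)
      have "K * \<epsilon> y * norm (z y - z \<xi>) \<le> 1 / 2 * norm (z y - z \<xi>)" using elim by (intro mult_right_mono) auto
      then show ?case using bnd[OF elim(2)] by (simp add: algebra_simps)
    qed
  qed
  then have "(z \<longlongrightarrow> z \<xi>) (nhds \<xi>)" by (rule LIM_zero_cancel)
  then have zc: "isCont z \<xi>" by (simp add: isCont_def tendsto_at_iff_tendsto_nhds)
  have "((\<lambda>y. \<Sum>b\<in>Basis. (z y \<bullet> b) *\<^sub>R \<delta> b y) has_derivative
      (\<lambda>u. \<Sum>b\<in>Basis. (z \<xi> \<bullet> b) *\<^sub>R dderiv (\<lambda>y. G y b) \<xi> u)) (at \<xi>)"
  proof (rule has_derivative_sum)
    fix b :: 'e
    have "isCont (\<lambda>y. z y \<bullet> b) \<xi>" by (intro continuous_intros zc)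
    moreover have "\<delta> b \<xi> = 0" by (simp add: \<delta>_def)
    ultimately show "((\<lambda>y. (z y \<bullet> b) *\<^sub>R \<delta> b y) has_derivative (\<lambda>u. (z \<xi> \<bullet> b) *\<^sub>R dderiv (\<lambda>y. G y b) \<xi> u)) (at \<xi>)"
      by (rule has_derivative_continuous_scaleR_zero[OF _ \<delta>])
  qed
  from bounded_linear.has_derivative[OF bf has_derivative_diff[OF dderiv_works[OF r] this]]
  have "(\<lambda>y. f (r y - (\<Sum>b\<in>Basis. (z y \<bullet> b) *\<^sub>R \<delta> b y))) differentiable (at \<xi>)"
    unfolding differentiable_def by blast
  moreover have "z differentiable (at \<xi>) \<longleftrightarrow> (\<lambda>y. f (r y - (\<Sum>b\<in>Basis. (z y \<bullet> b) *\<^sub>R \<delta> b y))) differentiable (at \<xi>)"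
    by (rule differentiable_cong_open[OF \<Omega>]) (rule z)
  ultimately show ?thesis by blast
qed

section \<open>Coordinate immersions: Gauss formula and Gauss equation\<close>

locale local_immersion =
  fixes \<Omega> :: "'e::euclidean_space set" and F :: "'e \<Rightarrow> 'q::euclidean_space \<times> real"
    and k :: real and h :: "'e \<Rightarrow> 'e \<Rightarrow> 'e \<Rightarrow> real"
  assumes open_\<Omega>: "open \<Omega>" and F: "smooth_on \<Omega> F" and F_in: "\<xi> \<in> \<Omega> \<Longrightarrow> F \<xi> \<in> space_form k"
    and inj_dF: "\<xi> \<in> \<Omega> \<Longrightarrow> inj (dderiv F \<xi>)"
    and h_eq: "\<xi> \<in> \<Omega> \<Longrightarrow> h \<xi> u v = ambient_form k (dderiv F \<xi> u) (dderiv F \<xi> v)"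
begin

definition D2 :: "'e \<Rightarrow> 'e \<Rightarrow> 'e \<Rightarrow> 'q \<times> real" where
  "D2 \<xi> u v = dderiv (\<lambda>y. dderiv F y v) \<xi> u"

definition D3 :: "'e \<Rightarrow> 'e \<Rightarrow> 'e \<Rightarrow> 'e \<Rightarrow> 'q \<times> real" where
  "D3 \<xi> w u v = dderiv (\<lambda>y. D2 y u v) \<xi> w"

text \<open>Gauss formula in the flat ambient space: the second derivative minus its tangential
  part, where the last term cancels the component along the position vector, found in
  \<open>height_D2\<close>.\<close>

definition \<alpha> :: "'e \<Rightarrow> 'e \<Rightarrow> 'e \<Rightarrow> 'q \<times> real" where
  "\<alpha> \<xi> u v = D2 \<xi> u v - dderiv F \<xi> (christoffel h \<xi> u v) + (k * h \<xi> u v) *\<^sub>R F \<xi>"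

lemma smooth_dF: "smooth_on \<Omega> (\<lambda>y. dderiv F y v)"
  by (rule smooth_on_dderiv[OF F])

lemma smooth_D2: "smooth_on \<Omega> (\<lambda>y. D2 y u v)"
  unfolding D2_def by (rule smooth_on_dderiv[OF smooth_dF])

lemma linear_dF: "\<xi> \<in> \<Omega> \<Longrightarrow> linear (dderiv F \<xi>)"
  by (rule smooth_on_linear[OF F])

lemma has_derivative_F: "\<xi> \<in> \<Omega> \<Longrightarrow> (F has_derivative dderiv F \<xi>) (at \<xi>)"
  by (rule smooth_on_has_derivative[OF F])

lemma has_derivative_dF: "\<xi> \<in> \<Omega> \<Longrightarrow> ((\<lambda>y. dderiv F y v) has_derivative (\<lambda>u. D2 \<xi> u v)) (at \<xi>)"
  unfolding D2_def by (rule smooth_on_has_derivative[OF smooth_dF])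

lemma has_derivative_D2: "\<xi> \<in> \<Omega> \<Longrightarrow> ((\<lambda>y. D2 y u v) has_derivative (\<lambda>w. D3 \<xi> w u v)) (at \<xi>)"
  unfolding D3_def by (rule smooth_on_has_derivative[OF smooth_D2])

lemma D2_sym: "\<xi> \<in> \<Omega> \<Longrightarrow> D2 \<xi> u v = D2 \<xi> v u"
  unfolding D2_def by (rule symmetric_second_derivative[OF open_\<Omega> _ F])

lemma D3_sym: "\<xi> \<in> \<Omega> \<Longrightarrow> D3 \<xi> w u v = D3 \<xi> u w v"
  unfolding D3_def D2_def by (rule symmetric_second_derivative[OF open_\<Omega> _ smooth_dF])

lemma linear_D2: "\<xi> \<in> \<Omega> \<Longrightarrow> linear (D2 \<xi> u)"
  unfolding D2_def using linear_second_derivative[OF open_\<Omega> _ F] by simp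

lemma linear_D2_left: "\<xi> \<in> \<Omega> \<Longrightarrow> linear (\<lambda>u. D2 \<xi> u v)"
  using has_derivative_linear[OF has_derivative_dF] .

lemma height_dF: assumes "\<xi> \<in> \<Omega>" shows "height k (F \<xi>) (dderiv F \<xi> u) = 0"
proof (cases "k = 0")
  case True
  have "((\<lambda>y. snd (F y)) has_derivative (\<lambda>u. snd (dderiv F \<xi> u))) (at \<xi>)"
    by (rule bounded_linear.has_derivative[OF bounded_linear_snd has_derivative_F[OF assms]])
  moreover have "((\<lambda>y. snd (F y)) has_derivative (\<lambda>u. 0)) (at \<xi>)"
    by (rule has_derivative_transform_within_open[OF has_derivative_const[of 0] open_\<Omega> assms])
      (use F_in True in \<open>auto simp: space_form_def\<close>)
  ultimately have "(\<lambda>u. snd (dderiv F \<xi> u)) = (\<lambda>u. 0)" by (rule has_derivative_unique)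
  then show ?thesis using True by (simp add: height_def fun_eq_iff)
next
  case False
  have "((\<lambda>y. ambient_form k (F y) (F y)) has_derivative
      (\<lambda>u. ambient_form k (F \<xi>) (dderiv F \<xi> u) + ambient_form k (dderiv F \<xi> u) (F \<xi>))) (at \<xi>)"
    by (rule ambient_form.FDERIV[OF has_derivative_F[OF assms] has_derivative_F[OF assms]])
  moreover have "((\<lambda>y. ambient_form k (F y) (F y)) has_derivative (\<lambda>u. 0)) (at \<xi>)"
    by (rule has_derivative_transform_within_open[OF has_derivative_const[of "1 / k"] open_\<Omega> assms])
      (use F_in False in \<open>auto simp: space_form_def\<close>)
  ultimately have "(\<lambda>u. ambient_form k (F \<xi>) (dderiv F \<xi> u) + ambient_form k (dderiv F \<xi> u) (F \<xi>)) = (\<lambda>u. 0)"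
    by (rule has_derivative_unique)
  then show ?thesis using False by (simp add: height_def fun_eq_iff ambient_form_commute[of k "F \<xi>"])
qed

lemma h_pos: assumes "\<xi> \<in> \<Omega>" "u \<noteq> 0" shows "h \<xi> u u > 0"
  unfolding h_eq[OF assms(1)]
proof (rule ambient_form_pos[OF F_in[OF assms(1)] height_dF[OF assms(1)]])
  show "dderiv F \<xi> u \<noteq> 0"
    using inj_dF[OF assms(1)] linear_dF[OF assms(1)] assms(2) linear_injective_0 by blast
qed

lemma h_sym: "\<xi> \<in> \<Omega> \<Longrightarrow> h \<xi> u v = h \<xi> v u"
  by (simp add: h_eq ambient_form_commute)

lemma linear_h: assumes "\<xi> \<in> \<Omega>" shows "linear (h \<xi> u)" "linear (\<lambda>u. h \<xi> u v)"
  using linear_add[OF linear_dF[OF assms]] linear_scale[OF linear_dF[OF assms]]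
  by (auto intro!: linearI simp: h_eq[OF assms] ambient_form_simps)

lemma bilinear_h: "\<xi> \<in> \<Omega> \<Longrightarrow> bilinear (h \<xi>)"
  using linear_h by (simp add: bilinear_def)

lemma h_nondegenerate: assumes "\<xi> \<in> \<Omega>" "\<And>w. h \<xi> z w = h \<xi> z' w" shows "z = z'"
proof (rule ccontr)
  assume "z \<noteq> z'"
  then have "h \<xi> (z - z') (z - z') > 0" using h_pos[OF assms(1)] by simp
  moreover have "h \<xi> (z - z') (z - z') = h \<xi> z (z - z') - h \<xi> z' (z - z')"
    by (rule linear_diff[OF linear_h(2)[OF assms(1)]])
  ultimately show False using assms(2) by simp
qed

text \<open>For \<open>k \<noteq> 0\<close>, differentiate \<open>height_dF\<close> once more: the
  moving base point contributes the metric.\<close>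

lemma height_D2: assumes "\<xi> \<in> \<Omega>" shows "height k (F \<xi>) (D2 \<xi> u v) = - k * h \<xi> u v"
proof (cases "k = 0")
  case True
  have "((\<lambda>y. snd (dderiv F y v)) has_derivative (\<lambda>u. snd (D2 \<xi> u v))) (at \<xi>)"
    by (rule bounded_linear.has_derivative[OF bounded_linear_snd has_derivative_dF[OF assms]])
  moreover have "((\<lambda>y. snd (dderiv F y v)) has_derivative (\<lambda>u. 0)) (at \<xi>)"
    by (rule has_derivative_transform_within_open[OF has_derivative_const[of 0] open_\<Omega> assms])
      (use height_dF True in \<open>auto simp: height_def\<close>)
  ultimately have "(\<lambda>u. snd (D2 \<xi> u v)) = (\<lambda>u. 0)" by (rule has_derivative_unique)
  then show ?thesis using True by (simp add: height_def fun_eq_iff)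
next
  case False
  have "((\<lambda>y. ambient_form k (dderiv F y v) (F y)) has_derivative
      (\<lambda>u. ambient_form k (dderiv F \<xi> v) (dderiv F \<xi> u) + ambient_form k (D2 \<xi> u v) (F \<xi>))) (at \<xi>)"
    by (rule ambient_form.FDERIV[OF has_derivative_dF[OF assms] has_derivative_F[OF assms]])
  moreover have "((\<lambda>y. ambient_form k (dderiv F y v) (F y)) has_derivative (\<lambda>u. 0)) (at \<xi>)"
    by (rule has_derivative_transform_within_open[OF has_derivative_const[of 0] open_\<Omega> assms])
      (use height_dF False in \<open>auto simp: height_def\<close>)
  ultimately have "(\<lambda>u. ambient_form k (dderiv F \<xi> v) (dderiv F \<xi> u) + ambient_form k (D2 \<xi> u v) (F \<xi>)) = (\<lambda>u. 0)"
    by (rule has_derivative_unique)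
  then have "ambient_form k (dderiv F \<xi> v) (dderiv F \<xi> u) + ambient_form k (D2 \<xi> u v) (F \<xi>) = 0" by (rule fun_cong)
  then have "ambient_form k (D2 \<xi> u v) (F \<xi>) = - h \<xi> u v"
    by (simp add: h_eq[OF assms] ambient_form_commute[of k "dderiv F \<xi> v"])
  then show ?thesis using False by (simp add: height_def)
qed

lemma has_derivative_h:
  assumes "\<xi> \<in> \<Omega>"
  shows "((\<lambda>y. h y v w) has_derivative
    (\<lambda>u. ambient_form k (dderiv F \<xi> v) (D2 \<xi> u w) + ambient_form k (D2 \<xi> u v) (dderiv F \<xi> w))) (at \<xi>)"
  by (rule has_derivative_transform_within_open[OF
      ambient_form.FDERIV[OF has_derivative_dF[OF assms] has_derivative_dF[OF assms]] open_\<Omega> assms])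
    (simp add: h_eq)

lemma h_riesz:
  assumes "\<xi> \<in> \<Omega>" "linear l" shows "\<exists>z. \<forall>w. h \<xi> z w = l w"
proof -
  define G where "G z = (\<Sum>b\<in>Basis. h \<xi> z b *\<^sub>R b)" for z
  have G: "G z \<bullet> w = h \<xi> z w" for z w
    unfolding G_def by (rule linear_functional_inner[OF linear_h(1)[OF assms(1)]])
  have lin: "linear G" unfolding G_def
    by (rule linearI) (simp_all add: linear_add[OF linear_h(2)[OF assms(1)]] linear_scale[OF linear_h(2)[OF assms(1)]]
      scaleR_add_left sum.distrib scaleR_sum_right)
  have "inj G" using h_nondegenerate[OF assms(1)] G by (metis injI)
  then have "surj G" using lin linear_injective_imp_surjective by blast
  then obtain z where "G z = (\<Sum>b\<in>Basis. l b *\<^sub>R b)" by (metis surjD)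
  then have "h \<xi> z w = l w" for w using G[of z w] linear_functional_inner[OF assms(2), of w] by simp
  then show ?thesis by blast
qed

text \<open>In the Koszul formula the other second derivatives cancel by \<open>D2_sym\<close>,
  leaving one term twice. So the Christoffel symbol represents the tangential part of
  \<open>D2\<close>.\<close>

lemma h_christoffel:
  assumes "\<xi> \<in> \<Omega>"
  shows "h \<xi> (christoffel h \<xi> u v) w = ambient_form k (D2 \<xi> u v) (dderiv F \<xi> w)"
proof -
  have koszul: "(dderiv (\<lambda>y. h y v w) \<xi> u + dderiv (\<lambda>y. h y u w) \<xi> v - dderiv (\<lambda>y. h y u v) \<xi> w) / 2
      = ambient_form k (D2 \<xi> u v) (dderiv F \<xi> w)" for w
    unfolding dderiv_eqI[OF has_derivative_h[OF assms]]
    using D2_sym[OF assms, of u v] D2_sym[OF assms, of u w] D2_sym[OF assms, of v w]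
    by (simp add: ambient_form_commute[of k "dderiv F \<xi> u"] ambient_form_commute[of k "dderiv F \<xi> v"])
  have "linear (\<lambda>w. ambient_form k (D2 \<xi> u v) (dderiv F \<xi> w))"
    using linear_add[OF linear_dF[OF assms]] linear_scale[OF linear_dF[OF assms]]
    by (auto intro!: linearI simp: ambient_form_simps)
  from h_riesz[OF assms this] obtain z where z: "\<And>w. h \<xi> z w = ambient_form k (D2 \<xi> u v) (dderiv F \<xi> w)" by blast
  have "christoffel h \<xi> u v = z"
    unfolding christoffel_def koszul
    by (rule the_equality) (use z h_nondegenerate[OF assms] in auto)
  then show ?thesis using z by simp
qed

lemma linear_christoffel:
  assumes "\<xi> \<in> \<Omega>"
  shows "linear (christoffel h \<xi> u)" and "linear (\<lambda>u. christoffel h \<xi> u v)"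
proof -
  show "linear (christoffel h \<xi> u)"
    by (rule linearI; rule h_nondegenerate[OF assms])
      (simp_all add: h_christoffel[OF assms] linear_add[OF linear_h(2)[OF assms]] linear_scale[OF linear_h(2)[OF assms]]
        linear_add[OF linear_D2[OF assms]] linear_scale[OF linear_D2[OF assms]] ambient_form_simps)
  show "linear (\<lambda>u. christoffel h \<xi> u v)"
    by (rule linearI; rule h_nondegenerate[OF assms])
      (simp_all add: h_christoffel[OF assms] linear_add[OF linear_h(2)[OF assms]] linear_scale[OF linear_h(2)[OF assms]]
        linear_add[OF linear_D2_left[OF assms]] linear_scale[OF linear_D2_left[OF assms]] ambient_form_simps)
qed

lemma bilinear_\<alpha>: assumes "\<xi> \<in> \<Omega>" shows "bilinear (\<alpha> \<xi>)"
  unfolding bilinear_def \<alpha>_def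
  by (intro conjI allI linearI)
    (simp_all add: linear_add[OF linear_D2[OF assms]] linear_add[OF linear_D2_left[OF assms]]
      linear_scale[OF linear_D2[OF assms]] linear_scale[OF linear_D2_left[OF assms]]
      linear_add[OF linear_christoffel(1)[OF assms]] linear_add[OF linear_christoffel(2)[OF assms]]
      linear_scale[OF linear_christoffel(1)[OF assms]] linear_scale[OF linear_christoffel(2)[OF assms]]
      linear_add[OF linear_h(1)[OF assms]] linear_add[OF linear_h(2)[OF assms]]
      linear_scale[OF linear_h(1)[OF assms]] linear_scale[OF linear_h(2)[OF assms]]
      linear_add[OF linear_dF[OF assms]] linear_scale[OF linear_dF[OF assms]] algebra_simps)

lemma christoffel_sym: "\<xi> \<in> \<Omega> \<Longrightarrow> christoffel h \<xi> u v = christoffel h \<xi> v u"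
  using h_christoffel D2_sym by (intro h_nondegenerate) auto

lemma \<alpha>_sym: "\<xi> \<in> \<Omega> \<Longrightarrow> \<alpha> \<xi> u v = \<alpha> \<xi> v u"
  using christoffel_sym[of \<xi> u v] D2_sym[of \<xi> u v] h_sym[of \<xi> u v] by (simp add: \<alpha>_def)

text \<open>The factor \<open>k\<close> accommodates \<open>k = 0\<close>, where
  \<open>F \<xi>\<close> has height 0.\<close>

lemma height_F: "\<xi> \<in> \<Omega> \<Longrightarrow> k * height k (F \<xi>) (F \<xi>) = k"
  using height_lift[OF F_in] by (cases "k = 0") (simp_all add: lift_def)

lemma height_\<alpha>: assumes "\<xi> \<in> \<Omega>" shows "height k (F \<xi>) (\<alpha> \<xi> u v) = 0"
proof -
  have "height k (F \<xi>) (\<alpha> \<xi> u v) = - k * h \<xi> u v + h \<xi> u v * (k * height k (F \<xi>) (F \<xi>))"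
    by (simp add: \<alpha>_def height_simps height_D2[OF assms] height_dF[OF assms])
  then show ?thesis by (simp only: height_F[OF assms]) simp
qed

lemma scaleR_ambient_F: "\<xi> \<in> \<Omega> \<Longrightarrow> height k (F \<xi>) v = 0 \<Longrightarrow> k * ambient_form k (F \<xi>) v = 0"
  by (auto simp: height_def ambient_form_commute[of k "F \<xi>"] split: if_splits)

lemma \<alpha>_normal: assumes "\<xi> \<in> \<Omega>" shows "ambient_form k (\<alpha> \<xi> u v) (dderiv F \<xi> w) = 0"
proof -
  have "ambient_form k (\<alpha> \<xi> u v) (dderiv F \<xi> w) =
      ambient_form k (D2 \<xi> u v) (dderiv F \<xi> w) - h \<xi> (christoffel h \<xi> u v) w
      + h \<xi> u v * (k * ambient_form k (F \<xi>) (dderiv F \<xi> w))"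
    by (simp add: \<alpha>_def ambient_form_simps h_eq[OF assms])
  then show ?thesis
    by (simp add: h_christoffel[OF assms] scaleR_ambient_F[OF assms height_dF[OF assms]])
qed

text \<open>\<open>h_christoffel\<close> is a linear system for the Gram operator of
  \<open>h\<close>, which is injective by nondegeneracy.\<close>

lemma christoffel_differentiable:
  assumes "\<xi> \<in> \<Omega>" shows "(\<lambda>y. christoffel h y v w) differentiable (at \<xi>)"
proof -
  define G where "G y z = (\<Sum>b\<in>Basis. h y z b *\<^sub>R b)" for y z
  define r where "r y = (\<Sum>b\<in>Basis. ambient_form k (D2 y v w) (dderiv F y b) *\<^sub>R b)" for y
  have G: "G y z \<bullet> w = h y z w" if "y \<in> \<Omega>" for y z w
    unfolding G_def by (rule linear_functional_inner[OF linear_h(1)[OF that]])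
  show ?thesis
  proof (rule linear_system_differentiable[where G = G and r = r, OF open_\<Omega> assms])
    show "linear (G y)" if "y \<in> \<Omega>" for y unfolding G_def
      by (rule linearI) (simp_all add: linear_add[OF linear_h(2)[OF that]] linear_scale[OF linear_h(2)[OF that]]
        scaleR_add_left sum.distrib scaleR_sum_right)
    show "inj (G \<xi>)" using h_nondegenerate[OF assms] G[OF assms] by (metis injI)
    show "(\<lambda>y. G y a) differentiable (at \<xi>)" for a
      unfolding G_def
      by (intro differentiable_sum differentiable_scaleR differentiable_const ballI finite_Basis
          differentiableI[OF has_derivative_h[OF assms]])
    show "r differentiable (at \<xi>)"
      unfolding r_def
      by (intro differentiable_sum differentiable_scaleR differentiable_const ballI finite_Basis
          differentiableI[OF ambient_form.FDERIV[OF has_derivative_D2[OF assms] has_derivative_dF[OF assms]]])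
    show "G y (christoffel h y v w) = r y" if "y \<in> \<Omega>" for y
      unfolding G_def r_def h_christoffel[OF that] ..
  qed
qed

text \<open>With \<open>N\<close> the normal part of \<open>D2\<close> in the flat space, each half
  of the curvature is a third derivative term plus a product of values of \<open>N\<close>; the
  former cancel by \<open>D3_sym\<close>. Passing from \<open>N\<close> to \<open>\<alpha>\<close>
  splits off the part along \<open>F\<close>, which accounts for the curvature \<open>k\<close> of
  the space form.\<close>

lemma gauss_riemann:
  assumes \<xi>: "\<xi> \<in> \<Omega>"
  shows "h \<xi> (riemann h \<xi> u v w) z =
    ambient_form k (\<alpha> \<xi> v w) (\<alpha> \<xi> u z) - ambient_form k (\<alpha> \<xi> u w) (\<alpha> \<xi> v z)
    + k * (h \<xi> v w * h \<xi> u z - h \<xi> u w * h \<xi> v z)"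
proof -
  let ?\<Gamma> = "christoffel h"
  define N where "N u v = D2 \<xi> u v - dderiv F \<xi> (?\<Gamma> \<xi> u v)" for u v
  have N: "ambient_form k (N u v) (N w z) = ambient_form k (\<alpha> \<xi> u v) (\<alpha> \<xi> w z) + k * (h \<xi> u v * h \<xi> w z)" for u v w z
  proof -
    have n: "N u v = \<alpha> \<xi> u v - (k * h \<xi> u v) *\<^sub>R F \<xi>" for u v by (simp add: N_def \<alpha>_def)
    have 0: "k * ambient_form k (F \<xi>) (\<alpha> \<xi> u v) = 0" for u v
      by (rule scaleR_ambient_F[OF \<xi> height_\<alpha>[OF \<xi>]])
    have 1: "k * (k * ambient_form k (F \<xi>) (F \<xi>)) = k"
      using space_form_norm[OF F_in[OF \<xi>]] by (cases "k = 0") auto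
    have "ambient_form k (N u v) (N w z) = ambient_form k (\<alpha> \<xi> u v) (\<alpha> \<xi> w z)
        - h \<xi> u v * (k * ambient_form k (F \<xi>) (\<alpha> \<xi> w z)) - h \<xi> w z * (k * ambient_form k (F \<xi>) (\<alpha> \<xi> u v))
        + h \<xi> u v * h \<xi> w z * (k * (k * ambient_form k (F \<xi>) (F \<xi>)))"
      unfolding n by (simp add: ambient_form_simps ambient_form_commute[of k "\<alpha> \<xi> u v" "F \<xi>"] algebra_simps)
    then show ?thesis by (simp only: 0 1) simp
  qed
  have N_normal: "ambient_form k (N u v) (dderiv F \<xi> w) = 0" for u v w
    using h_christoffel[OF \<xi>, of u v w] by (simp add: N_def ambient_form_simps h_eq[OF \<xi>])
  \<comment> \<open>The inner product of the Christoffel symbol with \<open>z\<close> is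
    differentiated once by the product rule and once through \<open>h_christoffel\<close>;
    comparison isolates the derivative of the symbol.\<close>
  have half: "h \<xi> (dderiv (\<lambda>y. ?\<Gamma> y v w) \<xi> u + ?\<Gamma> \<xi> u (?\<Gamma> \<xi> v w)) z
      = ambient_form k (D3 \<xi> u v w) (dderiv F \<xi> z) + ambient_form k (N v w) (N u z)" for u v
  proof -
    define g where "g = ?\<Gamma> \<xi> v w"
    have hd: "(\<lambda>y. h y a z) differentiable (at \<xi>)" for a
      using has_derivative_h[OF \<xi>] unfolding differentiable_def by blast
    have "((\<lambda>y. h y (?\<Gamma> y v w) z) has_derivative
      (\<lambda>u. dderiv (\<lambda>y. h y (?\<Gamma> \<xi> v w) z) \<xi> u + h \<xi> (dderiv (\<lambda>y. ?\<Gamma> y v w) \<xi> u) z)) (at \<xi>)"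
      by (rule has_derivative_linear_apply[OF open_\<Omega> \<xi> linear_h(2) hd
          dderiv_works[OF christoffel_differentiable[OF \<xi>]]])
    moreover have "((\<lambda>y. h y (?\<Gamma> y v w) z) has_derivative
      (\<lambda>u. ambient_form k (D2 \<xi> v w) (D2 \<xi> u z) + ambient_form k (D3 \<xi> u v w) (dderiv F \<xi> z))) (at \<xi>)"
      by (rule has_derivative_transform_within_open[OF
          ambient_form.FDERIV[OF has_derivative_D2[OF \<xi>] has_derivative_dF[OF \<xi>]] open_\<Omega> \<xi>])
        (simp add: h_christoffel)
    ultimately have "(\<lambda>u. dderiv (\<lambda>y. h y (?\<Gamma> \<xi> v w) z) \<xi> u + h \<xi> (dderiv (\<lambda>y. ?\<Gamma> y v w) \<xi> u) z)
      = (\<lambda>u. ambient_form k (D2 \<xi> v w) (D2 \<xi> u z) + ambient_form k (D3 \<xi> u v w) (dderiv F \<xi> z))"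
      by (rule has_derivative_unique)
    then have "dderiv (\<lambda>y. h y g z) \<xi> u + h \<xi> (dderiv (\<lambda>y. ?\<Gamma> y v w) \<xi> u) z
      = ambient_form k (D2 \<xi> v w) (D2 \<xi> u z) + ambient_form k (D3 \<xi> u v w) (dderiv F \<xi> z)"
      unfolding g_def by (rule fun_cong)
    moreover have "dderiv (\<lambda>y. h y g z) \<xi> u
      = ambient_form k (dderiv F \<xi> g) (D2 \<xi> u z) + ambient_form k (D2 \<xi> u g) (dderiv F \<xi> z)"
      by (simp add: dderiv_eqI[OF has_derivative_h[OF \<xi>]])
    moreover have "h \<xi> (?\<Gamma> \<xi> u g) z = ambient_form k (D2 \<xi> u g) (dderiv F \<xi> z)" by (rule h_christoffel[OF \<xi>])
    moreover have "ambient_form k (N v w) (N u z) = ambient_form k (N v w) (D2 \<xi> u z)"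
      using N_normal[of v w "?\<Gamma> \<xi> u z"] unfolding N_def[of u z] by (simp add: ambient_form_simps)
    moreover have "ambient_form k (N v w) (D2 \<xi> u z) = ambient_form k (D2 \<xi> v w) (D2 \<xi> u z)
        - ambient_form k (dderiv F \<xi> g) (D2 \<xi> u z)"
      unfolding N_def g_def by (simp add: ambient_form_simps)
    ultimately show ?thesis unfolding g_def[symmetric]
      by (simp add: linear_add[OF linear_h(2)[OF \<xi>]])
  qed
  have "riemann h \<xi> u v w = (dderiv (\<lambda>y. ?\<Gamma> y v w) \<xi> u + ?\<Gamma> \<xi> u (?\<Gamma> \<xi> v w))
      - (dderiv (\<lambda>y. ?\<Gamma> y u w) \<xi> v + ?\<Gamma> \<xi> v (?\<Gamma> \<xi> u w))"
    by (simp add: riemann_def)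
  then have "h \<xi> (riemann h \<xi> u v w) z = ambient_form k (N v w) (N u z) - ambient_form k (N u w) (N v z)"
    by (simp add: linear_diff[OF linear_h(2)[OF \<xi>]] half D3_sym[OF \<xi>, of u v w])
  then show ?thesis by (simp add: N algebra_simps)
qed

text \<open>On dependent pairs, about which sectional curvature says nothing, both sides vanish. On
  the others the denominator is positive and can be cleared.\<close>

lemma gauss_constant_curvature:
  assumes \<xi>: "\<xi> \<in> \<Omega>"
    and c: "\<And>u v. u \<noteq> v \<Longrightarrow> independent {u, v} \<Longrightarrow> sectional_curvature h \<xi> u v = c"
  shows "ambient_form k (\<alpha> \<xi> u u) (\<alpha> \<xi> v v) - ambient_form k (\<alpha> \<xi> u v) (\<alpha> \<xi> u v)
    = (c - k) * (h \<xi> u u * h \<xi> v v - h \<xi> u v * h \<xi> u v)"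
proof (cases "\<exists>r. u = r *\<^sub>R v \<or> v = r *\<^sub>R u")
  case True
  have la: "linear (\<alpha> \<xi> x)" "linear (\<lambda>x. \<alpha> \<xi> x y)" for x y
    using bilinear_\<alpha>[OF \<xi>] unfolding bilinear_def by blast+
  from True show ?thesis
    by (auto simp: linear_scale[OF la(1)] linear_scale[OF la(2)] linear_scale[OF linear_h(1)[OF \<xi>]]
      linear_scale[OF linear_h(2)[OF \<xi>]] ambient_form_simps)
next
  case False
  then have ne: "u \<noteq> v" "v \<noteq> 0" by (metis scaleR_one, metis scaleR_zero_left)
  have "u \<notin> span {v}" using False by (auto simp: span_singleton)
  then have "independent {u, v}" using ne by (simp add: independent_insert)
  from c[OF ne(1) this] have K: "h \<xi> (riemann h \<xi> u v v) u / (h \<xi> u u * h \<xi> v v - (h \<xi> u v)\<^sup>2) = c"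
    by (simp add: sectional_curvature_def)
  \<comment> \<open>Its square is \<open>h \<xi> v v\<close> times the Gram determinant, which is
    therefore positive.\<close>
  define w where "w = h \<xi> v v *\<^sub>R u - h \<xi> u v *\<^sub>R v"
  have hv: "h \<xi> v v > 0" using h_pos[OF \<xi> ne(2)] .
  have "w \<noteq> 0"
  proof
    assume "w = 0"
    then have "inverse (h \<xi> v v) *\<^sub>R (h \<xi> v v *\<^sub>R u) = inverse (h \<xi> v v) *\<^sub>R (h \<xi> u v *\<^sub>R v)"
      by (simp add: w_def)
    then have "u = (inverse (h \<xi> v v) * h \<xi> u v) *\<^sub>R v" using hv by simp
    then show False using False by blast
  qed
  then have "h \<xi> w w > 0" using h_pos[OF \<xi>] by simp
  also have "h \<xi> w w = h \<xi> v v * (h \<xi> u u * h \<xi> v v - (h \<xi> u v)\<^sup>2)"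
    unfolding w_def using h_sym[OF \<xi>, of v u]
    by (simp add: linear_diff[OF linear_h(1)[OF \<xi>]] linear_diff[OF linear_h(2)[OF \<xi>]]
      linear_scale[OF linear_h(1)[OF \<xi>]] linear_scale[OF linear_h(2)[OF \<xi>]] algebra_simps power2_eq_square)
  finally have "h \<xi> u u * h \<xi> v v - (h \<xi> u v)\<^sup>2 > 0" using hv by (simp add: zero_less_mult_iff)
  then have "h \<xi> (riemann h \<xi> u v v) u = c * (h \<xi> u u * h \<xi> v v - (h \<xi> u v)\<^sup>2)" using K by (simp add: field_simps)
  then show ?thesis
    using \<alpha>_sym[OF \<xi>, of v u] h_sym[OF \<xi>, of v u] ambient_form_commute[of k "\<alpha> \<xi> v v" "\<alpha> \<xi> u u"]
    by (simp add: gauss_riemann[OF \<xi>] algebra_simps power2_eq_square)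
qed

end

section \<open>The second osculating space\<close>

lemma linear_image_in_span:
  fixes l :: "'v::euclidean_space \<Rightarrow> 'w::euclidean_space"
  assumes "linear l" "\<And>b. b \<in> Basis \<Longrightarrow> l b \<in> span S" shows "l u \<in> span S"
proof -
  have "l u = (\<Sum>b\<in>Basis. (u \<bullet> b) *\<^sub>R l b)"
    using linear_sum[OF assms(1), of "\<lambda>b. (u \<bullet> b) *\<^sub>R b" Basis]
    by (simp add: euclidean_representation linear_scale[OF assms(1)])
  then show ?thesis using assms(2) by (simp add: span_sum span_scale)
qed

context local_immersion
begin

definition N :: "'e \<Rightarrow> ('q \<times> real) set" where
  "N \<xi> = span {\<alpha> \<xi> u v | u v. True}"

text \<open>Finitely many generators, as the Gronwall argument sums over them; they need not be
  independent.\<close>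

definition osculating_frame :: "('e \<Rightarrow> 'q \<times> real) set" where
  "osculating_frame = insert (\<lambda>y. lift k (F y))
     ((\<lambda>b y. dderiv F y b) ` Basis \<union> (\<lambda>(a, b) y. D2 y a b) ` (Basis \<times> Basis))"

text \<open>The position vector is adjoined so that the span catches the image of \<open>F\<close>.
  Built from \<open>D2\<close> rather than \<open>\<alpha>\<close>, the space does not involve the
  metric.\<close>

definition Osc :: "'e \<Rightarrow> ('q \<times> real) set" where
  "Osc \<xi> = span (insert (lift k (F \<xi>)) (range (dderiv F \<xi>) \<union> {D2 \<xi> u v | u v. True}))"

lemma subspace_Osc [simp]: "subspace (Osc \<xi>)"
  by (simp add: Osc_def)

lemma Osc_members: "lift k (F \<xi>) \<in> Osc \<xi>" "dderiv F \<xi> u \<in> Osc \<xi>" "D2 \<xi> u v \<in> Osc \<xi>"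
  unfolding Osc_def by (rule span_base, blast)+

lemma span_at_osculating_frame:
  assumes \<xi>: "\<xi> \<in> \<Omega>" shows "span_at osculating_frame \<xi> = Osc \<xi>"
proof
  show "span_at osculating_frame \<xi> \<subseteq> Osc \<xi>"
    unfolding span_at_def
    by (rule span_minimal) (auto simp: osculating_frame_def Osc_members)
  define S where "S = (\<lambda>G. G \<xi>) ` osculating_frame"
  have 1: "dderiv F \<xi> b \<in> span S" if "b \<in> Basis" for b
    unfolding S_def osculating_frame_def using that by (intro span_base) force
  have 2: "D2 \<xi> a b \<in> span S" if "a \<in> Basis" "b \<in> Basis" for a b
    unfolding S_def osculating_frame_def using that by (intro span_base) force
  have 3: "lift k (F \<xi>) \<in> span S"
    unfolding S_def osculating_frame_def by (intro span_base) force
  have 4: "dderiv F \<xi> u \<in> span S" for u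
    by (rule linear_image_in_span[OF linear_dF[OF \<xi>] 1])
  have 5: "D2 \<xi> u v \<in> span S" for u v
    by (rule linear_image_in_span[OF linear_D2[OF \<xi>]], rule linear_image_in_span[OF linear_D2_left[OF \<xi>] 2])
  show "Osc \<xi> \<subseteq> span_at osculating_frame \<xi>"
    unfolding Osc_def span_at_def S_def[symmetric] by (rule span_minimal) (use 3 4 5 in auto)
qed

lemma scaleR_F_Osc: "(k * r) *\<^sub>R F \<xi> \<in> Osc \<xi>"
proof -
  have "(k * r) *\<^sub>R F \<xi> = r *\<^sub>R (k *\<^sub>R lift k (F \<xi>))" by (simp add: scaleR_lift mult.commute)
  then show ?thesis by (simp only:) (intro subspace_scale subspace_Osc Osc_members)
qed

lemma \<alpha>_in_Osc: "\<alpha> \<xi> u v \<in> Osc \<xi>"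
  unfolding \<alpha>_def by (intro subspace_add subspace_diff subspace_Osc Osc_members scaleR_F_Osc)

lemma height_N: assumes "\<xi> \<in> \<Omega>" "a \<in> N \<xi>" shows "height k (F \<xi>) a = 0"
proof -
  have "N \<xi> \<subseteq> {a. height k (F \<xi>) a = 0}" unfolding N_def
    by (rule span_minimal) (auto simp: height_\<alpha>[OF assms(1)] subspace_def height_simps)
  then show ?thesis using assms(2) by blast
qed

lemma N_normal: assumes "\<xi> \<in> \<Omega>" "a \<in> N \<xi>" shows "ambient_form k a (dderiv F \<xi> w) = 0"
proof -
  have "N \<xi> \<subseteq> {a. ambient_form k a (dderiv F \<xi> w) = 0}" unfolding N_def
    by (rule span_minimal) (auto simp: \<alpha>_normal[OF assms(1)] subspace_def ambient_form_simps)
  then show ?thesis using assms(2) by blast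
qed

text \<open>The tangent image and \<open>N \<xi>\<close> are orthogonal and consist of vectors of
  height 0, where the form is definite, so they meet trivially; \<open>lift k (F \<xi>)\<close> has
  height 1 and is transverse to both.\<close>

lemma dim_Osc: assumes \<xi>: "\<xi> \<in> \<Omega>" shows "dim (Osc \<xi>) = Suc (DIM('e) + dim (N \<xi>))"
proof -
  define T where "T = range (dderiv F \<xi>)"
  have T: "subspace T" unfolding T_def by (rule linear_subspace_image[OF linear_dF[OF \<xi>] subspace_UNIV])
  have Ns: "subspace (N \<xi>)" by (simp add: N_def)
  have "T \<inter> N \<xi> = {0}"
  proof
    show "T \<inter> N \<xi> \<subseteq> {0}"
    proof
      fix x assume x: "x \<in> T \<inter> N \<xi>"
      then obtain u where "x = dderiv F \<xi> u" by (auto simp: T_def)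
      then have "ambient_form k x x = 0" using N_normal[OF \<xi>, of x u] x by simp
      then show "x \<in> {0}" using ambient_form_pos[OF F_in[OF \<xi>] height_N[OF \<xi>], of x] x by fastforce
    qed
  qed (use subspace_0[OF T] subspace_0[OF Ns] in auto)
  then have "dim {x + y | x y. x \<in> T \<and> y \<in> N \<xi>} = dim T + dim (N \<xi>)"
    using dim_sums_Int[OF T Ns] by simp
  moreover have "span (T \<union> N \<xi>) = {x + y | x y. x \<in> T \<and> y \<in> N \<xi>}"
    using T Ns by (auto simp: span_Un span_eq_iff[THEN iffD2])
  ultimately have "dim (T \<union> N \<xi>) = dim T + dim (N \<xi>)" by (metis dim_span)
  moreover have "dim T = DIM('e)" unfolding T_def
    using dim_image_eq[where f = "dderiv F \<xi>" and S = UNIV, OF linear_dF[OF \<xi>]] inj_dF[OF \<xi>] by simp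
  moreover have "lift k (F \<xi>) \<notin> span (T \<union> N \<xi>)"
  proof
    assume "lift k (F \<xi>) \<in> span (T \<union> N \<xi>)"
    moreover have "span (T \<union> N \<xi>) \<subseteq> {a. height k (F \<xi>) a = 0}"
      by (rule span_minimal) (auto simp: T_def height_dF[OF \<xi>] height_N[OF \<xi>] subspace_def height_simps)
    ultimately show False using height_lift[OF F_in[OF \<xi>]] by auto
  qed
  moreover have "Osc \<xi> = span (insert (lift k (F \<xi>)) (T \<union> N \<xi>))"
  proof
    define S where "S = insert (lift k (F \<xi>)) (T \<union> N \<xi>)"
    have m: "lift k (F \<xi>) \<in> span S" "dderiv F \<xi> u \<in> span S" for u
      unfolding S_def T_def by (rule span_base, blast)+
    have a: "\<alpha> \<xi> u v \<in> span S" for u v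
      unfolding S_def N_def by (rule span_base, intro insertI2 UnI2, rule span_base, blast)
    have d: "D2 \<xi> u v \<in> span S" for u v
    proof -
      have "D2 \<xi> u v = \<alpha> \<xi> u v + dderiv F \<xi> (christoffel h \<xi> u v) - h \<xi> u v *\<^sub>R (k *\<^sub>R lift k (F \<xi>))"
        by (simp add: \<alpha>_def scaleR_lift mult.commute)
      then show ?thesis using m a by (simp only:) (intro span_add span_diff span_scale)
    qed
    show "Osc \<xi> \<subseteq> span (insert (lift k (F \<xi>)) (T \<union> N \<xi>))"
      unfolding Osc_def S_def[symmetric] by (rule span_minimal) (use m d in auto)
    have "N \<xi> \<subseteq> Osc \<xi>" unfolding N_def by (rule span_minimal) (auto simp: \<alpha>_in_Osc)
    then show "span (insert (lift k (F \<xi>)) (T \<union> N \<xi>)) \<subseteq> Osc \<xi>"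
      by (intro span_minimal) (auto simp: T_def Osc_members)
  qed
  ultimately show ?thesis by (simp add: dim_insert)
qed

lemma smooth_osculating_frame: "G \<in> osculating_frame \<Longrightarrow> smooth_on \<Omega> G"
  unfolding osculating_frame_def lift_def
  by (auto intro!: smooth_on_add open_\<Omega> F smooth_dF smooth_D2)

end

locale flat_immersion = local_immersion \<Omega> F k h
  for \<Omega> :: "'e::euclidean_space set" and F :: "'e \<Rightarrow> 'q::euclidean_space \<times> real" and k h +
  fixes c :: real
  assumes dim_N: "\<xi> \<in> \<Omega> \<Longrightarrow> Suc (dim (N \<xi>)) = DIM('e)" and c: "c \<noteq> k"
    and curvature: "\<xi> \<in> \<Omega> \<Longrightarrow> u \<noteq> v \<Longrightarrow> independent {u, v} \<Longrightarrow> sectional_curvature h \<xi> u v = c"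
    and no_umbilic: "\<lbrakk>\<xi> \<in> \<Omega>; c > k; \<zeta> \<in> N \<xi>; ambient_form k \<zeta> \<zeta> = 1\<rbrakk> \<Longrightarrow>
      \<exists>u v. ambient_form k (\<alpha> \<xi> u v) \<zeta> \<noteq> sqrt (c - k) * h \<xi> u v"
begin

lemma dim_span_at: "\<xi> \<in> \<Omega> \<Longrightarrow> dim (span_at osculating_frame \<xi>) = 2 * DIM('e)"
  using dim_N[of \<xi>] by (simp add: span_at_osculating_frame dim_Osc)

text \<open>
  A functional vanishing on the osculating space induces, by differentiating its sections,
  a functional on the first normal space whose values on \<open>\<alpha>\<close> are third derivatives of \<open>F\<close>.
  Symmetry of the latter replaces the Codazzi equation.
\<close>

lemma D3_in_Osc:
  assumes \<xi>: "\<xi> \<in> \<Omega>" shows "D3 \<xi> w u v \<in> Osc \<xi>"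
  unfolding Osc_def
proof (rule in_span_orthogonalI)
  fix z assume z: "\<And>x. x \<in> span (insert (lift k (F \<xi>)) (range (dderiv F \<xi>) \<union> {D2 \<xi> u v | u v. True})) \<Longrightarrow> z \<bullet> x = 0"
  then have z: "\<And>x. x \<in> Osc \<xi> \<Longrightarrow> z \<bullet> x = 0" by (simp add: Osc_def)
  have "\<exists>\<mu>. \<forall>v. (\<forall>y\<in>\<Omega>. v y \<in> Osc y) \<longrightarrow> v differentiable (at \<xi>) \<longrightarrow> z \<bullet> dderiv v \<xi> w = \<mu> \<bullet> v \<xi>" for w
  proof (rule section_derivative_functional[OF open_\<Omega> \<xi>, of osculating_frame "2 * DIM('e)" z w])
    show "isCont G \<xi>" if "G \<in> osculating_frame" for G
      using smooth_on_differentiable[OF smooth_osculating_frame[OF that] \<xi>] differentiable_imp_continuous_within by blast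
  qed (use dim_span_at z span_at_osculating_frame \<xi> in auto)
  then obtain \<mu> where \<mu>: "\<And>w v. (\<forall>y\<in>\<Omega>. v y \<in> Osc y) \<Longrightarrow> v differentiable (at \<xi>) \<Longrightarrow> z \<bullet> dderiv v \<xi> w = \<mu> w \<bullet> v \<xi>"
    by metis
  have "((\<lambda>y. lift k (F y)) has_derivative dderiv F \<xi>) (at \<xi>)"
    unfolding lift_def using has_derivative_add[OF has_derivative_F[OF \<xi>] has_derivative_const] by simp
  \<comment> \<open>Derivatives of \<open>lift k (F y)\<close> and of tangent vectors stay in the
    osculating space, so \<open>\<mu> w\<close> kills both and sees \<open>\<alpha>\<close> only
    through \<open>D2\<close>.\<close>
  then have \<mu>0: "\<mu> w \<bullet> lift k (F \<xi>) = 0" for w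
    using \<mu>[of "\<lambda>y. lift k (F y)" w] z[OF Osc_members(2)] Osc_members(1) by (simp add: dderiv_eqI differentiableI)
  have \<mu>1: "\<mu> w \<bullet> dderiv F \<xi> u = 0" for w u
    using \<mu>[of "\<lambda>y. dderiv F y u" w] z[OF Osc_members(3)] Osc_members(2) has_derivative_dF[OF \<xi>, of u]
    by (simp add: dderiv_eqI differentiableI)
  have \<mu>2: "\<mu> w \<bullet> D2 \<xi> u v = z \<bullet> D3 \<xi> w u v" for w u v
    using \<mu>[of "\<lambda>y. D2 y u v" w] Osc_members(3) has_derivative_D2[OF \<xi>, of u v]
    by (simp add: dderiv_eqI differentiableI)
  have \<mu>\<alpha>: "\<mu> w \<bullet> \<alpha> \<xi> u v = z \<bullet> D3 \<xi> w u v" for w u v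
  proof -
    have "\<alpha> \<xi> u v = D2 \<xi> u v - dderiv F \<xi> (christoffel h \<xi> u v) + h \<xi> u v *\<^sub>R (k *\<^sub>R lift k (F \<xi>))"
      by (simp add: \<alpha>_def scaleR_lift mult.commute)
    then show ?thesis using \<mu>0 \<mu>1 \<mu>2 by (simp add: inner_diff_right inner_add_right)
  qed
  interpret flat_pair "\<alpha> \<xi>" "h \<xi>" "ambient_form k" "c - k" "N \<xi>"
  proof
    show "ambient_form k a a > 0" if "a \<in> N \<xi>" "a \<noteq> 0" for a
      using ambient_form_pos[OF F_in[OF \<xi>] height_N[OF \<xi>]] that by blast
    show "ambient_form k (\<alpha> \<xi> u u) (\<alpha> \<xi> v v) - ambient_form k (\<alpha> \<xi> u v) (\<alpha> \<xi> u v)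
      = (c - k) * (h \<xi> u u * h \<xi> v v - h \<xi> u v * h \<xi> u v)" for u v
      by (rule gauss_constant_curvature[OF \<xi> curvature[OF \<xi>]])
  qed (use bilinear_\<alpha>[OF \<xi>] \<alpha>_sym[OF \<xi>] bilinear_h[OF \<xi>] h_sym[OF \<xi>] h_pos[OF \<xi>] bilinear_ambient_form
      ambient_form_commute N_def dim_N[OF \<xi>] c no_umbilic[OF \<xi>] in auto)
  have "\<mu> w \<bullet> \<alpha> \<xi> u v = 0"
  proof (rule symmetric_functional_zero)
    show "linear (\<lambda>x. \<mu> w \<bullet> x)" for w
      by (rule bounded_linear.linear[OF bounded_linear_inner_right])
    show "\<mu> w \<bullet> \<alpha> \<xi> u v = \<mu> u \<bullet> \<alpha> \<xi> w v" for u v w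
      using D3_sym[OF \<xi>, of w u v] by (simp add: \<mu>\<alpha>)
  qed
  then show "z \<bullet> D3 \<xi> w u v = 0" by (simp add: \<mu>\<alpha>)
qed

text \<open>Differentiating a generator raises its order by one; only the derivatives of
  \<open>D2\<close> are not in \<open>Osc\<close> by construction, and \<open>D3_in_Osc\<close>
  covers them.\<close>

theorem Osc_locally_constant:
  assumes \<xi>: "\<xi> \<in> \<Omega>" shows "\<forall>\<^sub>F y in nhds \<xi>. Osc y = Osc \<xi>"
proof -
  have "\<forall>\<^sub>F y in nhds \<xi>. span_at osculating_frame y = span_at osculating_frame \<xi>"
  proof (rule parallel_family_locally_constant[OF open_\<Omega> \<xi>])
    show "finite osculating_frame" by (simp add: osculating_frame_def)
    fix G y w assume G: "G \<in> osculating_frame" and y: "y \<in> \<Omega>"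
    have 0: "((\<lambda>y. lift k (F y)) has_derivative dderiv F y) (at y)"
      unfolding lift_def using has_derivative_add[OF has_derivative_F[OF y] has_derivative_const] by simp
    have "dderiv G y w \<in> Osc y"
      using G Osc_members D3_in_Osc[OF y]
      by (auto simp: osculating_frame_def dderiv_eqI[OF 0] dderiv_eqI[OF has_derivative_dF[OF y]]
        dderiv_eqI[OF has_derivative_D2[OF y]])
    then show "dderiv G y w \<in> span_at osculating_frame y" by (simp add: span_at_osculating_frame[OF y])
  qed (use smooth_osculating_frame dim_span_at in auto)
  moreover have "\<forall>\<^sub>F y in nhds \<xi>. y \<in> \<Omega>" using open_\<Omega> \<xi> by (rule eventually_nhds_in_open)
  ultimately show ?thesis
    by eventually_elim (simp add: span_at_osculating_frame \<xi>)
qed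

end

section \<open>Gluing the charts\<close>

locale immersed_manifold =
  fixes \<A> :: "('a::{t2_space,second_countable_topology}, 'e::euclidean_space) chart set"
    and g :: "('a, 'e) chart \<Rightarrow> 'e \<Rightarrow> 'e \<Rightarrow> 'e \<Rightarrow> real"
    and k :: real and f :: "'a \<Rightarrow> 'q::euclidean_space \<times> real"
  assumes atlas: "smooth_atlas \<A>" and immersion: "isometric_immersion \<A> g k f"
begin

lemma chart:
  assumes "\<phi> \<in> \<A>"
  shows open_chart: "open (fst \<phi>)" and open_coord: "open (coord_domain \<phi>)"
    and homeo: "homeomorphism (fst \<phi>) (coord_domain \<phi>) (snd \<phi>) (param \<phi>)"
    and coord_in: "x \<in> fst \<phi> \<Longrightarrow> snd \<phi> x \<in> coord_domain \<phi>"
    and param_coord: "x \<in> fst \<phi> \<Longrightarrow> param \<phi> (snd \<phi> x) = x"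
    and param_in: "\<xi> \<in> coord_domain \<phi> \<Longrightarrow> param \<phi> \<xi> \<in> fst \<phi>"
    and coord_param: "\<xi> \<in> coord_domain \<phi> \<Longrightarrow> snd \<phi> (param \<phi> \<xi>) = \<xi>"
proof -
  show "open (fst \<phi>)" "open (coord_domain \<phi>)" and h: "homeomorphism (fst \<phi>) (coord_domain \<phi>) (snd \<phi>) (param \<phi>)"
    using atlas assms by (auto simp: smooth_atlas_def)
  show "x \<in> fst \<phi> \<Longrightarrow> snd \<phi> x \<in> coord_domain \<phi>" by (simp add: coord_domain_def)
  show "x \<in> fst \<phi> \<Longrightarrow> param \<phi> (snd \<phi> x) = x" using h by (simp add: homeomorphism_def)
  show "\<xi> \<in> coord_domain \<phi> \<Longrightarrow> param \<phi> \<xi> \<in> fst \<phi>" using h by (auto simp: homeomorphism_def)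
  show "\<xi> \<in> coord_domain \<phi> \<Longrightarrow> snd \<phi> (param \<phi> \<xi>) = \<xi>" using h by (simp add: homeomorphism_def)
qed

lemma chart_exists: obtains \<phi> where "\<phi> \<in> \<A>" "x \<in> fst \<phi>"
proof -
  have "x \<in> (\<Union>\<phi>\<in>\<A>. fst \<phi>)" using atlas unfolding smooth_atlas_def by blast
  then show ?thesis using that by blast
qed

lemma f_in: "f x \<in> space_form k"
  using immersion by (auto simp: isometric_immersion_def)

lemma chart_local_immersion:
  assumes "\<phi> \<in> \<A>" shows "local_immersion (coord_domain \<phi>) (f \<circ> param \<phi>) k (g \<phi>)"
  using immersion assms f_in
  by unfold_locales (auto simp: isometric_immersion_def open_coord)

text \<open>Coordinate objects are moved to points of the manifold, so that several charts can be
  compared at one point.\<close>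

definition tangent_im where "tangent_im \<phi> x = dderiv (f \<circ> param \<phi>) (snd \<phi> x)"
definition hessian where "hessian \<phi> x = local_immersion.D2 (f \<circ> param \<phi>) (snd \<phi> x)"
definition sff where "sff \<phi> x = local_immersion.\<alpha> (f \<circ> param \<phi>) k (g \<phi>) (snd \<phi> x)"
definition osc where "osc \<phi> x = local_immersion.Osc (f \<circ> param \<phi>) k (snd \<phi> x)"
definition nrm where "nrm \<phi> x = local_immersion.N (f \<circ> param \<phi>) k (g \<phi>) (snd \<phi> x)"

text \<open>\<open>T\<close> is the derivative of the coordinate change and \<open>q\<close> its
  second derivative. The Hessian changes by a tangential vector only, which makes its normal
  projection and the osculating space independent of the chart.\<close>

lemma transition:
  assumes \<phi>: "\<phi> \<in> \<A>" "x \<in> fst \<phi>" and \<psi>: "\<psi> \<in> \<A>" "x \<in> fst \<psi>"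
  obtains T q where "\<And>u. tangent_im \<phi> x u = tangent_im \<psi> x (T u)"
    "\<And>u v. hessian \<phi> x u v = hessian \<psi> x (T u) (T v) + tangent_im \<psi> x (q u v)"
proof -
  interpret P: local_immersion "coord_domain \<phi>" "f \<circ> param \<phi>" k "g \<phi>" by (rule chart_local_immersion[OF \<phi>(1)])
  interpret Q: local_immersion "coord_domain \<psi>" "f \<circ> param \<psi>" k "g \<psi>" by (rule chart_local_immersion[OF \<psi>(1)])
  define W where "W = snd \<phi> ` (fst \<phi> \<inter> fst \<psi>)"
  define \<tau> where "\<tau> = snd \<psi> \<circ> param \<phi>"
  define \<xi> where "\<xi> = snd \<phi> x"
  have \<tau>_smooth: "smooth_on W \<tau>" using atlas \<phi> \<psi> unfolding smooth_atlas_def W_def \<tau>_def by blast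
  have "W = coord_domain \<phi> \<inter> param \<phi> -` fst \<psi>"
    using param_coord[OF \<phi>(1)] param_in[OF \<phi>(1)] coord_param[OF \<phi>(1)]
    by (force simp: W_def coord_domain_def)
  then have W: "open W"
    using homeo[OF \<phi>(1)] open_coord[OF \<phi>(1)] open_chart[OF \<psi>(1)]
    by (simp add: homeomorphism_def continuous_open_preimage)
  have \<xi>: "\<xi> \<in> W" using \<phi> \<psi> by (simp add: \<xi>_def W_def)
  have \<tau>\<xi>: "\<tau> \<xi> = snd \<psi> x" using \<phi> by (simp add: \<tau>_def \<xi>_def param_coord)
  have \<tau>W: "\<tau> y \<in> coord_domain \<psi>" "(f \<circ> param \<phi>) y = (f \<circ> param \<psi>) (\<tau> y)" if "y \<in> W" for y
    using that param_coord[OF \<phi>(1)] param_coord[OF \<psi>(1)] coord_in[OF \<psi>(1)] by (auto simp: W_def \<tau>_def)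
  have d\<tau>: "(\<tau> has_derivative dderiv \<tau> y) (at y)" if "y \<in> W" for y
    by (rule smooth_on_has_derivative[OF \<tau>_smooth that])
  have 1: "dderiv (f \<circ> param \<phi>) y u = dderiv (f \<circ> param \<psi>) (\<tau> y) (dderiv \<tau> y u)" if "y \<in> W" for y u
  proof -
    have "((\<lambda>y. (f \<circ> param \<psi>) (\<tau> y)) has_derivative (\<lambda>u. dderiv (f \<circ> param \<psi>) (\<tau> y) (dderiv \<tau> y u))) (at y)"
      by (rule has_derivative_compose[OF d\<tau>[OF that] Q.has_derivative_F[OF \<tau>W(1)[OF that]]])
    then have "((f \<circ> param \<phi>) has_derivative (\<lambda>u. dderiv (f \<circ> param \<psi>) (\<tau> y) (dderiv \<tau> y u))) (at y)"
      by (rule has_derivative_transform_within_open[OF _ W that]) (simp add: \<tau>W(2)[symmetric] del: o_apply)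
    then show ?thesis by (simp add: dderiv_eqI)
  qed
  have 2: "P.D2 \<xi> u v = Q.D2 (\<tau> \<xi>) (dderiv \<tau> \<xi> u) (dderiv \<tau> \<xi> v)
      + dderiv (f \<circ> param \<psi>) (\<tau> \<xi>) (dderiv (\<lambda>y. dderiv \<tau> y v) \<xi> u)" for u v
  proof -
    have m: "((\<lambda>y. dderiv (f \<circ> param \<psi>) (\<tau> y) a) has_derivative (\<lambda>u. Q.D2 (\<tau> \<xi>) (dderiv \<tau> \<xi> u) a)) (at \<xi>)" for a
      by (rule has_derivative_compose[OF d\<tau>[OF \<xi>] Q.has_derivative_dF[OF \<tau>W(1)[OF \<xi>]]])
    have "((\<lambda>y. dderiv (f \<circ> param \<psi>) (\<tau> y) (dderiv \<tau> y v)) has_derivative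
       (\<lambda>u. dderiv (\<lambda>y. dderiv (f \<circ> param \<psi>) (\<tau> y) (dderiv \<tau> \<xi> v)) \<xi> u
          + dderiv (f \<circ> param \<psi>) (\<tau> \<xi>) (dderiv (\<lambda>y. dderiv \<tau> y v) \<xi> u))) (at \<xi>)"
      by (rule has_derivative_linear_apply[OF W \<xi> Q.linear_dF[OF \<tau>W(1)] differentiableI[OF m]
          smooth_on_has_derivative[OF smooth_on_dderiv[OF \<tau>_smooth] \<xi>]])
    then have "((\<lambda>y. dderiv (f \<circ> param \<phi>) y v) has_derivative
       (\<lambda>u. dderiv (\<lambda>y. dderiv (f \<circ> param \<psi>) (\<tau> y) (dderiv \<tau> \<xi> v)) \<xi> u
          + dderiv (f \<circ> param \<psi>) (\<tau> \<xi>) (dderiv (\<lambda>y. dderiv \<tau> y v) \<xi> u))) (at \<xi>)"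
      by (rule has_derivative_transform_within_open[OF _ W \<xi>]) (simp add: 1)
    then show ?thesis by (simp add: P.D2_def dderiv_eqI dderiv_eqI[OF m])
  qed
  show ?thesis
    by (rule that[of "dderiv \<tau> \<xi>" "\<lambda>u v. dderiv (\<lambda>y. dderiv \<tau> y v) \<xi> u"])
      (use 1[OF \<xi>] 2 in \<open>simp_all add: tangent_im_def hessian_def \<tau>\<xi> flip: \<xi>_def\<close>)
qed

lemma normal_space_eq:
  assumes \<phi>: "\<phi> \<in> \<A>" "x \<in> fst \<phi>"
  shows "normal_space \<A> k f x = {\<eta>. height k (f x) \<eta> = 0 \<and> (\<forall>u. ambient_form k \<eta> (tangent_im \<phi> x u) = 0)}"
proof -
  have "ambient_form k \<eta> (dderiv (f \<circ> param \<psi>) (snd \<psi> x) u) = 0"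
    if \<eta>: "\<forall>u. ambient_form k \<eta> (tangent_im \<phi> x u) = 0" and \<psi>: "\<psi> \<in> \<A>" "x \<in> fst \<psi>" for \<eta> \<psi> u
  proof -
    obtain T q where T: "\<And>u. tangent_im \<psi> x u = tangent_im \<phi> x (T u)"
      "\<And>u v. hessian \<psi> x u v = hessian \<phi> x (T u) (T v) + tangent_im \<phi> x (q u v)"
      by (rule transition[OF \<psi> \<phi>]) blast
    from T(1)[of u] \<eta> show ?thesis by (simp add: tangent_im_def)
  qed
  with \<phi> show ?thesis unfolding normal_space_def tangent_space_form[OF f_in]
    by (auto simp: tangent_im_def)
qed

text \<open>The tangent vector \<open>a\<close> is there because of \<open>transition\<close>: a
  Hessian from any other chart has this form, so all charts are covered at once.\<close>

lemma normal_projection_hessian: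
  assumes \<phi>: "\<phi> \<in> \<A>" "x \<in> fst \<phi>"
  shows "orth_proj k (normal_space \<A> k f x) (space_form_cov k (f x) (hessian \<phi> x u v + tangent_im \<phi> x a)) = sff \<phi> x u v"
proof -
  interpret P: local_immersion "coord_domain \<phi>" "f \<circ> param \<phi>" k "g \<phi>" by (rule chart_local_immersion[OF \<phi>(1)])
  define \<xi> where "\<xi> = snd \<phi> x"
  have \<xi>: "\<xi> \<in> coord_domain \<phi>" "(f \<circ> param \<phi>) \<xi> = f x" using \<phi> by (simp_all add: \<xi>_def coord_in param_coord)
  have tan: "tangent_im \<phi> x = dderiv (f \<circ> param \<phi>) \<xi>" by (simp add: tangent_im_def \<xi>_def)
  have ht: "height k (f x) (tangent_im \<phi> x a) = 0" for a using P.height_dF[OF \<xi>(1)] \<xi>(2) by (simp add: tan del: o_apply)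
  have hh: "height k (f x) (hessian \<phi> x u v) = - k * g \<phi> \<xi> u v"
    using P.height_D2[OF \<xi>(1)] \<xi>(2) by (simp add: hessian_def \<xi>_def)
  have "space_form_cov k (f x) (hessian \<phi> x u v + tangent_im \<phi> x a)
      = hessian \<phi> x u v + tangent_im \<phi> x a + (k * g \<phi> \<xi> u v) *\<^sub>R f x"
    by (simp add: space_form_cov_eq[OF f_in] height_simps ht hh zero_prod_def[symmetric])
  moreover have "sff \<phi> x u v = hessian \<phi> x u v - tangent_im \<phi> x (christoffel (g \<phi>) \<xi> u v) + (k * g \<phi> \<xi> u v) *\<^sub>R f x"
    using \<xi>(2) by (simp add: sff_def P.\<alpha>_def hessian_def tan flip: \<xi>_def)
  ultimately have cov: "space_form_cov k (f x) (hessian \<phi> x u v + tangent_im \<phi> x a) - sff \<phi> x u v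
      = tangent_im \<phi> x a + tangent_im \<phi> x (christoffel (g \<phi>) \<xi> u v)" by simp
  show ?thesis
  proof (rule orth_proj_eqI)
    show "subspace (normal_space \<A> k f x)"
      unfolding normal_space_eq[OF \<phi>] by (auto simp: subspace_def height_simps ambient_form_simps)
    show "ambient_form k v v > 0" if "v \<in> normal_space \<A> k f x" "v \<noteq> 0" for v
      using that unfolding normal_space_eq[OF \<phi>] by (intro ambient_form_pos[OF f_in[of x]]) auto
    show "sff \<phi> x u v \<in> normal_space \<A> k f x"
      using P.height_\<alpha>[OF \<xi>(1)] P.\<alpha>_normal[OF \<xi>(1)] \<xi>(2)
      by (simp add: normal_space_eq[OF \<phi>] sff_def tan flip: \<xi>_def)
    show "ambient_form k (space_form_cov k (f x) (hessian \<phi> x u v + tangent_im \<phi> x a) - sff \<phi> x u v) w = 0"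
      if "w \<in> normal_space \<A> k f x" for w
      using that unfolding cov by (simp add: normal_space_eq[OF \<phi>] ambient_form_simps ambient_form_commute[of k _ w])
  qed
qed

lemma second_ff_eq:
  assumes \<phi>: "\<phi> \<in> \<A>" "x \<in> fst \<phi>" shows "second_ff \<A> k f \<phi> x u v = sff \<phi> x u v"
proof -
  interpret P: local_immersion "coord_domain \<phi>" "f \<circ> param \<phi>" k "g \<phi>" by (rule chart_local_immersion[OF \<phi>(1)])
  have "tangent_im \<phi> x 0 = 0"
    using linear_0[OF P.linear_dF[OF coord_in[OF \<phi>]]] by (simp add: tangent_im_def)
  then show ?thesis using normal_projection_hessian[OF \<phi>, of u v 0]
    by (simp add: second_ff_def hessian_def P.D2_def)
qed

lemma first_normal_space_eq:
  assumes \<phi>: "\<phi> \<in> \<A>" "x \<in> fst \<phi>" shows "first_normal_space \<A> k f x = nrm \<phi> x"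
proof -
  interpret P: local_immersion "coord_domain \<phi>" "f \<circ> param \<phi>" k "g \<phi>" by (rule chart_local_immersion[OF \<phi>(1)])
  have "second_ff \<A> k f \<psi> x u v \<in> {sff \<phi> x u v | u v. True}" if \<psi>: "\<psi> \<in> \<A>" "x \<in> fst \<psi>" for \<psi> u v
  proof -
    obtain T q where T: "\<And>u. tangent_im \<psi> x u = tangent_im \<phi> x (T u)"
      "\<And>u v. hessian \<psi> x u v = hessian \<phi> x (T u) (T v) + tangent_im \<phi> x (q u v)"
      by (rule transition[OF \<psi> \<phi>]) blast
    have "hessian \<psi> x u v = dderiv (\<lambda>\<xi>. dderiv (f \<circ> param \<psi>) \<xi> v) (snd \<psi> x) u"
      using chart_local_immersion[OF \<psi>(1)] by (simp add: hessian_def local_immersion.D2_def)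
    then have "second_ff \<A> k f \<psi> x u v = sff \<phi> x (T u) (T v)"
      using normal_projection_hessian[OF \<phi>, of "T u" "T v" "q u v"] by (simp add: second_ff_def T(2))
    then show ?thesis by blast
  qed
  moreover have "sff \<phi> x u v \<in> {second_ff \<A> k f \<psi> x u v | \<psi> u v. \<psi> \<in> \<A> \<and> x \<in> fst \<psi>}" for u v
    unfolding second_ff_eq[OF \<phi>, symmetric] using \<phi> by blast
  ultimately have "{second_ff \<A> k f \<psi> x u v | \<psi> u v. \<psi> \<in> \<A> \<and> x \<in> fst \<psi>} = {sff \<phi> x u v | u v. True}"
    by blast
  then show ?thesis by (simp add: first_normal_space_def nrm_def P.N_def sff_def)
qed

lemma osc_subset:
  assumes \<phi>: "\<phi> \<in> \<A>" "x \<in> fst \<phi>" and \<psi>: "\<psi> \<in> \<A>" "x \<in> fst \<psi>" shows "osc \<phi> x \<subseteq> osc \<psi> x"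
proof -
  interpret P: local_immersion "coord_domain \<phi>" "f \<circ> param \<phi>" k "g \<phi>" by (rule chart_local_immersion[OF \<phi>(1)])
  interpret Q: local_immersion "coord_domain \<psi>" "f \<circ> param \<psi>" k "g \<psi>" by (rule chart_local_immersion[OF \<psi>(1)])
  obtain T q where T: "\<And>u. tangent_im \<phi> x u = tangent_im \<psi> x (T u)"
      "\<And>u v. hessian \<phi> x u v = hessian \<psi> x (T u) (T v) + tangent_im \<psi> x (q u v)"
    by (rule transition[OF \<phi> \<psi>]) blast
  have m: "lift k (f x) \<in> osc \<psi> x" "tangent_im \<psi> x u \<in> osc \<psi> x" "hessian \<psi> x u v \<in> osc \<psi> x" for u v
    using Q.Osc_members[of "snd \<psi> x"] \<psi> by (simp_all add: osc_def tangent_im_def hessian_def param_coord)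
  have s: "subspace (osc \<psi> x)" by (simp add: osc_def)
  have "tangent_im \<phi> x u \<in> osc \<psi> x" "hessian \<phi> x u v \<in> osc \<psi> x" for u v
    using m T subspace_add[OF s] by auto
  then show ?thesis
    unfolding osc_def[of \<phi>] P.Osc_def using m(1) s \<phi>
    by (intro span_minimal) (auto simp: tangent_im_def hessian_def param_coord)
qed

lemma osc_eq:
  assumes "\<phi> \<in> \<A>" "x \<in> fst \<phi>" "\<psi> \<in> \<A>" "x \<in> fst \<psi>" shows "osc \<phi> x = osc \<psi> x"
  using osc_subset assms by blast

text \<open>Nondegeneracy of the metric supplies the uniqueness that the definite description in
  \<open>shape_operator\<close> requires.\<close>

lemma shape_operator_umbilic:
  assumes \<phi>: "\<phi> \<in> \<A>" "x \<in> fst \<phi>"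
    and \<zeta>: "\<And>u v. ambient_form k (sff \<phi> x u v) \<zeta> = r * g \<phi> (snd \<phi> x) u v"
  shows "shape_operator \<A> g k f \<phi> x \<zeta> = (\<lambda>u. r *\<^sub>R u)"
proof -
  interpret P: local_immersion "coord_domain \<phi>" "f \<circ> param \<phi>" k "g \<phi>" by (rule chart_local_immersion[OF \<phi>(1)])
  note \<xi> = coord_in[OF \<phi>]
  show ?thesis unfolding shape_operator_def second_ff_eq[OF \<phi>] \<zeta>
  proof (rule the_equality)
    show "\<forall>u v. g \<phi> (snd \<phi> x) (r *\<^sub>R u) v = r * g \<phi> (snd \<phi> x) u v"
      by (simp add: linear_scale[OF P.linear_h(2)[OF \<xi>]])
    fix B assume B: "\<forall>u v. g \<phi> (snd \<phi> x) (B u) v = r * g \<phi> (snd \<phi> x) u v"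
    show "B = (\<lambda>u. r *\<^sub>R u)"
      by (rule ext, rule P.h_nondegenerate[OF \<xi>]) (simp add: B linear_scale[OF P.linear_h(2)[OF \<xi>]])
  qed
qed

text \<open>The last locale assumption carries the content: a unit vector of \<open>P.N\<close>
  violating it would be normal with shape operator \<open>sqrt (c - k)\<close> times the identity,
  that is, a weak-umbilic direction.\<close>

lemma chart_flat_immersion:
  assumes \<phi>: "\<phi> \<in> \<A>" and dim: "\<And>x. Suc (dim (first_normal_space \<A> k f x)) = DIM('e)" and c: "c \<noteq> k"
    and curv: "constant_sectional_curvature \<A> g c"
    and umb: "\<And>x. c > k \<Longrightarrow> \<not> weak_umbilic \<A> g c k f x"
  shows "flat_immersion (coord_domain \<phi>) (f \<circ> param \<phi>) k (g \<phi>) c"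
proof -
  interpret P: local_immersion "coord_domain \<phi>" "f \<circ> param \<phi>" k "g \<phi>" by (rule chart_local_immersion[OF \<phi>])
  have N: "P.N \<xi> = nrm \<phi> (param \<phi> \<xi>)" "P.\<alpha> \<xi> = sff \<phi> (param \<phi> \<xi>)" if "\<xi> \<in> coord_domain \<phi>" for \<xi>
    using coord_param[OF \<phi> that] by (simp_all add: nrm_def sff_def)
  show ?thesis
  proof
    fix \<xi> assume \<xi>: "\<xi> \<in> coord_domain \<phi>"
    define x where "x = param \<phi> \<xi>"
    have x: "x \<in> fst \<phi>" "snd \<phi> x = \<xi>" using \<xi> \<phi> by (simp_all add: x_def param_in coord_param)
    show "Suc (dim (P.N \<xi>)) = DIM('e)"
      using dim[of x] first_normal_space_eq[OF \<phi> x(1)] N(1)[OF \<xi>] by (simp add: x_def)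
    show "sectional_curvature (g \<phi>) \<xi> u v = c" if "u \<noteq> v" "independent {u, v}" for u v
      using curv \<phi> \<xi> that by (simp add: constant_sectional_curvature_def)
    fix \<zeta> assume ck: "c > k" and \<zeta>: "\<zeta> \<in> P.N \<xi>" "ambient_form k \<zeta> \<zeta> = 1"
    show "\<exists>u v. ambient_form k (P.\<alpha> \<xi> u v) \<zeta> \<noteq> sqrt (c - k) * g \<phi> \<xi> u v"
    proof (rule ccontr)
      assume "\<not> ?thesis"
      then have "shape_operator \<A> g k f \<phi> x \<zeta> = (\<lambda>u. sqrt (c - k) *\<^sub>R u)"
        using N(2)[OF \<xi>] x by (intro shape_operator_umbilic[OF \<phi> x(1)]) (simp add: x_def)
      moreover have "\<zeta> \<in> normal_space \<A> k f x"
        unfolding normal_space_eq[OF \<phi> x(1)]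
        using P.height_N[OF \<xi> \<zeta>(1)] P.N_normal[OF \<xi> \<zeta>(1)] by (simp add: tangent_im_def x(2)) (simp add: x_def)
      ultimately have "weak_umbilic \<A> g c k f x" using \<zeta>(2) \<phi> x(1) unfolding weak_umbilic_def by blast
      then show False using umb[OF ck] by blast
    qed
  qed (rule c)
qed

end

theorem theorem1:
  fixes n p :: nat
    and c k :: real
    and \<A> :: "('a::{t2_space,second_countable_topology}, 'e::euclidean_space) chart set"
    and g :: "('a, 'e) chart \<Rightarrow> 'e \<Rightarrow> 'e \<Rightarrow> 'e \<Rightarrow> real"
    and f :: "'a \<Rightarrow> 'q::euclidean_space \<times> real"
  assumes "n \<ge> 2" and "p \<ge> 1" and "c \<noteq> k"
    and "DIM('e) = n" and "DIM('q) = n + p"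
    and "smooth_atlas \<A>" and "connected (UNIV :: 'a set)"
    and "riemannian_metric \<A> g" and "constant_sectional_curvature \<A> g c"
    and "isometric_immersion \<A> g k f" and "substantial k f"
    and "\<And>x. dim (first_normal_space \<A> k f x) = n - 1"
    and "\<And>x. c > k \<Longrightarrow> \<not> weak_umbilic \<A> g c k f x"
  shows "p = n - 1"
proof -
  interpret immersed_manifold \<A> g k f using assms by unfold_locales
  have dimN: "Suc (dim (first_normal_space \<A> k f x)) = DIM('e)" for x using assms by simp
  \<comment> \<open>One chart is chosen at each point; \<open>osc_eq\<close> makes the choice
    immaterial for \<open>Os\<close>.\<close>
  define ch where "ch x = (SOME \<phi>. \<phi> \<in> \<A> \<and> x \<in> fst \<phi>)" for x
  have ch: "ch x \<in> \<A>" "x \<in> fst (ch x)" for x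
    using someI_ex[of "\<lambda>\<phi>. \<phi> \<in> \<A> \<and> x \<in> fst \<phi>"] chart_exists[of x] unfolding ch_def by blast+
  define Os where "Os x = osc (ch x) x" for x
  have "\<forall>\<^sub>F y in at x. Os x = Os y" for x
  proof -
    let ?\<phi> = "ch x"
    interpret P: flat_immersion "coord_domain ?\<phi>" "f \<circ> param ?\<phi>" k "g ?\<phi>" c
      by (rule chart_flat_immersion[OF ch(1) dimN assms(3) assms(9) assms(13)])
    have "isCont (snd ?\<phi>) x"
      using homeo[OF ch(1)] open_chart[OF ch(1)] ch(2)
      by (auto simp: homeomorphism_def continuous_on_eq_continuous_at)
    then have "filterlim (snd ?\<phi>) (nhds (snd ?\<phi> x)) (nhds x)"
      by (simp add: isCont_def tendsto_at_iff_tendsto_nhds)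
    with P.Osc_locally_constant[OF coord_in[OF ch]]
    have "\<forall>\<^sub>F y in nhds x. P.Osc (snd ?\<phi> y) = P.Osc (snd ?\<phi> x)" by (rule eventually_compose_filterlim)
    moreover have "\<forall>\<^sub>F y in nhds x. y \<in> fst ?\<phi>"
      by (rule eventually_nhds_in_open[OF open_chart[OF ch(1)] ch(2)])
    ultimately have "\<forall>\<^sub>F y in nhds x. Os x = Os y"
    proof eventually_elim
      case (elim y)
      have "Os y = osc ?\<phi> y" unfolding Os_def by (rule osc_eq[OF ch ch(1) elim(2)])
      then show ?case using elim(1) by (simp add: Os_def osc_def)
    qed
    then show ?thesis by (simp add: eventually_at_filter eventually_mono)
  qed
  then have const: "Os x = Os y" for x y
    using connected_local_const[OF assms(7), of x y Os] by simp
  \<comment> \<open>Since \<open>Os\<close> is constant, \<open>undefined\<close> serves as an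
    arbitrary base point.\<close>
  define L where "L = Os undefined"
  interpret P: flat_immersion "coord_domain (ch undefined)" "f \<circ> param (ch undefined)" k "g (ch undefined)" c
    by (rule chart_flat_immersion[OF ch(1) dimN assms(3) assms(9) assms(13)])
  have L: "subspace L" by (simp add: L_def Os_def osc_def)
  have dimL: "dim L = 2 * n"
    using P.dim_Osc[OF coord_in[OF ch]] P.dim_N[OF coord_in[OF ch]] assms(4) by (simp add: L_def Os_def osc_def)
  have "range f \<subseteq> linear_section k L"
  proof (rule image_subsetI)
    fix x
    interpret Q: local_immersion "coord_domain (ch x)" "f \<circ> param (ch x)" k "g (ch x)"
      by (rule chart_local_immersion[OF ch(1)])
    have "lift k (f x) \<in> Os x"
      using Q.Osc_members(1)[of "snd (ch x) x"] by (simp add: Os_def osc_def param_coord[OF ch])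
    then show "f x \<in> linear_section k L" using const[of x undefined] f_in by (simp add: linear_section_def L_def)
  qed
  \<comment> \<open>Otherwise the section by \<open>L\<close>, of dimension
    \<open>dim L - 1\<close>, would contradict substantiality; this bounds \<open>p\<close> from
    above.\<close>
  then have "\<not> 2 * n - 1 < n + p"
    using totally_geodesic_linear_section[OF L, of k] assms(5,11) unfolding substantial_def dimL by auto
  \<comment> \<open>The subspace \<open>L\<close> lies in an ambient space of dimension
    \<open>n + p + 1\<close>; this bounds \<open>p\<close> from below.\<close>
  moreover have "2 * n \<le> n + p + 1"
    using dim_subset_UNIV[of L] dimL assms(5) by simp
  ultimately show ?thesis using assms(1) by simp
qed

end
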